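(* (Strong uniqueness property) Let $p\in(1,\infty]$, let $\Omega\subset\mathbb{R}^d$ be a bounded $C^2$-domain, and let $g\in C(\partial\Omega)$. Let $u$ and $v$ be respectively a generalized viscosity $p$-subsolution and a generalized viscosity $p$-supersolution of the Dirichlet problem $-\Delta_p w=0$ in $\Omega$, $w=g$ on $\partial\Omega$. Then $u\le v$ in $\overline{\Omega}$.
   Context: For $p\in(1,\infty)$, $\Delta_p\phi=\mathrm{div}(|\nabla\phi|^{p-2}\nabla\phi)$, and $\Delta_\infty\phi=\langle D^2\phi\,\nabla\phi,\nabla\phi\rangle$. $\mathrm{USC}(\overline\Omega)$, $\mathrm{LSC}(\overline\Omega)$ denote upper and lower semicontinuous functions. $u\in \mathrm{USC}(\overline\Omega)$ is a generalized viscosity $p$-subsolution of the Dirichlet problem if whenever $x_0\in\overline\Omega$ and $\phi\in C^2(\overline\Omega)$ satisfy $\phi(x_0)=u(x_0)$, $\phi(x)>u(x)$ for $x\ne x_0$, and $\nabla\phi(x_0)\neq0$, then $-\Delta_p\phi(x_0)\le0$ if $x_0\in\Omega$, and $\min\{-\Delta_p\phi(x_0),\,u(x_0)-g(x_0)\}\le0$ if $x_0\in\partial\Omega$. $u\in \mathrm{LSC}(\overline\Omega)$ is a generalized viscosity $p$-supersolution if whenever $x_0\in\overline\Omega$ and $\phi\in C^2(\overline\Omega)$ satisfy $\phi(x_0)=u(x_0)$, $\phi(x)<u(x)$ for $x\ne x_0$, and $\nabla\phi(x_0)\neq0$, then $-\Delta_p\phi(x_0)\ge0$ if $x_0\in\Omega$,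 and $\max\{-\Delta_p\phi(x_0),\,u(x_0)-g(x_0)\}\ge0$ if $x_0\in\partial\Omega$. *)

theory Defs
  imports "HOL-Analysis.Analysis"
begin

definition usc_on :: "'a::topological_space set \<Rightarrow> ('a \<Rightarrow> real) \<Rightarrow> bool" where
  "usc_on S u \<longleftrightarrow> (\<forall>x\<in>S. \<forall>a. u x < a \<longrightarrow> (\<forall>\<^sub>F y in at x within S. u y < a))"

definition lsc_on :: "'a::topological_space set \<Rightarrow> ('a \<Rightarrow> real) \<Rightarrow> bool" where
  "lsc_on S u \<longleftrightarrow> (\<forall>x\<in>S. \<forall>a. a < u x \<longrightarrow> (\<forall>\<^sub>F y in at x within S. a < u y))"

text \<open>The values of the following operators are only meaningful at points of
  differentiability of their arguments.\<close>

definition grad :: "('a::euclidean_space \<Rightarrow> real) \<Rightarrow> 'a \<Rightarrow> 'a" where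
  "grad \<phi> x = (THE D. GDERIV \<phi> x :> D)"

definition divergence :: "('a::euclidean_space \<Rightarrow> 'a) \<Rightarrow> 'a \<Rightarrow> real" where
  "divergence F x = (\<Sum>b\<in>Basis. frechet_derivative F (at x) b \<bullet> b)"

definition hess :: "('a::euclidean_space \<Rightarrow> real) \<Rightarrow> 'a \<Rightarrow> 'a \<Rightarrow> 'a" where
  "hess \<phi> x = frechet_derivative (grad \<phi>) (at x)"

text \<open>In finite dimension, continuity of the linear map \<open>hess \<phi> x\<close> in \<open>x\<close> is the same as
  continuity of \<open>hess \<phi> x h\<close> for each direction \<open>h\<close>.\<close>

definition C2_on :: "'a::euclidean_space set \<Rightarrow> ('a \<Rightarrow> real) \<Rightarrow> bool" where
  "C2_on U \<phi> \<longleftrightarrow> open U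
     \<and> (\<forall>x\<in>U. \<phi> differentiable (at x))
     \<and> (\<forall>x\<in>U. grad \<phi> differentiable (at x))
     \<and> (\<forall>h. continuous_on U (\<lambda>x. hess \<phi> x h))"

text \<open>Functions of class \<open>C\<^sup>2\<close> up to the boundary are those that are \<open>C\<^sup>2\<close> on a neighbourhood of
  the closure, so that derivatives at boundary points are ordinary derivatives. On a bounded
  \<open>C\<^sup>2\<close>-domain every function whose derivatives of order at most 2 extend continuously to the
  closure coincides there with such a function (Whitney extension), and derivatives at boundary
  points do not depend on the extension.\<close>

definition C2_closure :: "'a::euclidean_space set \<Rightarrow> ('a \<Rightarrow> real) \<Rightarrow> bool" where
  "C2_closure \<Omega> \<phi> \<longleftrightarrow> (\<exists>U. closure \<Omega> \<subseteq> U \<and> C2_on U \<phi>)"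

text \<open>Near each boundary point the domain is, up to a rotation, the region strictly above the graph
  of a \<open>C\<^sup>2\<close> function of \<open>d - 1\<close> variables. Here \<open>e\<close> is the upward direction, and \<open>\<gamma>\<close> is only
  evaluated on the hyperplane orthogonal to \<open>e\<close>; a \<open>C\<^sup>2\<close> function on this hyperplane is the
  restriction of one on the whole space (compose with the orthogonal projection).\<close>

definition C2_domain :: "'a::euclidean_space set \<Rightarrow> bool" where
  "C2_domain \<Omega> \<longleftrightarrow> open \<Omega> \<and> connected \<Omega> \<and> \<Omega> \<noteq> {}
     \<and> (\<forall>x0\<in>frontier \<Omega>. \<exists>r>0. \<exists>e \<gamma>. norm e = 1 \<and> C2_on UNIV \<gamma>
          \<and> \<Omega> \<inter> ball x0 r = {x \<in> ball x0 r. x \<bullet> e > \<gamma> (x - (x \<bullet> e) *\<^sub>R e)})"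

definition p_laplacian :: "ereal \<Rightarrow> ('a::euclidean_space \<Rightarrow> real) \<Rightarrow> 'a \<Rightarrow> real" where
  "p_laplacian p \<phi> x =
     (if p = \<infinity> then hess \<phi> x (grad \<phi> x) \<bullet> grad \<phi> x
      else divergence (\<lambda>y. (norm (grad \<phi> y) powr (real_of_ereal p - 2)) *\<^sub>R grad \<phi> y) x)"

definition gen_visc_subsolution ::
  "ereal \<Rightarrow> 'a::euclidean_space set \<Rightarrow> ('a \<Rightarrow> real) \<Rightarrow> ('a \<Rightarrow> real) \<Rightarrow> bool" where
  "gen_visc_subsolution p \<Omega> g u \<longleftrightarrow> usc_on (closure \<Omega>) u
     \<and> (\<forall>x0\<in>closure \<Omega>. \<forall>\<phi>.
          C2_closure \<Omega> \<phi> \<and> \<phi> x0 = u x0 \<and> (\<forall>x\<in>closure \<Omega>. x \<noteq> x0 \<longrightarrow> \<phi> x > u x)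
          \<and> grad \<phi> x0 \<noteq> 0 \<longrightarrow>
            (x0 \<in> \<Omega> \<longrightarrow> - p_laplacian p \<phi> x0 \<le> 0)
          \<and> (x0 \<in> frontier \<Omega> \<longrightarrow> min (- p_laplacian p \<phi> x0) (u x0 - g x0) \<le> 0))"

definition gen_visc_supersolution ::
  "ereal \<Rightarrow> 'a::euclidean_space set \<Rightarrow> ('a \<Rightarrow> real) \<Rightarrow> ('a \<Rightarrow> real) \<Rightarrow> bool" where
  "gen_visc_supersolution p \<Omega> g u \<longleftrightarrow> lsc_on (closure \<Omega>) u
     \<and> (\<forall>x0\<in>closure \<Omega>. \<forall>\<phi>.
          C2_closure \<Omega> \<phi> \<and> \<phi> x0 = u x0 \<and> (\<forall>x\<in>closure \<Omega>. x \<noteq> x0 \<longrightarrow> \<phi> x < u x)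
          \<and> grad \<phi> x0 \<noteq> 0 \<longrightarrow>
            (x0 \<in> \<Omega> \<longrightarrow> - p_laplacian p \<phi> x0 \<ge> 0)
          \<and> (x0 \<in> frontier \<Omega> \<longrightarrow> max (- p_laplacian p \<phi> x0) (u x0 - g x0) \<ge> 0))"

end

theory Submission
  imports Defs "HOL-Library.Function_Algebras"
begin

text \<open>The \<open>p\<close>-Laplacian at a nonzero gradient \<open>q\<close> is a positive multiple of
  \<open>N(q, H) = a tr H + b (H q \<bullet> q) / \<bar>q\<bar>\<^sup>2\<close> with \<open>(a, b) = (1, p - 2)\<close>, or \<open>(0, 1)\<close> if
  \<open>p = \<infinity>\<close>, so that \<open>a \<ge> 0\<close> and \<open>a + b > 0\<close>. Steep radial barriers centred at an exterior
  touching ball give \<open>u \<le> g \<le> v\<close> on the boundary. In the interior \<open>u\<close> is first replaced by a convex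
  function of \<open>u\<close>, which turns \<open>N \<ge> 0\<close> into \<open>N \<ge> \<kappa> \<bar>q\<bar>\<^sup>2\<close>, and then \<open>u\<close> and \<open>-v\<close> are replaced
  by their sup-convolutions \<open>U\<close> and \<open>W\<close>, which are semiconvex. At a maximum point of
  \<open>U(x + h) + W(x)\<close> both are differentiable with opposite gradients \<open>\<plusminus>q\<close>. If \<open>q \<noteq> 0\<close>, then near that
  point both satisfy inequalities for one and the same linear elliptic operator with constant
  coefficients (semiconvexity bounds the negative part of the Hessians, a small multiple of the trace
  absorbs the positive part), and inserting a harmonic polynomial between them yields a contradiction;
  this replaces the theorem on sums. If the gradient vanishes at all such points for all small \<open>h\<close>, then,
  following Barles and Busca, the maximum value does not depend on \<open>h\<close>, so the maximum points of
  \<open>U + W\<close> are local maximum points of \<open>U\<close> and of \<open>W\<close>; by the strong maximum principle they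
  form a nonempty bounded set that is both open and closed, which is absurd.\<close>

section \<open>Superjets and test functions\<close>

text \<open>The equation is singular: it says nothing about test functions whose gradient vanishes
  at the touching point. A doubling of variables therefore stalls as soon as the penalised maximum
  has zero gradient, and the shift \<open>h\<close> serves to extract information from exactly that
  case. Dividing by |q|^(p-2) or |q|^2 puts all p into one family, linear in H and invariant under
  rescaling of q, but degenerate for p = \<infinity>. Freezing the direction at a nonzero slope must
  thus be accompanied by a small multiple of the trace, which restores uniform ellipticity; the
  strict gain \<open>\<kappa>\<close> pays for this perturbation, which is why u is made strict
  beforehand. Polynomials suffice as separating solutions because Stone-Weierstrass reduces
  continuous data on a sphere to polynomial data, for which the Dirichlet problem is
  finite-dimensional linear algebra. On the boundary the relaxed condition offers two alternatives,
  and a barrier that violates the equation forces the other one. Sup-convolutions live on the whole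
  space, so the final clopen set sits in a connected unbounded space.\<close>

definition op_trace :: "('a::euclidean_space \<Rightarrow> 'a) \<Rightarrow> real" where
  "op_trace H = (\<Sum>b\<in>Basis. H b \<bullet> b)"

definition nlap :: "real \<Rightarrow> real \<Rightarrow> 'a::euclidean_space \<Rightarrow> ('a \<Rightarrow> 'a) \<Rightarrow> real" where
  "nlap a b q H = a * op_trace H + b * (H q \<bullet> q) / (norm q)\<^sup>2"

definition superjet ::
  "'a::euclidean_space set \<Rightarrow> ('a \<Rightarrow> real) \<Rightarrow> 'a \<Rightarrow> 'a \<Rightarrow> ('a \<Rightarrow> 'a) \<Rightarrow> bool" where
  "superjet S u x q H \<longleftrightarrow> linear H \<and> (\<forall>\<eta>>0. \<exists>d>0. \<forall>y\<in>S. norm (y - x) < d \<longrightarrow>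
     u y \<le> u x + q \<bullet> (y - x) + H (y - x) \<bullet> (y - x) / 2 + \<eta> * (norm (y - x))\<^sup>2)"

lemma superjetI:
  assumes "linear H"
    and "\<And>\<eta>. \<eta> > 0 \<Longrightarrow> \<exists>d>0. \<forall>y\<in>S. norm (y - x) < d \<longrightarrow>
      u y \<le> u x + q \<bullet> (y - x) + H (y - x) \<bullet> (y - x) / 2 + \<eta> * (norm (y - x))\<^sup>2"
  shows "superjet S u x q H"
  using assms by (auto simp: superjet_def)

lemma superjetD:
  assumes "superjet S u x q H" "\<eta> > 0"
  obtains d where "d > 0" "\<And>y. y \<in> S \<Longrightarrow> norm (y - x) < d \<Longrightarrow>
      u y \<le> u x + q \<bullet> (y - x) + H (y - x) \<bullet> (y - x) / 2 + \<eta> * (norm (y - x))\<^sup>2"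
  using assms unfolding superjet_def by blast

lemma superjet_linear: "superjet S u x q H \<Longrightarrow> linear H"
  by (simp add: superjet_def)

text \<open>\<open>G\<close> is assumed differentiable at the single point \<open>x\<close>, so a
  second derivative cannot be integrated along the segment; instead the mean value theorem is
  applied once to the remainder.\<close>

lemma second_order_taylor:
  fixes \<phi> :: "'a::euclidean_space \<Rightarrow> real"
  assumes "e0 > 0" and der: "\<And>y. norm (y - x) < e0 \<Longrightarrow> GDERIV \<phi> y :> G y"
    and H: "(G has_derivative H) (at x)" and "\<eta> > 0"
  obtains d where "d > 0" "\<And>y. norm (y - x) < d \<Longrightarrow>
    \<bar>\<phi> y - \<phi> x - G x \<bullet> (y - x) - H (y - x) \<bullet> (y - x) / 2\<bar> \<le> \<eta> * (norm (y - x))\<^sup>2"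
proof -
  have lin: "linear H" using H has_derivative_linear by blast
  obtain d1 where d1: "d1 > 0"
    "\<And>y. norm (y - x) < d1 \<Longrightarrow> norm (G y - G x - H (y - x)) \<le> \<eta> * norm (y - x)"
    using H \<open>\<eta> > 0\<close> unfolding has_derivative_at_alt by blast
  define d where "d = min d1 e0"
  have d: "d > 0" using d1 assms by (simp add: d_def)
  have "\<bar>\<phi> y - \<phi> x - G x \<bullet> (y - x) - H (y - x) \<bullet> (y - x) / 2\<bar> \<le> \<eta> * (norm (y - x))\<^sup>2"
    if y: "norm (y - x) < d" for y
  proof -
    define w where "w = y - x"
    \<comment> \<open>The remainder along the segment. Its derivative in \<open>t\<close> is the
      first-order error of \<open>G\<close>, paired with \<open>w\<close>.\<close>
    define k where "k = (\<lambda>t. \<phi> (x + t *\<^sub>R w) - t * (G x \<bullet> w) - t\<^sup>2 * (H w \<bullet> w) / 2)"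
    have inside: "norm ((x + t *\<^sub>R w) - x) < d" if "0 \<le> t" "t \<le> 1" for t
    proof -
      have "norm ((x + t *\<^sub>R w) - x) = t * norm w" using that by simp
      also have "\<dots> \<le> 1 * norm w" using that by (intro mult_right_mono) auto
      finally show ?thesis using y w_def by simp
    qed
    have "DERIV k t :> (G (x + t *\<^sub>R w) - G x - H (t *\<^sub>R w)) \<bullet> w" if "0 \<le> t" "t \<le> 1" for t
    proof -
      have "norm ((x + t *\<^sub>R w) - x) < e0" using inside[OF that] d_def by simp
      then have *: "(\<phi> has_derivative (\<lambda>h. h \<bullet> G (x + t *\<^sub>R w))) (at (x + t *\<^sub>R w))"
        using der unfolding gderiv_def by blast
      have "((\<lambda>t. x + t *\<^sub>R w) has_derivative (\<lambda>s. s *\<^sub>R w)) (at t)"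
        by (auto intro!: derivative_eq_intros)
      from has_derivative_compose[OF this, of \<phi>] *
      have "((\<lambda>t. \<phi> (x + t *\<^sub>R w)) has_derivative (\<lambda>s. (s *\<^sub>R w) \<bullet> G (x + t *\<^sub>R w))) (at t)"
        by blast
      then have 1: "DERIV (\<lambda>t. \<phi> (x + t *\<^sub>R w)) t :> w \<bullet> G (x + t *\<^sub>R w)"
        unfolding has_field_derivative_def by (simp add: mult_commute_abs)
      show ?thesis unfolding k_def
        by (rule derivative_eq_intros 1 refl | simp)+
           (simp add: linear_scale[OF lin] inner_diff_left inner_commute algebra_simps)
    qed
    from MVT2[OF zero_less_one this] obtain z where z: "0 < z" "z < 1"
      "k 1 - k 0 = (G (x + z *\<^sub>R w) - G x - H (z *\<^sub>R w)) \<bullet> w" by auto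
    have "norm (G (x + z *\<^sub>R w) - G x - H ((x + z *\<^sub>R w) - x)) \<le> \<eta> * norm ((x + z *\<^sub>R w) - x)"
      using inside[of z] z d_def by (intro d1(2)) auto
    also have "\<dots> \<le> \<eta> * norm w"
      using z \<open>\<eta> > 0\<close> by (auto intro!: mult_left_le_one_le)
    finally have "\<bar>k 1 - k 0\<bar> \<le> (\<eta> * norm w) * norm w"
      unfolding z(3) using Cauchy_Schwarz_ineq2 mult_right_mono[OF _ norm_ge_zero]
      by (smt (verit, best) add_diff_cancel_left')
    then show ?thesis unfolding k_def w_def by (simp add: power2_eq_square algebra_simps)
  qed
  with d show thesis by (rule that)
qed

lemma superjet_smooth:
  fixes \<phi> :: "'a::euclidean_space \<Rightarrow> real"
  assumes "e0 > 0" and "\<And>y. norm (y - x) < e0 \<Longrightarrow> GDERIV \<phi> y :> G y"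
    and "(G has_derivative H) (at x)"
    and le: "\<And>y. y \<in> S \<Longrightarrow> norm (y - x) < e0 \<Longrightarrow> u y - u x \<le> \<phi> y - \<phi> x"
  shows "superjet S u x (G x) H"
proof (rule superjetI)
  show "linear H" using assms(3) has_derivative_linear by blast
  fix \<eta> :: real assume "\<eta> > 0"
  from second_order_taylor[OF assms(1-3) this] obtain d where d: "d > 0" "\<And>y. norm (y - x) < d \<Longrightarrow>
    \<bar>\<phi> y - \<phi> x - G x \<bullet> (y - x) - H (y - x) \<bullet> (y - x) / 2\<bar> \<le> \<eta> * (norm (y - x))\<^sup>2" by blast
  show "\<exists>d>0. \<forall>y\<in>S. norm (y - x) < d \<longrightarrow>
      u y \<le> u x + G x \<bullet> (y - x) + H (y - x) \<bullet> (y - x) / 2 + \<eta> * (norm (y - x))\<^sup>2"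
  proof (intro exI[of _ "min d e0"] conjI ballI impI)
    fix y assume "y \<in> S" "norm (y - x) < min d e0"
    then show "u y \<le> u x + G x \<bullet> (y - x) + H (y - x) \<bullet> (y - x) / 2 + \<eta> * (norm (y - x))\<^sup>2"
      using d(2)[of y] le[of y] by simp
  qed (use d assms in auto)
qed

lemma grad_eqI: "GDERIV \<phi> x :> D \<Longrightarrow> grad \<phi> x = D"
  unfolding grad_def gderiv_def
  by (rule the_equality, assumption)
     (metis (no_types) has_derivative_unique inner_commute vector_eq_rdot)

lemma grad_works:
  fixes \<phi> :: "'a::euclidean_space \<Rightarrow> real"
  assumes "\<phi> differentiable (at x)"
  shows "GDERIV \<phi> x :> grad \<phi> x"
proof -
  obtain f' where f': "(\<phi> has_derivative f') (at x)" using assms differentiable_def by blast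
  then have lin: "linear f'" using has_derivative_linear by blast
  have "f' = (\<lambda>h. h \<bullet> adjoint f' 1)"
    using adjoint_works[OF lin, of _ 1] by (auto simp: inner_commute)
  with f' have "GDERIV \<phi> x :> adjoint f' 1" unfolding gderiv_def by simp
  from grad_eqI[OF this] this show ?thesis by simp
qed

text \<open>The Hessian of \<open>w \<mapsto> H w \<bullet> w / 2\<close> is the symmetric part of \<open>H\<close>; neither the trace nor
  \<open>H q \<bullet> q\<close> sees the difference.\<close>

definition sym_part :: "('a::euclidean_space \<Rightarrow> 'a) \<Rightarrow> 'a \<Rightarrow> 'a" where
  "sym_part H w = (1/2) *\<^sub>R (H w + adjoint H w)"

lemma sym_part:
  fixes H :: "'a::euclidean_space \<Rightarrow> 'a"
  assumes "linear H"
  shows linear_sym_part: "linear (sym_part H)"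
    and sym_part_inner: "sym_part H v \<bullet> w = (H v \<bullet> w + H w \<bullet> v) / 2"
    and sym_part_diag: "sym_part H w \<bullet> w = H w \<bullet> w"
    and op_trace_sym_part: "op_trace (sym_part H) = op_trace H"
proof -
  show 1: "linear (sym_part H)"
    unfolding sym_part_def using assms
    by (intro linear_compose_scale_right linear_compose_add adjoint_linear)
  show 2: "sym_part H v \<bullet> w = (H v \<bullet> w + H w \<bullet> v) / 2" for v w
    using adjoint_works[OF assms, of w v]
    by (simp add: sym_part_def inner_add_left inner_add_right inner_commute)
  show 3: "sym_part H w \<bullet> w = H w \<bullet> w" for w by (simp add: 2)
  show "op_trace (sym_part H) = op_trace H" by (simp add: op_trace_def 3)
qed

text \<open>A large fourth-order term turns a local test function into a global one without affecting
  its derivatives of order at most 2 at \<open>x\<close>.\<close>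

definition quartic :: "'a::euclidean_space \<Rightarrow> real \<Rightarrow> 'a \<Rightarrow> ('a \<Rightarrow> 'a) \<Rightarrow> real \<Rightarrow> 'a \<Rightarrow> real" where
  "quartic x c q H K y =
     c + q \<bullet> (y - x) + H (y - x) \<bullet> (y - x) / 2 + K * ((y - x) \<bullet> (y - x))\<^sup>2"

lemma GDERIV_quartic:
  assumes "linear H"
  shows "GDERIV (quartic x c q H K) y :>
    q + sym_part H (y - x) + (4 * K * ((y - x) \<bullet> (y - x))) *\<^sub>R (y - x)"
proof -
  have bl: "bounded_linear H" using assms linear_conv_bounded_linear by blast
  have *: "((\<lambda>y. H (y - x)) has_derivative (\<lambda>h. H h)) (at y)"
    by (rule bounded_linear.has_derivative[OF bl]) (auto intro!: derivative_eq_intros)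
  have key: "w \<bullet> sym_part H v = (H v \<bullet> w + H w \<bullet> v) / 2" for v w
    using sym_part_inner[OF assms, of v w] by (simp add: inner_commute)
  show ?thesis
    unfolding gderiv_def quartic_def
    by (rule derivative_eq_intros * refl | simp)+
       (auto simp: fun_eq_iff inner_add_right key inner_commute power2_eq_square
          inner_add_left inner_diff_left inner_diff_right algebra_simps)
qed

lemma has_derivative_grad_quartic:
  assumes "linear H"
  shows "((\<lambda>y. q + sym_part H (y - x) + (4 * K * ((y - x) \<bullet> (y - x))) *\<^sub>R (y - x)) has_derivative
    (\<lambda>h. sym_part H h + (4 * K * ((y - x) \<bullet> (y - x))) *\<^sub>R h + (8 * K * ((y - x) \<bullet> h)) *\<^sub>R (y - x))) (at y)"
proof -
  have bl: "bounded_linear (sym_part H)"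
    using linear_sym_part[OF assms] linear_conv_bounded_linear by blast
  have *: "((\<lambda>y. sym_part H (y - x)) has_derivative (\<lambda>h. sym_part H h)) (at y)"
    by (rule bounded_linear.has_derivative[OF bl]) (auto intro!: derivative_eq_intros)
  show ?thesis
    by (rule derivative_eq_intros * refl | simp)+
       (auto simp: fun_eq_iff inner_commute algebra_simps)
qed

lemma grad_quartic:
  assumes "linear H"
  shows "grad (quartic x c q H K) =
    (\<lambda>y. q + sym_part H (y - x) + (4 * K * ((y - x) \<bullet> (y - x))) *\<^sub>R (y - x))"
  using GDERIV_quartic[OF assms] grad_eqI by blast

lemma hess_quartic:
  assumes "linear H"
  shows "hess (quartic x c q H K) y =
    (\<lambda>h. sym_part H h + (4 * K * ((y - x) \<bullet> (y - x))) *\<^sub>R h + (8 * K * ((y - x) \<bullet> h)) *\<^sub>R (y - x))"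
  unfolding hess_def grad_quartic[OF assms]
  using frechet_derivative_at[OF has_derivative_grad_quartic[OF assms]] by metis

lemma C2_closure_quartic:
  assumes "linear H"
  shows "C2_closure \<Omega> (quartic x c q H K)"
  unfolding C2_closure_def C2_on_def
proof (intro exI[of _ UNIV] conjI ballI allI)
  fix y
  show "quartic x c q H K differentiable (at y)"
    using GDERIV_quartic[OF assms] unfolding gderiv_def differentiable_def by blast
  show "grad (quartic x c q H K) differentiable (at y)"
    unfolding grad_quartic[OF assms]
    using has_derivative_grad_quartic[OF assms] differentiable_def by blast
next
  fix h show "continuous_on UNIV (\<lambda>x'. hess (quartic x c q H K) x' h)"
    unfolding hess_quartic[OF assms] by (intro continuous_intros)
qed auto

section \<open>Normalised form of the \<open>p\<close>-Laplacian\<close>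

definition lap_a :: "ereal \<Rightarrow> real" where "lap_a p = (if p = \<infinity> then 0 else 1)"
definition lap_b :: "ereal \<Rightarrow> real" where "lap_b p = (if p = \<infinity> then 1 else real_of_ereal p - 2)"

lemma lap_ab: assumes "1 < p" shows "lap_a p \<ge> 0" "lap_a p + lap_b p > 0"
  using assms by (cases p; auto simp: lap_a_def lap_b_def)+

text \<open>The factor \<open>s\<close> is |q|^2 for p = \<infinity> and |q|^(p-2) otherwise. It is
  fixed before \<open>c\<close> and \<open>K\<close>, so the test function can be globalised
  afterwards.\<close>

lemma p_laplacian_quartic:
  fixes q :: "'a::euclidean_space"
  assumes "linear H" "q \<noteq> 0"
  obtains s where "s > 0"
    "\<And>c K. p_laplacian p (quartic x c q H K) x = s * nlap (lap_a p) (lap_b p) q H"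
proof (cases "p = \<infinity>")
  case True
  have "p_laplacian p (quartic x c q H K) x = (norm q)\<^sup>2 * nlap (lap_a p) (lap_b p) q H" for c K
    using True assms
    by (simp add: p_laplacian_def hess_quartic grad_quartic nlap_def lap_a_def lap_b_def sym_part_diag
        linear_0[OF linear_sym_part])
  with assms show ?thesis by (intro that[of "(norm q)\<^sup>2"]) auto
next
  case False
  define r where "r = real_of_ereal p"
  have "p_laplacian p (quartic x c q H K) x = norm q powr (r - 2) * nlap (lap_a p) (lap_b p) q H" for c K
  proof -
    define G where "G = grad (quartic x c q H K)"
    have Gx: "G x = q" by (simp add: G_def grad_quartic assms linear_0[OF linear_sym_part])
    have dG: "(G has_derivative sym_part H) (at x)"
      using has_derivative_grad_quartic[OF assms(1), of q x K x]
      by (simp add: G_def grad_quartic assms)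
    have dn: "((\<lambda>y. norm (G y)) has_derivative (\<lambda>h. sym_part H h \<bullet> sgn q)) (at x)"
      using has_derivative_compose[OF dG, of norm] has_derivative_norm[of "G x"] assms
      by (simp add: Gx)
    have dp: "((\<lambda>y. norm (G y) powr (r - 2)) has_derivative
        (\<lambda>h. (sym_part H h \<bullet> sgn q) * ((r - 2) * norm q powr (r - 3)))) (at x)"
    proof -
      have "((\<lambda>t. t powr (r - 2)) has_real_derivative ((r - 2) * norm q powr (r - 3))) (at (norm q))"
        using assms has_real_derivative_powr[of "norm q" "r - 2"] by (simp add: algebra_simps)
      then have "((\<lambda>t. t powr (r - 2)) has_derivative (\<lambda>s. s * ((r - 2) * norm q powr (r - 3)))) (at (norm (G x)))"
        by (simp add: Gx has_field_derivative_def mult_commute_abs)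
      from has_derivative_compose[OF dn this] show ?thesis .
    qed
    have dF: "((\<lambda>y. (norm (G y) powr (r - 2)) *\<^sub>R G y) has_derivative
        (\<lambda>h. (norm q powr (r - 2)) *\<^sub>R sym_part H h
          + ((sym_part H h \<bullet> sgn q) * ((r - 2) * norm q powr (r - 3))) *\<^sub>R q)) (at x)"
      using has_derivative_scaleR[OF dp dG] by (simp add: Gx)
    have pw: "norm q powr (r - 3) = norm q powr (r - 2) / norm q"
      using assms powr_mult_base[of "norm q" "r - 3"] by (simp add: field_simps)
    have "p_laplacian p (quartic x c q H K) x = (\<Sum>b\<in>Basis.
        ((norm q powr (r - 2)) *\<^sub>R sym_part H b
          + ((sym_part H b \<bullet> sgn q) * ((r - 2) * norm q powr (r - 3))) *\<^sub>R q) \<bullet> b)"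
      using False frechet_derivative_at[OF dF, symmetric]
      by (simp add: p_laplacian_def divergence_def r_def[symmetric] G_def[symmetric])
    also have "\<dots> = norm q powr (r - 2) * op_trace (sym_part H)
        + (r - 2) * norm q powr (r - 3) * (\<Sum>b\<in>Basis. (sym_part H (sgn q) \<bullet> b) * (q \<bullet> b))"
    proof -
      define Q where "Q = (r - 2) * norm q powr (r - 3)"
      \<comment> \<open>Symmetry moves the basis vector out of the argument, so that the sum over
        the basis collapses to an inner product.\<close>
      have "sym_part H b \<bullet> sgn q = sym_part H (sgn q) \<bullet> b" for b
        by (simp add: sym_part_inner assms)
      then have "((norm q powr (r - 2)) *\<^sub>R sym_part H b
          + ((sym_part H b \<bullet> sgn q) * ((r - 2) * norm q powr (r - 3))) *\<^sub>R q) \<bullet> b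
          = norm q powr (r - 2) * (sym_part H b \<bullet> b) + Q * ((sym_part H (sgn q) \<bullet> b) * (q \<bullet> b))" for b
        by (simp add: inner_add_left Q_def)
      then show ?thesis
        by (simp add: sum.distrib op_trace_def sum_distrib_left Q_def)
    qed
    also have "(\<Sum>b\<in>Basis. (sym_part H (sgn q) \<bullet> b) * (q \<bullet> b)) = sym_part H (sgn q) \<bullet> q"
      by (simp add: euclidean_inner[of _ q])
    also have "\<dots> = (H q \<bullet> q) / norm q"
      by (simp add: sgn_div_norm linear_scale[OF linear_sym_part[OF assms(1)]] sym_part_diag assms
          divide_inverse mult.commute)
    finally have "p_laplacian p (quartic x c q H K) x = norm q powr (r - 2) * op_trace H
        + (r - 2) * (norm q powr (r - 2) / norm q) * ((H q \<bullet> q) / norm q)"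
      by (simp only: op_trace_sym_part[OF assms(1)] pw)
    then show ?thesis
      using False
      by (simp add: nlap_def lap_a_def lap_b_def r_def[symmetric] power2_eq_square diff_divide_distrib algebra_simps)
  qed
  with assms show ?thesis by (intro that[of "norm q powr (r - 2)"]) auto
qed

lemma nlap_add_id:
  fixes q :: "'a::euclidean_space"
  assumes "q \<noteq> 0"
  shows "nlap a b q (\<lambda>w. H w + c *\<^sub>R w) = nlap a b q H + c * (a * real DIM('a) + b)"
  using assms
  by (simp add: nlap_def op_trace_def inner_add_left sum.distrib dot_square_norm field_simps)

lemma linear_add_id: "linear H \<Longrightarrow> linear (\<lambda>w. H w + c *\<^sub>R w)"
  by (intro linear_compose_add linear_compose_scale_right linear_ident)

text \<open>Removes the vanishing perturbations of Hessians used below, whatever the sign of the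
  constant \<open>c\<close>.\<close>

lemma le_zero_if_le_eps:
  fixes s c :: real
  assumes "\<And>\<eta>. \<eta> > 0 \<Longrightarrow> s \<le> \<eta> * c"
  shows "s \<le> 0"
proof (rule ccontr)
  assume "\<not> s \<le> 0"
  then have s: "s > 0" by simp
  have "s \<le> s / (2 * (\<bar>c\<bar> + 1)) * c" using s by (intro assms) auto
  also have "\<dots> \<le> s / (2 * (\<bar>c\<bar> + 1)) * (\<bar>c\<bar> + 1)" using s by (intro mult_left_mono) auto
  also have "\<dots> = s / 2" by (simp add: field_simps)
  finally show False using s by simp
qed

lemma quartic_strictly_above:
  fixes u :: "'a::euclidean_space \<Rightarrow> real"
  assumes "compact S" and bdd: "\<And>y. y \<in> S \<Longrightarrow> u y \<le> B"
    and jet: "superjet S u x q H" and "\<eta> > 0"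
  obtains K where "\<And>y. y \<in> S \<Longrightarrow> y \<noteq> x \<Longrightarrow> u y < quartic x (u x) q (\<lambda>w. H w + \<eta> *\<^sub>R w) K y"
proof -
  obtain d where d: "d > 0" "\<And>y. y \<in> S \<Longrightarrow> norm (y - x) < d \<Longrightarrow>
      u y \<le> u x + q \<bullet> (y - x) + H (y - x) \<bullet> (y - x) / 2 + (\<eta>/4) * (norm (y - x))\<^sup>2"
    using superjetD[OF jet, of "\<eta>/4"] \<open>\<eta> > 0\<close> by auto
  define T where "T = quartic x (u x) q (\<lambda>w. H w + \<eta> *\<^sub>R w) 0"
  have lin: "linear (\<lambda>w. H w + \<eta> *\<^sub>R w)" by (rule linear_add_id[OF superjet_linear[OF jet]])
  have "continuous_on S T"
    using GDERIV_quartic[OF lin] unfolding T_def gderiv_def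
    by (meson continuous_at_imp_continuous_on has_derivative_continuous)
  then obtain m where m: "\<And>y. y \<in> S \<Longrightarrow> m \<le> T y"
    using compact_continuous_image[OF _ \<open>compact S\<close>] compact_imp_bounded bounded_imp_bdd_below
    by (metis (no_types) bdd_below.E imageI)
  \<comment> \<open>Outside the ball of radius \<open>d\<close> the fourth-order term must outweigh
    the gap between \<open>B\<close> and the lower bound \<open>m\<close> of the quadratic part.
    Inside the ball the margin \<open>\<eta>/2\<close> beats the jet error
    \<open>\<eta>/4\<close>.\<close>
  define K where "K = (\<bar>B - m\<bar> + 1) / d ^ 4"
  have K: "K > 0" "K * d ^ 4 = \<bar>B - m\<bar> + 1" using d by (auto simp: K_def)
  have eq: "quartic x (u x) q (\<lambda>w. H w + \<eta> *\<^sub>R w) K y = T y + K * norm (y - x) ^ 4" for y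
    by (simp add: T_def quartic_def dot_square_norm power_mult[symmetric])
  have "u y < quartic x (u x) q (\<lambda>w. H w + \<eta> *\<^sub>R w) K y" if y: "y \<in> S" "y \<noteq> x" for y
  proof (cases "norm (y - x) < d")
    case True
    have *: "T y = u x + q \<bullet> (y - x) + H (y - x) \<bullet> (y - x) / 2 + (\<eta>/2) * (norm (y - x))\<^sup>2"
      by (simp add: T_def quartic_def dot_square_norm inner_add_left add_divide_distrib)
    have "(\<eta>/4) * (norm (y - x))\<^sup>2 < (\<eta>/2) * (norm (y - x))\<^sup>2" "K * norm (y - x) ^ 4 > 0"
      using y \<open>\<eta> > 0\<close> K by auto
    with d(2)[OF y(1) True] show ?thesis unfolding eq * by linarith
  next
    case False
    then have "K * d ^ 4 \<le> K * norm (y - x) ^ 4"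
      using K d by (intro mult_left_mono power_mono) auto
    with m[OF y(1)] bdd[OF y(1)] K show ?thesis unfolding eq by linarith
  qed
  then show thesis by (rule that)
qed

text \<open>A superjet gives an admissible test function only after \<open>H\<close> is enlarged by
  \<open>\<eta>\<close>. As \<open>nlap\<close> is affine in this enlargement, \<open>\<eta>\<close>
  can be sent to 0. The second alternative is the boundary half of the minimum.\<close>

lemma subsolution_superjet:
  fixes u :: "'a::euclidean_space \<Rightarrow> real"
  assumes sub: "gen_visc_subsolution p \<Omega> g u" and "bounded \<Omega>"
    and bdd: "\<And>y. y \<in> closure \<Omega> \<Longrightarrow> u y \<le> B"
    and x: "x \<in> closure \<Omega>" and jet: "superjet (closure \<Omega>) u x q H" and "q \<noteq> 0"
  shows "nlap (lap_a p) (lap_b p) q H \<ge> 0 \<or> x \<notin> \<Omega> \<and> u x \<le> g x"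
proof (rule disjCI)
  assume n: "\<not> (x \<notin> \<Omega> \<and> u x \<le> g x)"
  let ?a = "lap_a p" let ?b = "lap_b p"
  have "- nlap ?a ?b q H \<le> \<eta> * (?a * real DIM('a) + ?b)" if "\<eta> > 0" for \<eta>
  proof -
    let ?H = "\<lambda>w. H w + \<eta> *\<^sub>R w"
    have lin: "linear ?H" by (rule linear_add_id[OF superjet_linear[OF jet]])
    obtain K where K: "\<And>y. y \<in> closure \<Omega> \<Longrightarrow> y \<noteq> x \<Longrightarrow> u y < quartic x (u x) q ?H K y"
      using quartic_strictly_above[OF _ bdd jet \<open>\<eta> > 0\<close>] \<open>bounded \<Omega>\<close> by (meson compact_closure)
    obtain s where s: "s > 0" "\<And>c K. p_laplacian p (quartic x c q ?H K) x = s * nlap ?a ?b q ?H"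
      using p_laplacian_quartic[OF lin \<open>q \<noteq> 0\<close>] by metis
    have "grad (quartic x (u x) q ?H K) x \<noteq> 0"
      using \<open>q \<noteq> 0\<close> by (simp add: grad_quartic[OF lin] linear_0[OF linear_sym_part[OF lin]])
    moreover have "quartic x (u x) q ?H K x = u x" by (simp add: quartic_def)
    ultimately have "(x \<in> \<Omega> \<longrightarrow> - p_laplacian p (quartic x (u x) q ?H K) x \<le> 0)
          \<and> (x \<in> frontier \<Omega> \<longrightarrow> min (- p_laplacian p (quartic x (u x) q ?H K) x) (u x - g x) \<le> 0)"
      using sub x K C2_closure_quartic[OF lin] unfolding gen_visc_subsolution_def by blast
    moreover have "x \<in> \<Omega> \<or> x \<in> frontier \<Omega>"
      using x interior_subset unfolding frontier_def by blast
    ultimately have "p_laplacian p (quartic x (u x) q ?H K) x \<ge> 0"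
      using n by (auto simp: min_le_iff_disj)
    then have "nlap ?a ?b q ?H \<ge> 0" using s by (simp add: zero_le_mult_iff)
    then show ?thesis by (simp add: nlap_add_id \<open>q \<noteq> 0\<close>)
  qed
  from le_zero_if_le_eps[OF this] show "nlap ?a ?b q H \<ge> 0" by simp
qed

text \<open>\<open>nlap\<close> is odd in the pair of gradient and Hessian, so - v satisfies a
  condition of the same form as a subsolution. This is what allows every later lemma to treat both
  functions through superjets.\<close>

lemma supersolution_superjet:
  fixes v :: "'a::euclidean_space \<Rightarrow> real"
  assumes super: "gen_visc_supersolution p \<Omega> g v" and "bounded \<Omega>"
    and bdd: "\<And>y. y \<in> closure \<Omega> \<Longrightarrow> - v y \<le> B"
    and x: "x \<in> closure \<Omega>" and jet: "superjet (closure \<Omega>) (\<lambda>y. - v y) x q H" and "q \<noteq> 0"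
  shows "nlap (lap_a p) (lap_b p) q H \<ge> 0 \<or> x \<notin> \<Omega> \<and> - v x \<le> - g x"
proof (rule disjCI)
  assume n: "\<not> (x \<notin> \<Omega> \<and> - v x \<le> - g x)"
  let ?a = "lap_a p" let ?b = "lap_b p"
  have "- nlap ?a ?b q H \<le> \<eta> * (?a * real DIM('a) + ?b)" if "\<eta> > 0" for \<eta>
  proof -
    let ?H = "\<lambda>w. H w + \<eta> *\<^sub>R w"
    let ?N = "\<lambda>w. - ?H w"
    have lin: "linear ?H" by (rule linear_add_id[OF superjet_linear[OF jet]])
    have lin': "linear ?N" by (rule linear_compose_neg[OF lin])
    obtain K where K: "\<And>y. y \<in> closure \<Omega> \<Longrightarrow> y \<noteq> x \<Longrightarrow> - v y < quartic x (- v x) q ?H K y"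
      using quartic_strictly_above[OF _ bdd jet \<open>\<eta> > 0\<close>] \<open>bounded \<Omega>\<close> by (meson compact_closure)
    define \<phi> where "\<phi> = quartic x (v x) (- q) ?N (- K)"
    have "\<phi> y = - quartic x (- v x) q ?H K y" for y
      by (simp add: \<phi>_def quartic_def inner_add_left inner_diff_left add_divide_distrib diff_divide_distrib)
    with K have below: "\<And>y. y \<in> closure \<Omega> \<Longrightarrow> y \<noteq> x \<Longrightarrow> \<phi> y < v y" by fastforce
    obtain s where s: "s > 0" "\<And>c K. p_laplacian p (quartic x c (- q) ?N K) x = s * nlap ?a ?b (- q) ?N"
      using p_laplacian_quartic[OF lin', of "- q"] \<open>q \<noteq> 0\<close> by (metis neg_equal_0_iff_equal)
    have odd: "nlap ?a ?b (- q) ?N = - nlap ?a ?b q ?H"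
      using linear_neg[OF superjet_linear[OF jet], of q]
      by (simp add: nlap_def op_trace_def inner_add_left inner_diff_left sum_negf sum_subtractf
          sum.distrib algebra_simps add_divide_distrib diff_divide_distrib)
    have "grad \<phi> x \<noteq> 0"
      unfolding \<phi>_def grad_quartic[OF lin']
      using \<open>q \<noteq> 0\<close> linear_0[OF linear_sym_part[OF lin']] by simp
    moreover have "\<phi> x = v x" by (simp add: \<phi>_def quartic_def)
    moreover have "C2_closure \<Omega> \<phi>" unfolding \<phi>_def by (rule C2_closure_quartic[OF lin'])
    ultimately have "(x \<in> \<Omega> \<longrightarrow> - p_laplacian p \<phi> x \<ge> 0)
          \<and> (x \<in> frontier \<Omega> \<longrightarrow> max (- p_laplacian p \<phi> x) (v x - g x) \<ge> 0)"
      using super x below unfolding gen_visc_supersolution_def by blast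
    moreover have "x \<in> \<Omega> \<or> x \<in> frontier \<Omega>"
      using x interior_subset unfolding frontier_def by blast
    ultimately have "p_laplacian p \<phi> x \<le> 0"
      using n by (auto simp: le_max_iff_disj)
    then have "nlap ?a ?b q ?H \<ge> 0" using s odd by (simp add: \<phi>_def zero_le_mult_iff)
    then show ?thesis by (simp add: nlap_add_id \<open>q \<noteq> 0\<close>)
  qed
  from le_zero_if_le_eps[OF this] show "nlap ?a ?b q H \<ge> 0" by simp
qed

section \<open>Semicontinuity\<close>

lemma usc_onD:
  fixes u :: "'a::metric_space \<Rightarrow> real"
  assumes "usc_on S u" "x \<in> S" "u x < c"
  obtains d where "d > 0" "\<And>y. y \<in> S \<Longrightarrow> dist y x < d \<Longrightarrow> u y < c"
proof -
  obtain d where "d > 0" "\<And>y. y \<in> S \<Longrightarrow> y \<noteq> x \<Longrightarrow> dist y x < d \<Longrightarrow> u y < c"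
    using assms unfolding usc_on_def eventually_at by meson
  with assms(3) show thesis by (intro that[of d]) metis+
qed

lemma usc_onI:
  fixes u :: "'a::metric_space \<Rightarrow> real"
  assumes "\<And>x c. x \<in> S \<Longrightarrow> u x < c \<Longrightarrow> \<exists>d>0. \<forall>y\<in>S. dist y x < d \<longrightarrow> u y < c"
  shows "usc_on S u"
  unfolding usc_on_def eventually_at using assms by meson

text \<open>Without a maximum point the relatively open sets \<open>T y\<close> would cover
  \<open>S\<close>; but in a finite subcover the index with the largest value of \<open>u\<close>
  lies in none of the chosen sets.\<close>

lemma usc_on_attains_sup:
  fixes u :: "'a::metric_space \<Rightarrow> real"
  assumes "usc_on S u" "compact S" "S \<noteq> {}"
  shows "\<exists>x\<in>S. \<forall>y\<in>S. u y \<le> u x"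
proof (rule ccontr)
  assume "\<not> ?thesis"
  then have *: "\<And>x. x \<in> S \<Longrightarrow> \<exists>y\<in>S. u x < u y" by force
  define T where "T = (\<lambda>y. {x \<in> S. u x < u y})"
  have "openin (top_of_set S) (T y)" for y
    unfolding openin_euclidean_subtopology_iff
  proof (intro conjI ballI)
    fix x assume "x \<in> T y"
    then have "x \<in> S" "u x < u y" by (auto simp: T_def)
    from usc_onD[OF assms(1) this] obtain d where "d > 0" "\<And>z. z \<in> S \<Longrightarrow> dist z x < d \<Longrightarrow> u z < u y"
      by metis
    then show "\<exists>e>0. \<forall>z\<in>S. dist z x < e \<longrightarrow> z \<in> T y" unfolding T_def by auto
  qed (auto simp: T_def)
  moreover have "S \<subseteq> \<Union>(T ` S)" using * by (auto simp: T_def)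
  ultimately obtain D where D: "D \<subseteq> T ` S" "finite D" "S \<subseteq> \<Union>D"
    using \<open>compact S\<close> unfolding compact_eq_openin_cover by (metis (no_types, lifting) imageE)
  then obtain Y where Y: "Y \<subseteq> S" "finite Y" "D = T ` Y" by (meson finite_subset_image)
  then have "Y \<noteq> {}" using D \<open>S \<noteq> {}\<close> by auto
  then have "Max (u ` Y) \<in> u ` Y" using Y(2) by (intro Max_in) auto
  then obtain y where "y \<in> Y" "u y = Max (u ` Y)" by force
  then have y: "y \<in> Y" "\<And>z. z \<in> Y \<Longrightarrow> u z \<le> u y" using Y(2) by auto
  then obtain z where "z \<in> Y" "y \<in> T z" using D Y by auto
  with y show False by (auto simp: T_def not_le[symmetric])
qed

lemma usc_on_add:
  fixes u v :: "'a::metric_space \<Rightarrow> real"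
  assumes "usc_on S u" "usc_on S v"
  shows "usc_on S (\<lambda>x. u x + v x)"
proof (rule usc_onI)
  fix x c assume x: "x \<in> S" "u x + v x < c"
  define e where "e = (c - u x - v x) / 2"
  have "e > 0" using x by (simp add: e_def)
  then have "u x < u x + e" "v x < v x + e" by auto
  obtain d1 where d1: "d1 > 0" "\<And>y. y \<in> S \<Longrightarrow> dist y x < d1 \<Longrightarrow> u y < u x + e"
    using usc_onD[OF assms(1) x(1) \<open>u x < u x + e\<close>] by metis
  obtain d2 where d2: "d2 > 0" "\<And>y. y \<in> S \<Longrightarrow> dist y x < d2 \<Longrightarrow> v y < v x + e"
    using usc_onD[OF assms(2) x(1) \<open>v x < v x + e\<close>] by metis
  have "u y + v y < c" if "y \<in> S" "dist y x < min d1 d2" for y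
    using d1(2)[of y] d2(2)[of y] that by (simp add: e_def field_simps)
  then show "\<exists>d>0. \<forall>y\<in>S. dist y x < d \<longrightarrow> u y + v y < c"
    using d1 d2 by (intro exI[of _ "min d1 d2"]) auto
qed

lemma continuous_imp_usc_on:
  fixes f :: "'a::metric_space \<Rightarrow> real"
  assumes "continuous_on S f"
  shows "usc_on S f"
proof (rule usc_onI)
  fix x c assume x: "x \<in> S" "f x < c"
  then obtain d where d: "d > 0" "\<And>y. y \<in> S \<Longrightarrow> dist y x < d \<Longrightarrow> dist (f y) (f x) < c - f x"
    using assms unfolding continuous_on_iff by (metis diff_gt_0_iff_gt)
  then show "\<exists>d>0. \<forall>y\<in>S. dist y x < d \<longrightarrow> f y < c"
    by (intro exI[of _ d]) (auto simp: dist_real_def abs_diff_less_iff)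
qed

text \<open>In the application \<open>f\<close> contains a logarithm and \<open>A\<close> is the
  half-line on which it is defined.\<close>

lemma usc_on_mono_compose:
  fixes u :: "'a::metric_space \<Rightarrow> real"
  assumes "usc_on S u" and cont: "continuous_on A f" and open_A: "open A"
    and ran: "\<And>x. x \<in> S \<Longrightarrow> u x \<in> A"
    and mono: "\<And>s t. s \<le> t \<Longrightarrow> t \<in> A \<Longrightarrow> f s \<le> f t"
  shows "usc_on S (\<lambda>x. f (u x))"
proof (rule usc_onI)
  fix x c assume x: "x \<in> S" "f (u x) < c"
  have "{t \<in> A. f t < c} = A \<inter> f -` {..<c}" by auto
  then have "open {t \<in> A. f t < c}"
    using continuous_open_preimage[OF cont open_A open_lessThan, of c] by simp
  moreover have "u x \<in> {t \<in> A. f t < c}" using x ran by auto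
  ultimately obtain e where e: "e > 0" "ball (u x) e \<subseteq> {t \<in> A. f t < c}"
    unfolding open_contains_ball by blast
  have "u x + e / 2 \<in> ball (u x) e" using e by (simp add: dist_real_def)
  then have top: "u x + e / 2 \<in> A" "f (u x + e / 2) < c" using e by auto
  obtain d where d: "d > 0" "\<And>y. y \<in> S \<Longrightarrow> dist y x < d \<Longrightarrow> u y < u x + e / 2"
    using usc_onD[OF assms(1) x(1), of "u x + e / 2"] e by auto
  have "f (u y) < c" if "y \<in> S" "dist y x < d" for y
    using mono[of "u y" "u x + e / 2"] d(2)[OF that] top by force
  with d show "\<exists>d>0. \<forall>y\<in>S. dist y x < d \<longrightarrow> f (u y) < c" by blast
qed

section \<open>The boundary condition\<close>

text \<open>A graph of class C2 lies above a downward paraboloid, so near \<open>x0\<close> the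
  closure satisfies a quadratic one-sided bound in the outward direction. A ball of sufficiently
  small radius placed on that side meets the closure in \<open>x0\<close> only.\<close>

lemma exterior_ball:
  fixes \<Omega> :: "'a::euclidean_space set"
  assumes "C2_domain \<Omega>" and x0: "x0 \<in> frontier \<Omega>"
  obtains y R where "R > 0" "norm (x0 - y) = R"
    "\<And>x. x \<in> closure \<Omega> \<Longrightarrow> x \<noteq> x0 \<Longrightarrow> norm (x - y) > R"
proof -
  obtain r e \<gamma> where r: "r > 0" and e: "norm e = 1" and C2: "C2_on UNIV \<gamma>"
    and eq: "\<Omega> \<inter> ball x0 r = {x \<in> ball x0 r. x \<bullet> e > \<gamma> (x - (x \<bullet> e) *\<^sub>R e)}"
    using assms unfolding C2_domain_def by blast
  have "open \<Omega>" using assms C2_domain_def by blast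
  have ee: "e \<bullet> e = 1" using e by (simp add: dot_square_norm)
  define P where "P = (\<lambda>x. x - (x \<bullet> e) *\<^sub>R e)"
  have Pdiff: "P x - P y = P (x - y)" for x y
    by (simp add: P_def inner_diff_left algebra_simps)
  have Pnorm: "norm (P w) \<le> norm w" for w
  proof -
    have "(norm (P w))\<^sup>2 = (norm w)\<^sup>2 - (w \<bullet> e)\<^sup>2"
      unfolding P_def dot_square_norm[symmetric]
      by (simp add: inner_diff_left inner_diff_right ee power2_eq_square inner_commute)
    then have "(norm (P w))\<^sup>2 \<le> (norm w)\<^sup>2" by simp
    then show ?thesis by (rule power2_le_imp_le) simp
  qed
  have diff: "\<gamma> differentiable (at z)" for z using C2 by (simp add: C2_on_def)
  have gd: "GDERIV \<gamma> z :> grad \<gamma> z" for z by (rule grad_works[OF diff])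
  have hd: "(grad \<gamma> has_derivative hess \<gamma> z) (at z)" for z
  proof -
    have "grad \<gamma> differentiable (at z)" using C2 by (simp add: C2_on_def)
    then show ?thesis unfolding hess_def by (rule iffD1[OF frechet_derivative_works])
  qed
  define N where "N = grad \<gamma> (P x0)"
  define H where "H = hess \<gamma> (P x0)"
  obtain d where d: "d > 0" "\<And>z. norm (z - P x0) < d \<Longrightarrow>
    \<bar>\<gamma> z - \<gamma> (P x0) - N \<bullet> (z - P x0) - H (z - P x0) \<bullet> (z - P x0) / 2\<bar> \<le> 1 * (norm (z - P x0))\<^sup>2"
    unfolding N_def H_def using second_order_taylor[OF zero_less_one gd hd zero_less_one] by blast
  obtain C0 where C0: "\<And>w. norm (H w) \<le> C0 * norm w" "C0 > 0"
    using linear_bounded_pos[OF has_derivative_linear[OF hd[of "P x0"]]] unfolding H_def by metis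
  \<comment> \<open>Half the bound of the Hessian, plus 1 for the Taylor error.\<close>
  define C where "C = C0 / 2 + 1"
  have "C > 0" using C0 by (simp add: C_def)
  have \<gamma>_lower: "\<gamma> z \<ge> \<gamma> (P x0) + N \<bullet> (z - P x0) - C * (norm (z - P x0))\<^sup>2"
    if "norm (z - P x0) < d" for z
  proof -
    let ?w = "z - P x0"
    have "\<bar>H ?w \<bullet> ?w\<bar> \<le> norm (H ?w) * norm ?w" by (rule Cauchy_Schwarz_ineq2)
    also have "\<dots> \<le> C0 * norm ?w * norm ?w" by (intro mult_right_mono C0) auto
    finally have "\<bar>H ?w \<bullet> ?w\<bar> \<le> C0 * (norm ?w)\<^sup>2" by (simp add: power2_eq_square mult.assoc)
    moreover have "C * (norm ?w)\<^sup>2 = C0 * (norm ?w)\<^sup>2 / 2 + (norm ?w)\<^sup>2"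
      by (simp add: C_def distrib_right)
    ultimately show ?thesis using d(2)[OF that] by linarith
  qed
  have cont: "continuous_on UNIV \<gamma>"
    using diff by (simp add: continuous_at_imp_continuous_on differentiable_imp_continuous_within)
  have graph: "x \<bullet> e \<ge> \<gamma> (P x)" if "x \<in> closure \<Omega>" "x \<in> ball x0 r" for x
  proof -
    have "x \<in> closure (ball x0 r \<inter> \<Omega>)"
      using that open_Int_closure_subset[of "ball x0 r" \<Omega>] by auto
    moreover have "ball x0 r \<inter> \<Omega> \<subseteq> {x. \<gamma> (P x) \<le> x \<bullet> e}"
    proof
      fix z assume z: "z \<in> ball x0 r \<inter> \<Omega>"
      then have "z \<in> {x \<in> ball x0 r. x \<bullet> e > \<gamma> (x - (x \<bullet> e) *\<^sub>R e)}" using eq by blast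
      then show "z \<in> {x. \<gamma> (P x) \<le> x \<bullet> e}" by (simp add: P_def)
    qed
    moreover have "closed {x. \<gamma> (P x) \<le> x \<bullet> e}"
      unfolding P_def
      by (intro closed_Collect_le continuous_on_compose2[OF cont]) (auto intro!: continuous_intros)
    ultimately show ?thesis using closure_minimal by blast
  qed
  have "x0 \<in> closure \<Omega>" "x0 \<notin> \<Omega>" using x0 \<open>open \<Omega>\<close> by (auto simp: frontier_def interior_open)
  have "x0 \<bullet> e = \<gamma> (P x0)"
  proof (rule antisym)
    have "x0 \<notin> {x \<in> ball x0 r. x \<bullet> e > \<gamma> (x - (x \<bullet> e) *\<^sub>R e)}" using eq \<open>x0 \<notin> \<Omega>\<close> by blast
    then show "x0 \<bullet> e \<le> \<gamma> (P x0)" using r by (simp add: P_def)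
    show "\<gamma> (P x0) \<le> x0 \<bullet> e" using graph[OF \<open>x0 \<in> closure \<Omega>\<close>] r by simp
  qed
  \<comment> \<open>An outward normal, not normalised. The gradient of \<open>\<gamma>\<close> is
    projected because only values of \<open>\<gamma>\<close> on the hyperplane orthogonal to
    \<open>e\<close> describe the domain.\<close>
  define \<nu> where "\<nu> = P N - e"
  have "\<nu> \<bullet> e = -1" by (simp add: \<nu>_def P_def inner_diff_left ee)
  then have "\<nu> \<noteq> 0" by auto
  have \<nu>: "\<nu> \<bullet> (x - x0) \<le> C * (norm (x - x0))\<^sup>2"
    if "x \<in> closure \<Omega>" "norm (x - x0) < min r d" for x
  proof -
    have "norm (P x - P x0) < d" using that Pnorm[of "x - x0"] by (simp add: Pdiff)
    from \<gamma>_lower[OF this] have "\<gamma> (P x) \<ge> \<gamma> (P x0) + N \<bullet> P (x - x0) - C * (norm (P (x - x0)))\<^sup>2"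
      by (simp add: Pdiff)
    moreover have "C * (norm (P (x - x0)))\<^sup>2 \<le> C * (norm (x - x0))\<^sup>2"
      using \<open>C > 0\<close> Pnorm by (intro mult_left_mono power_mono) auto
    moreover have "x \<bullet> e \<ge> \<gamma> (P x)"
      using that by (intro graph) (auto simp: dist_norm norm_minus_commute)
    moreover have "N \<bullet> P (x - x0) = P N \<bullet> (x - x0)"
      by (simp add: P_def inner_diff_left inner_diff_right inner_commute)
    ultimately show ?thesis using \<open>x0 \<bullet> e = \<gamma> (P x0)\<close>
      by (simp add: \<nu>_def inner_diff_left inner_diff_right inner_commute)
  qed
  \<comment> \<open>The first bound disposes of points at distance at least \<open>min r d\<close>
    from \<open>x0\<close> by the triangle inequality; the second makes \<open>2 * R * C\<close>
    smaller than \<open>norm \<nu>\<close>, so the quadratic bound on \<nu> \<bullet> (x - x0) keeps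
    the nearby points outside the ball.\<close>
  define R where "R = min (min r d / 4) (norm \<nu> / (4 * C))"
  have R: "R > 0" "2 * R < min r d" "2 * R * C < norm \<nu>"
  proof -
    show "R > 0" using r d \<open>C > 0\<close> \<open>\<nu> \<noteq> 0\<close> by (simp add: R_def)
    have "R \<le> min r d / 4" unfolding R_def by (rule min.cobounded1)
    then show "2 * R < min r d" using \<open>R > 0\<close> by linarith
    have "R \<le> norm \<nu> / (4 * C)" unfolding R_def by (rule min.cobounded2)
    then have "2 * R * C \<le> norm \<nu> / 2" using \<open>C > 0\<close> by (simp add: field_simps)
    then show "2 * R * C < norm \<nu>" using \<open>\<nu> \<noteq> 0\<close> by (smt (verit) field_sum_of_halves zero_less_norm_iff)
  qed
  define y where "y = x0 + R *\<^sub>R sgn \<nu>"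
  have "norm (x0 - y) = R" using \<open>\<nu> \<noteq> 0\<close> R by (simp add: y_def norm_sgn)
  moreover have "norm (x - y) > R" if x: "x \<in> closure \<Omega>" "x \<noteq> x0" for x
  proof (cases "norm (x - x0) < min r d")
    case True
    define w where "w = x - x0"
    have "w \<noteq> 0" using x by (simp add: w_def)
    have xy: "x - y = w - R *\<^sub>R sgn \<nu>" by (simp add: w_def y_def)
    have "(norm (x - y))\<^sup>2 = (norm w)\<^sup>2 - 2 * R * (sgn \<nu> \<bullet> w) + R\<^sup>2"
    proof -
      have "(norm (w - z))\<^sup>2 = (norm w)\<^sup>2 - 2 * (z \<bullet> w) + (norm z)\<^sup>2" for z
        unfolding power2_norm_eq_inner by (simp add: inner_diff_left inner_diff_right inner_commute)
      from this[of "R *\<^sub>R sgn \<nu>"] show ?thesis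
        using \<open>\<nu> \<noteq> 0\<close> by (simp add: xy norm_sgn)
    qed
    moreover have "2 * R * (sgn \<nu> \<bullet> w) < (norm w)\<^sup>2"
    proof -
      have "2 * R * (sgn \<nu> \<bullet> w) = 2 * R * (\<nu> \<bullet> w) / norm \<nu>" by (simp add: sgn_div_norm divide_inverse)
      also have "\<dots> \<le> 2 * R * (C * (norm w)\<^sup>2) / norm \<nu>"
        using \<nu>[OF x(1) True] R unfolding w_def[symmetric]
        by (intro divide_right_mono mult_left_mono) auto
      also have "\<dots> = (2 * R * C) * (norm w)\<^sup>2 / norm \<nu>" by simp
      also have "\<dots> < norm \<nu> * (norm w)\<^sup>2 / norm \<nu>"
        using \<open>w \<noteq> 0\<close> \<open>\<nu> \<noteq> 0\<close> R by (intro divide_strict_right_mono mult_strict_right_mono) auto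
      finally show ?thesis using \<open>\<nu> \<noteq> 0\<close> by simp
    qed
    ultimately have "R\<^sup>2 < (norm (x - y))\<^sup>2" by simp
    then show ?thesis by (rule power2_less_imp_less) simp
  next
    case False
    then have "norm (x - x0) \<ge> min r d" by (simp only: not_less)
    moreover have "norm (x - x0) \<le> norm (x - y) + norm (x0 - y)"
      by (metis dist_norm dist_triangle2)
    ultimately show ?thesis using R \<open>norm (x0 - y) = R\<close> by linarith
  qed
  ultimately show thesis using R by (intro that)
qed

section \<open>Radial barriers and the boundary inequality\<close>

definition barrier :: "'a::euclidean_space \<Rightarrow> real \<Rightarrow> 'a \<Rightarrow> real" where
  "barrier y \<mu> x = - exp (- \<mu> * ((x - y) \<bullet> (x - y)))"

lemma continuous_barrier: "continuous_on S (barrier y \<mu>)"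
  unfolding barrier_def by (intro continuous_intros)

lemma barrier_le_iff:
  "\<mu> > 0 \<Longrightarrow> barrier y \<mu> x \<le> barrier y \<mu> x' \<longleftrightarrow> norm (x - y) \<le> norm (x' - y)"
  by (simp add: barrier_def dot_square_norm power2_le_iff_abs_le)

lemma barrier_range: "-1 \<le> barrier y \<mu> x \<longleftrightarrow> 0 \<le> \<mu> * ((x - y) \<bullet> (x - y))" "barrier y \<mu> x < 0"
  by (auto simp: barrier_def)

text \<open>With z = x - y the Hessian is c times the identity minus 2 \<mu> c times the
  projection-like term z (z \<bullet> h), and the gradient is c z. The trace and the radial
  direction both pick up - 2 \<mu> c |z|^2, hence \<open>nlap\<close> equals c ((a d + b) - 2 \<mu>
  (a + b) |z|^2) with d the dimension. This is negative for large \<open>\<mu>\<close> because a + b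
  > 0, so the degenerate case a = 0 is included.\<close>

lemma superjet_barrier:
  fixes u :: "'a::euclidean_space \<Rightarrow> real"
  assumes "a + b > 0" "0 < \<rho>" "\<rho> \<le> norm (x - y)" "\<tau> > 0"
    and \<mu>: "\<mu> > \<bar>a * real DIM('a) + b\<bar> / (2 * (a + b) * \<rho>\<^sup>2)"
    and "e0 > 0" and touch: "\<And>z. z \<in> S \<Longrightarrow> norm (z - x) < e0 \<Longrightarrow>
      u z - u x \<le> \<tau> * (barrier y \<mu> z - barrier y \<mu> x)"
  obtains q H where "superjet S u x q H" "q \<noteq> 0" "nlap a b q H < 0"
proof -
  define G where "G = (\<lambda>z. (\<tau> * (2 * \<mu> * exp (- \<mu> * ((z - y) \<bullet> (z - y))))) *\<^sub>R (z - y))"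
  define c where "c = \<tau> * (2 * \<mu> * exp (- \<mu> * ((x - y) \<bullet> (x - y))))"
  define H where "H = (\<lambda>h. c *\<^sub>R h - (2 * \<mu> * c * ((x - y) \<bullet> h)) *\<^sub>R (x - y))"
  have "0 \<le> \<bar>a * real DIM('a) + b\<bar> / (2 * (a + b) * \<rho>\<^sup>2)" using assms by simp
  then have "\<mu> > 0" using \<mu> by linarith
  then have "c > 0" using \<open>\<tau> > 0\<close> by (simp add: c_def)
  have "x - y \<noteq> 0" using assms by auto
  have g: "GDERIV (\<lambda>z. \<tau> * barrier y \<mu> z) z :> G z" for z
    unfolding gderiv_def barrier_def G_def
    by (rule derivative_eq_intros refl | simp)+ (auto simp: fun_eq_iff inner_commute algebra_simps)
  have h: "(G has_derivative H) (at x)"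
    unfolding G_def H_def c_def
    by (rule derivative_eq_intros refl | simp)+ (auto simp: fun_eq_iff inner_commute algebra_simps)
  have jet: "superjet S u x (G x) H"
    using touch by (intro superjet_smooth[OF \<open>e0 > 0\<close> g h]) (auto simp: algebra_simps)
  have Gx: "G x = c *\<^sub>R (x - y)" by (simp add: G_def c_def)
  have tr: "op_trace H = c * real DIM('a) - 2 * \<mu> * c * (norm (x - y))\<^sup>2"
  proof -
    have "op_trace H = (\<Sum>i\<in>Basis. c - 2 * \<mu> * c * (((x - y) \<bullet> i) * ((x - y) \<bullet> i)))"
      unfolding op_trace_def H_def by (intro sum.cong) (auto simp: inner_diff_left algebra_simps)
    also have "\<dots> = c * real DIM('a) - 2 * \<mu> * c * ((x - y) \<bullet> (x - y))"
      unfolding euclidean_inner[of "x - y" "x - y"] by (simp add: sum_subtractf sum_distrib_left)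
    finally show ?thesis by (simp add: dot_square_norm)
  qed
  have dir: "(H (G x) \<bullet> G x) / (norm (G x))\<^sup>2 = c - 2 * \<mu> * c * (norm (x - y))\<^sup>2"
  proof -
    define z where "z = x - y"
    have z: "z \<noteq> 0" using \<open>x - y \<noteq> 0\<close> by (simp add: z_def)
    have "H (c *\<^sub>R z) \<bullet> (c *\<^sub>R z) = (c - 2 * \<mu> * c * (norm z)\<^sup>2) * (norm (c *\<^sub>R z))\<^sup>2"
      by (simp add: H_def z_def[symmetric] inner_diff_left dot_square_norm power_mult_distrib
          power2_eq_square algebra_simps)
    then show ?thesis using \<open>c > 0\<close> z by (simp add: Gx z_def[symmetric])
  qed
  have "nlap a b (G x) H = c * ((a * real DIM('a) + b) - 2 * \<mu> * (a + b) * (norm (x - y))\<^sup>2)"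
    unfolding nlap_def tr times_divide_eq_right[symmetric] dir by (simp add: algebra_simps)
  moreover have "(a * real DIM('a) + b) < 2 * \<mu> * (a + b) * (norm (x - y))\<^sup>2"
  proof -
    have "(a * real DIM('a) + b) < \<mu> * (2 * (a + b) * \<rho>\<^sup>2)"
      using \<mu> assms by (simp add: pos_divide_less_eq)
    also have "\<dots> \<le> \<mu> * (2 * (a + b) * (norm (x - y))\<^sup>2)"
      using assms \<open>\<mu> > 0\<close> by (intro mult_left_mono power_mono) auto
    finally show ?thesis by (simp add: algebra_simps)
  qed
  ultimately have "nlap a b (G x) H < 0" using \<open>c > 0\<close> by (simp add: mult_pos_neg)
  moreover have "G x \<noteq> 0" using Gx \<open>c > 0\<close> \<open>x - y \<noteq> 0\<close> by simp
  ultimately show thesis using jet that by blast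
qed

text \<open>Maximum points of \<open>u\<close> minus a growing multiple of the barrier must violate
  the equation, so they lie on the boundary and satisfy u \<le> g. The penalty drives a subsequence
  to \<open>x0\<close> without letting the values of \<open>u\<close> fall below
  \<open>u x0\<close>, and continuity of \<open>g\<close> finishes the argument.\<close>

lemma boundary_le:
  fixes u g :: "'a::euclidean_space \<Rightarrow> real"
  assumes "C2_domain \<Omega>" "bounded \<Omega>" "a + b > 0"
    and usc: "usc_on (closure \<Omega>) u" and g: "continuous_on (frontier \<Omega>) g"
    and jets: "\<And>x q H. x \<in> closure \<Omega> \<Longrightarrow> superjet (closure \<Omega>) u x q H \<Longrightarrow> q \<noteq> 0 \<Longrightarrow>
      nlap a b q H \<ge> 0 \<or> x \<notin> \<Omega> \<and> u x \<le> g x"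
    and x0: "x0 \<in> frontier \<Omega>"
  shows "u x0 \<le> g x0"
proof -
  let ?K = "closure \<Omega>"
  have cK: "compact ?K" using assms by simp
  have x0K: "x0 \<in> ?K" using x0 by (simp add: frontier_def)
  obtain y R where R: "R > 0" "norm (x0 - y) = R" "\<And>x. x \<in> ?K \<Longrightarrow> x \<noteq> x0 \<Longrightarrow> norm (x - y) > R"
    using exterior_ball[OF assms(1) x0] by metis
  define \<mu> where "\<mu> = \<bar>a * real DIM('a) + b\<bar> / (2 * (a + b) * R\<^sup>2) + 1"
  have \<mu>: "\<mu> > \<bar>a * real DIM('a) + b\<bar> / (2 * (a + b) * R\<^sup>2)" "\<mu> > 0"
    using assms R by (auto simp: \<mu>_def add_nonneg_pos)
  define \<beta> where "\<beta> = (\<lambda>x. barrier y \<mu> x - barrier y \<mu> x0)"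
  have \<beta>_nonneg: "\<beta> x \<ge> 0" if "x \<in> ?K" for x
    using that R(2) R(3)[of x] by (cases "x = x0") (auto simp: \<beta>_def barrier_le_iff[OF \<mu>(2)])
  have \<beta>_zero: "x = x0" if "x \<in> ?K" "\<beta> x \<le> 0" for x
    using that R(2) R(3)[of x] by (auto simp: \<beta>_def barrier_le_iff[OF \<mu>(2)])
  have \<beta>_cont: "continuous_on S \<beta>" for S
    unfolding \<beta>_def by (intro continuous_intros continuous_barrier)
  have "\<exists>x\<in>?K. \<forall>z\<in>?K. u z + - real (Suc n) * \<beta> z \<le> u x + - real (Suc n) * \<beta> x" for n
    using x0K by (intro usc_on_attains_sup usc_on_add usc continuous_imp_usc_on cK)
      (auto intro!: continuous_intros \<beta>_cont)
  then obtain s where s: "\<And>n. s n \<in> ?K"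
    "\<And>n z. z \<in> ?K \<Longrightarrow> u z + - real (Suc n) * \<beta> z \<le> u (s n) + - real (Suc n) * \<beta> (s n)"
    by metis
  \<comment> \<open>The factor \<open>Suc n\<close> only rescales the barrier jet, so a single
    \<open>\<mu>\<close> works for all \<open>n\<close>.\<close>
  have sb: "s n \<notin> \<Omega> \<and> u (s n) \<le> g (s n)" for n
  proof -
    have "R \<le> norm (s n - y)" using R(2) R(3)[OF s(1)] by (cases "s n = x0") force+
    from superjet_barrier[OF assms(3) R(1) this _ \<mu>(1) zero_less_one, of "real (Suc n)" ?K u]
    obtain q H where "superjet ?K u (s n) q H" "q \<noteq> 0" "nlap a b q H < 0"
      using s(2)[of _ n] by (auto simp: \<beta>_def algebra_simps)
    with jets[OF s(1)] show ?thesis by fastforce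
  qed
  then have sf: "s n \<in> frontier \<Omega>" for n
    using s(1) assms(1) by (auto simp: frontier_def C2_domain_def interior_open)
  have "compact (frontier \<Omega>)" using assms(2) by (rule compact_frontier_bounded)
  with sf obtain l r where lr: "l \<in> frontier \<Omega>" "strict_mono r" "(s \<circ> r) \<longlonglongrightarrow> l"
    unfolding compact_def by blast
  have ux0: "u x0 \<le> u (s n) - real (Suc n) * \<beta> (s n)" for n
    using s(2)[OF x0K, of n] by (simp add: \<beta>_def algebra_simps)
  obtain B where B: "\<And>x. x \<in> ?K \<Longrightarrow> u x \<le> B"
    using usc_on_attains_sup[OF usc cK] x0K by (metis empty_iff)
  have small: "\<beta> (s n) \<le> (B - u x0) * inverse (real (Suc n))" for n
    using ux0[of n] B[OF s(1), of n] by (simp add: field_simps)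
  have "(\<lambda>n. \<beta> ((s \<circ> r) n)) \<longlonglongrightarrow> \<beta> l"
    using \<beta>_cont[of UNIV] lr(3) by (auto simp: continuous_on_eq_continuous_at comp_def intro: isCont_tendsto_compose)
  moreover have "(\<lambda>n. (B - u x0) * inverse (real (Suc (r n)))) \<longlonglongrightarrow> 0"
    using tendsto_mult_right_zero[OF LIMSEQ_subseq_LIMSEQ[OF LIMSEQ_inverse_real_of_nat lr(2)]]
    by (simp add: comp_def)
  ultimately have "\<beta> l \<le> 0" using small by (intro LIMSEQ_le) auto
  with lr(1) have "l = x0" by (intro \<beta>_zero) (auto simp: frontier_def)
  have "(\<lambda>n. g ((s \<circ> r) n)) \<longlonglongrightarrow> g x0"
    using g lr sf unfolding \<open>l = x0\<close> continuous_on_sequentially comp_def by auto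
  moreover have "u x0 \<le> g ((s \<circ> r) n)" for n
    using ux0[of "r n"] sb[of "r n"] \<beta>_nonneg[OF s(1), of "r n"]
    by (smt (verit) comp_apply of_nat_0_le_iff mult_nonneg_nonneg)
  ultimately show ?thesis by (intro LIMSEQ_le_const) auto
qed

section \<open>Passing to strict subsolutions\<close>

text \<open>Here \<open>u = \<psi> (w)\<close> with \<open>\<psi>'' = - \<delta> \<psi>'\<close>, so that passing from \<open>u\<close> to \<open>w\<close> gains
  \<open>\<delta> (a + b) \<bar>q\<bar>\<^sup>2\<close>.\<close>

lemma superjet_strict:
  fixes u w :: "'a::euclidean_space \<Rightarrow> real"
  assumes jets: "\<And>q H. superjet S u x q H \<Longrightarrow> q \<noteq> 0 \<Longrightarrow> nlap a b q H \<ge> 0"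
    and u: "\<And>z. z \<in> S \<Longrightarrow> u z = M + (1 - exp (- \<delta> * (w z - M))) / \<delta>"
    and "x \<in> S" "\<delta> > 0"
    and jet: "superjet S w x q H" and "q \<noteq> 0"
  shows "nlap a b q H \<ge> \<delta> * (a + b) * (norm q)\<^sup>2"
proof -
  have "\<delta> * (a + b) * (norm q)\<^sup>2 - nlap a b q H \<le> \<eta> * (2 * (a * real DIM('a) + b))" if "\<eta> > 0" for \<eta>
  proof -
    \<comment> \<open>The additional \<open>2 * \<eta>\<close> in the Hessian contributes exactly
      the error term of the jet, so \<open>T\<close> lies above \<open>w\<close> near
      \<open>x\<close>.\<close>
    let ?H = "\<lambda>w. H w + (2 * \<eta>) *\<^sub>R w"
    have lin: "linear ?H" by (rule linear_add_id[OF superjet_linear[OF jet]])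
    define T where "T = quartic x (w x) q ?H 0"
    define DT where "DT = (\<lambda>y. q + sym_part ?H (y - x))"
    obtain d where d: "d > 0" "\<And>y. y \<in> S \<Longrightarrow> norm (y - x) < d \<Longrightarrow>
        w y \<le> w x + q \<bullet> (y - x) + H (y - x) \<bullet> (y - x) / 2 + \<eta> * (norm (y - x))\<^sup>2"
      using superjetD[OF jet \<open>\<eta> > 0\<close>] by metis
    have wT: "w y \<le> T y" if "y \<in> S" "norm (y - x) < d" for y
      using d(2)[OF that] by (simp add: T_def quartic_def inner_add_left add_divide_distrib dot_square_norm)
    have Tx: "T x = w x" by (simp add: T_def quartic_def)
    have DTx: "DT x = q" by (simp add: DT_def linear_0[OF linear_sym_part[OF lin]])
    have gT: "GDERIV T y :> DT y" for y
      using GDERIV_quartic[OF lin, of x "w x" q 0 y] by (simp add: T_def DT_def)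
    have hT: "(DT has_derivative sym_part ?H) (at x)"
      using has_derivative_grad_quartic[OF lin, of q x 0 x] by (simp add: DT_def)
    define \<psi> where "\<psi> = (\<lambda>t. M + (1 - exp (- \<delta> * (t - M))) / \<delta>)"
    define \<psi>' where "\<psi>' = (\<lambda>t. exp (- \<delta> * (t - M)))"
    have u\<psi>: "u z = \<psi> (w z)" if "z \<in> S" for z using that by (simp add: u \<psi>_def)
    have mono: "\<psi> t \<le> \<psi> t'" if "t \<le> t'" for t t'
      using that \<open>\<delta> > 0\<close> by (simp add: \<psi>_def divide_right_mono)
    have d\<psi>: "DERIV \<psi> t :> \<psi>' t" for t
      unfolding \<psi>_def \<psi>'_def using \<open>\<delta> > 0\<close>
      by (auto intro!: derivative_eq_intros simp: field_simps)
    have d\<psi>': "DERIV \<psi>' t :> - \<delta> * \<psi>' t" for t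
      unfolding \<psi>'_def by (auto intro!: derivative_eq_intros simp: field_simps)
    define c where "c = \<psi>' (w x)"
    have "c > 0" by (simp add: c_def \<psi>'_def)
    \<comment> \<open>The derivative at \<open>x\<close> of the gradient of \<psi>(T). The rank-one
      term comes from \<psi>'' and is what produces the gain.\<close>
    define H' where "H' = (\<lambda>h. c *\<^sub>R sym_part ?H h + (- \<delta> * c * (h \<bullet> q)) *\<^sub>R q)"
    have g: "GDERIV (\<lambda>y. \<psi> (T y)) y :> \<psi>' (T y) *\<^sub>R DT y" for y
      by (rule GDERIV_DERIV_compose[OF gT d\<psi>])
    have "GDERIV (\<lambda>y. \<psi>' (T y)) x :> (- \<delta> * \<psi>' (T x)) *\<^sub>R DT x"
      by (rule GDERIV_DERIV_compose[OF gT d\<psi>'])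
    then have "((\<lambda>y. \<psi>' (T y)) has_derivative (\<lambda>h. - \<delta> * c * (h \<bullet> q))) (at x)"
      by (simp add: gderiv_def DTx Tx c_def mult.commute mult.left_commute)
    from has_derivative_scaleR[OF this hT]
    have "((\<lambda>y. \<psi>' (T y) *\<^sub>R DT y) has_derivative H') (at x)"
      unfolding H'_def DTx Tx c_def[symmetric] .
    then have "superjet S u x (\<psi>' (T x) *\<^sub>R DT x) H'"
      using wT mono Tx u\<psi> \<open>x \<in> S\<close>
      by (intro superjet_smooth[OF d(1) g]) auto
    moreover have "\<psi>' (T x) *\<^sub>R DT x = c *\<^sub>R q"
      by (simp add: DTx Tx c_def)
    ultimately have "nlap a b (c *\<^sub>R q) H' \<ge> 0" using jets \<open>c > 0\<close> \<open>q \<noteq> 0\<close> by auto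
    moreover have "nlap a b (c *\<^sub>R q) H' = c * (nlap a b q ?H - \<delta> * (a + b) * (norm q)\<^sup>2)"
    proof -
      have "(\<Sum>i\<in>Basis. - \<delta> * c * ((i \<bullet> q) * (q \<bullet> i))) = - \<delta> * c * (q \<bullet> q)"
        unfolding euclidean_inner[of q q] by (simp add: sum_distrib_left inner_commute)
      then have tr: "op_trace H' = c * op_trace ?H - \<delta> * c * (norm q)\<^sup>2"
        using op_trace_sym_part[OF lin]
        by (simp add: op_trace_def H'_def inner_add_left inner_diff_left sum.distrib sum_subtractf
            sum_negf sum_distrib_left[symmetric] dot_square_norm mult.assoc)
      have "H' (c *\<^sub>R q) \<bullet> (c *\<^sub>R q) = c\<^sup>2 * (c * (?H q \<bullet> q) - \<delta> * c * (norm q)\<^sup>2 * (norm q)\<^sup>2)"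
        using sym_part_diag[OF lin, of q] linear_scale[OF linear_sym_part[OF lin], of c q]
        by (simp add: H'_def inner_add_left dot_square_norm power2_eq_square algebra_simps)
      then have dir: "(H' (c *\<^sub>R q) \<bullet> (c *\<^sub>R q)) / (norm (c *\<^sub>R q))\<^sup>2
          = c * ((?H q \<bullet> q) / (norm q)\<^sup>2) - \<delta> * c * (norm q)\<^sup>2"
        using \<open>c > 0\<close> \<open>q \<noteq> 0\<close> by (simp add: power_mult_distrib diff_divide_distrib)
      show ?thesis
        unfolding nlap_def tr times_divide_eq_right[symmetric] dir by (simp add: algebra_simps)
    qed
    ultimately have "nlap a b q ?H \<ge> \<delta> * (a + b) * (norm q)\<^sup>2"
      using \<open>c > 0\<close> by (simp add: zero_le_mult_iff)
    then show ?thesis by (simp add: nlap_add_id[OF \<open>q \<noteq> 0\<close>] algebra_simps)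
  qed
  from le_zero_if_le_eps[OF this] show ?thesis by simp
qed

section \<open>Elliptic operators with constant coefficients\<close>

text \<open>Cauchy-Schwarz for the semidefinite form, applied to \<open>x\<close> and each basis
  vector and then summed, gives |S x|^2 \<le> (S x \<bullet> x) tr S for the symmetric part S. No
  diagonalisation is involved.\<close>

lemma psd_trace_bound:
  fixes H :: "'a::euclidean_space \<Rightarrow> 'a"
  assumes lin: "linear H" and psd: "\<And>w. H w \<bullet> w \<ge> 0"
  shows psd_trace_nonneg: "op_trace H \<ge> 0"
    and psd_sym_part_le: "norm (sym_part H x) \<le> op_trace H * norm x"
proof -
  let ?S = "sym_part H"
  have linS: "linear ?S" by (rule linear_sym_part[OF lin])
  have sym: "?S v \<bullet> w = ?S w \<bullet> v" for v w by (simp add: sym_part_inner[OF lin])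
  have pos: "?S w \<bullet> w \<ge> 0" for w by (simp add: sym_part_diag[OF lin] psd)
  show tr: "op_trace H \<ge> 0" unfolding op_trace_def by (intro sum_nonneg psd)
  have CS: "(?S v \<bullet> w)\<^sup>2 \<le> (?S v \<bullet> v) * (?S w \<bullet> w)" for v w
  proof -
    have q: "0 \<le> ?S v \<bullet> v + 2 * t * (?S v \<bullet> w) + t\<^sup>2 * (?S w \<bullet> w)" for t
    proof -
      have "?S (v + t *\<^sub>R w) \<bullet> (v + t *\<^sub>R w) = ?S v \<bullet> v + 2 * t * (?S v \<bullet> w) + t\<^sup>2 * (?S w \<bullet> w)"
        using sym[of w v]
        by (simp add: linear_add[OF linS] linear_scale[OF linS] inner_add_left inner_add_right
            power2_eq_square algebra_simps)
      with pos show ?thesis by metis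
    qed
    show ?thesis
    proof (cases "?S w \<bullet> w = 0")
      case True
      have "?S v \<bullet> w = 0"
      proof (rule ccontr)
        assume n: "?S v \<bullet> w \<noteq> 0"
        \<comment> \<open>At this \<open>t\<close> the polynomial, which is linear when its leading
          coefficient vanishes, takes the value - 1.\<close>
        show False using q[of "- (?S v \<bullet> v + 1) / (2 * (?S v \<bullet> w))"] n True by (simp add: field_simps)
      qed
      then show ?thesis using True by simp
    next
      case False
      then have "?S w \<bullet> w > 0" using pos[of w] by simp
      \<comment> \<open>The minimiser of the quadratic polynomial in \<open>t\<close>.\<close>
      then show ?thesis
        using q[of "- (?S v \<bullet> w) / (?S w \<bullet> w)"] by (simp add: field_simps power2_eq_square)
    qed
  qed
  have "(norm (?S x))\<^sup>2 = (\<Sum>i\<in>Basis. (?S x \<bullet> i)\<^sup>2)"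
    unfolding power2_norm_eq_inner euclidean_inner[of "?S x" "?S x"] by (simp add: power2_eq_square)
  also have "\<dots> \<le> (\<Sum>i\<in>Basis. (?S x \<bullet> x) * (?S i \<bullet> i))" by (intro sum_mono CS)
  also have "\<dots> = (?S x \<bullet> x) * op_trace H"
    by (simp add: op_trace_def sum_distrib_left sym_part_diag[OF lin])
  also have "\<dots> \<le> (norm (?S x) * norm x) * op_trace H"
    by (intro mult_right_mono norm_cauchy_schwarz tr)
  finally have *: "norm (?S x) * norm (?S x) \<le> norm (?S x) * (op_trace H * norm x)"
    by (simp add: power2_eq_square mult.commute mult.left_commute)
  show "norm (?S x) \<le> op_trace H * norm x"
    using * tr by (cases "?S x = 0") (auto simp: mult_le_cancel_left)
qed

lemma psd_diag_le:
  assumes "linear H" "\<And>w. H w \<bullet> w \<ge> 0"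
  shows "H x \<bullet> x \<le> op_trace H * (norm x)\<^sup>2"
proof -
  have "H x \<bullet> x = sym_part H x \<bullet> x" by (simp add: sym_part_diag assms)
  also have "\<dots> \<le> norm (sym_part H x) * norm x" by (rule norm_cauchy_schwarz)
  also have "\<dots> \<le> op_trace H * norm x * norm x" by (intro mult_right_mono psd_sym_part_le assms) auto
  finally show ?thesis by (simp add: power2_eq_square)
qed

text \<open>Difference of squares for a symmetric form. The trace on the right is the point:
  changing the direction in which a Hessian is evaluated costs a small multiple of its
  trace.\<close>

lemma psd_diag_diff:
  assumes "linear H" "\<And>w. H w \<bullet> w \<ge> 0"
  shows "\<bar>H x \<bullet> x - H y \<bullet> y\<bar> \<le> op_trace H * norm (x - y) * norm (x + y)"
proof -
  have "H x \<bullet> x - H y \<bullet> y = sym_part H (x - y) \<bullet> (x + y)"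
    by (simp add: sym_part_inner assms linear_diff linear_add inner_add_right inner_diff_right
        inner_add_left inner_diff_left field_simps)
  also have "\<bar>\<dots>\<bar> \<le> norm (sym_part H (x - y)) * norm (x + y)" by (rule Cauchy_Schwarz_ineq2)
  also have "\<dots> \<le> op_trace H * norm (x - y) * norm (x + y)"
    by (intro mult_right_mono psd_sym_part_le assms) auto
  finally show ?thesis .
qed

text \<open>\<open>nlap\<close> with its direction frozen at \<open>e\<close>: the coefficient
  matrix has eigenvalue a + b along \<open>e\<close> and a on the orthogonal complement.\<close>

definition lform :: "real \<Rightarrow> real \<Rightarrow> 'a::euclidean_space \<Rightarrow> ('a \<Rightarrow> 'a) \<Rightarrow> real" where
  "lform a b e H = a * op_trace H + b * (H e \<bullet> e)"

lemma lform_add_id: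
  fixes e :: "'a::euclidean_space"
  assumes "norm e = 1"
  shows "lform a b e (\<lambda>w. H w + c *\<^sub>R w) = lform a b e H + c * (a * real DIM('a) + b)"
  using assms by (simp add: lform_def op_trace_def inner_add_left sum.distrib dot_square_norm algebra_simps)

text \<open>For negative \<open>b\<close> the directional term is dominated by the trace, leaving
  the coefficient a + b in front of it.\<close>

lemma lform_nonneg:
  assumes "linear H" "\<And>w. H w \<bullet> w \<ge> 0" "a > 0" "a + b > 0" "norm e = 1"
  shows "lform a b e H \<ge> 0"
proof (cases "b \<ge> 0")
  case True
  then show ?thesis using assms psd_trace_nonneg[OF assms(1,2)] by (simp add: lform_def)
next
  case False
  have "H e \<bullet> e \<le> op_trace H" using psd_diag_le[OF assms(1,2), of e] assms by simp
  then have "b * op_trace H \<le> b * (H e \<bullet> e)" using False by (intro mult_left_mono_neg) auto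
  moreover have "(a + b) * op_trace H \<ge> 0" using psd_trace_nonneg[OF assms(1,2)] assms by simp
  ultimately show ?thesis by (simp add: lform_def algebra_simps)
qed

lemma lform_dim_pos:
  fixes e :: "'a::euclidean_space"
  assumes "a > 0" "a + b > 0"
  shows "a * real DIM('a) + b > 0"
proof -
  have "a * 1 \<le> a * real DIM('a)" using assms DIM_positive[where 'a='a]
    by (intro mult_left_mono) (auto simp: Suc_le_eq)
  with assms show ?thesis by linarith
qed

text \<open>Adding the expansions at x + t w and x - t w cancels the gradient.\<close>

lemma local_max_hessian:
  fixes \<phi> :: "'a::euclidean_space \<Rightarrow> real"
  assumes "e0 > 0" and g: "\<And>y. norm (y - x) < e0 \<Longrightarrow> GDERIV \<phi> y :> G y"
    and h: "(G has_derivative H) (at x)"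
    and max: "\<And>y. norm (y - x) < e0 \<Longrightarrow> \<phi> y \<le> \<phi> x"
  shows "H w \<bullet> w \<le> 0"
proof -
  have lin: "linear H" using h has_derivative_linear by blast
  have "H w \<bullet> w \<le> \<eta> * (2 * (norm w)\<^sup>2)" if "\<eta> > 0" for \<eta>
  proof (cases "w = 0")
    case True then show ?thesis by (simp add: linear_0[OF lin])
  next
    case False
    obtain d where d: "d > 0" "\<And>y. norm (y - x) < d \<Longrightarrow>
      \<bar>\<phi> y - \<phi> x - G x \<bullet> (y - x) - H (y - x) \<bullet> (y - x) / 2\<bar> \<le> \<eta> * (norm (y - x))\<^sup>2"
      using second_order_taylor[OF assms(1) g h \<open>\<eta> > 0\<close>] by blast
    define t where "t = min d e0 / (2 * norm w)"
    have t: "t > 0" using d assms False by (simp add: t_def)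
    have "norm (t *\<^sub>R w) = t * norm w" using t by simp
    also have "\<dots> = min d e0 / 2" using False by (simp add: t_def)
    also have "\<dots> < min d e0" using d(1) assms(1) by linarith
    finally have tn: "norm (t *\<^sub>R w) < min d e0" .
    have "0 \<le> - (G x \<bullet> (t *\<^sub>R w)) - H (t *\<^sub>R w) \<bullet> (t *\<^sub>R w) / 2 + \<eta> * (norm (t *\<^sub>R w))\<^sup>2"
      using d(2)[of "x + t *\<^sub>R w"] max[of "x + t *\<^sub>R w"] tn by simp
    moreover have "0 \<le> (G x \<bullet> (t *\<^sub>R w)) - H (t *\<^sub>R w) \<bullet> (t *\<^sub>R w) / 2 + \<eta> * (norm (t *\<^sub>R w))\<^sup>2"
      using d(2)[of "x - t *\<^sub>R w"] max[of "x - t *\<^sub>R w"] tn linear_neg[OF lin, of "t *\<^sub>R w"] by simp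
    ultimately have "H (t *\<^sub>R w) \<bullet> (t *\<^sub>R w) \<le> 2 * \<eta> * (norm (t *\<^sub>R w))\<^sup>2" by linarith
    then have "t\<^sup>2 * (H w \<bullet> w) \<le> t\<^sup>2 * (2 * \<eta> * (norm w)\<^sup>2)"
      by (simp add: linear_scale[OF lin] power_mult_distrib power2_eq_square[of t] algebra_simps)
    then show ?thesis using t by (simp add: mult_le_cancel_left algebra_simps)
  qed
  from le_zero_if_le_eps[OF this] show ?thesis .
qed

section \<open>Harmonic polynomials with prescribed values on a sphere\<close>

text \<open>Linearity of \<open>T\<close> is asked for on the span only: the operator to which this
  is applied is built from derivatives and is known to be linear only on polynomials. Surjectivity
  is a count of independent vectors.\<close>

lemma (in vector_space) inj_endo_surj:
  assumes "finite M" and maps: "\<And>x. x \<in> span M \<Longrightarrow> T x \<in> span M"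
    and add: "\<And>x y. x \<in> span M \<Longrightarrow> y \<in> span M \<Longrightarrow> T (x + y) = T x + T y"
    and scl: "\<And>c x. x \<in> span M \<Longrightarrow> T (scale c x) = scale c (T x)"
    and inj: "\<And>x. x \<in> span M \<Longrightarrow> T x = 0 \<Longrightarrow> x = 0"
    and y: "y \<in> span M"
  shows "\<exists>x\<in>span M. T x = y"
proof -
  obtain B where B: "B \<subseteq> M" "independent B" "span B = span M"
    using maximal_independent_subset[of M] span_mono span_span by (metis span_minimal subspace_span subset_antisym)
  have finB: "finite B" using B(1) \<open>finite M\<close> finite_subset by blast
  have BV: "B \<subseteq> span M" using B by (metis span_superset)
  have T_sum: "(\<Sum>v\<in>C. scale (c v) v) \<in> span M \<and> T (\<Sum>v\<in>C. scale (c v) v) = (\<Sum>v\<in>C. scale (c v) (T v))"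
    if "finite C" "C \<subseteq> span M" for C c
    using that
  proof (induction C rule: finite_induct)
    case empty
    have "T (scale 0 0) = scale 0 (T 0)" by (rule scl[OF span_zero])
    then show ?case by (simp add: span_zero)
  next
    case (insert z C)
    then show ?case by (simp add: add scl span_add span_scale)
  qed
  have injB: "inj_on T B"
  proof (rule inj_onI)
    fix v w assume vw: "v \<in> B" "w \<in> B" "T v = T w"
    then have V: "v \<in> span M" "w \<in> span M" using BV by auto
    have "T (v + scale (-1) w) = T v + scale (-1) (T w)"
      using V by (simp only: add scl span_scale)
    then have "T (v - w) = 0" using vw by simp
    from inj[OF span_diff[OF V] this] have "v - w = 0" .
    then show "v = w" by simp
  qed
  have ind: "independent (T ` B)"
  proof
    assume "dependent (T ` B)"
    then obtain c where c: "\<exists>v\<in>T ` B. c v \<noteq> 0" "(\<Sum>v\<in>T ` B. scale (c v) v) = 0"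
      unfolding dependent_finite[OF finite_imageI[OF finB]] by auto
    have z: "(\<Sum>v\<in>B. scale (c (T v)) (T v)) = 0"
      using c(2) unfolding sum.reindex[OF injB] comp_def .
    have "(\<Sum>v\<in>B. scale (c (T v)) v) = 0"
      using T_sum[OF finB BV, of "\<lambda>v. c (T v)"] unfolding z by (elim conjE) (rule inj)
    moreover have "\<exists>v\<in>B. c (T v) \<noteq> 0" using c(1) by blast
    ultimately have "dependent B"
      unfolding dependent_finite[OF finB] by (intro exI[of _ "\<lambda>v. c (T v)"] conjI)
    with B(2) show False by blast
  qed
  have "y \<in> span (T ` B)"
  proof (rule ccontr)
    assume "y \<notin> span (T ` B)"
    then have "independent (insert y (T ` B))" using ind by (rule independent_insertI)
    moreover have "insert y (T ` B) \<subseteq> span B" using y maps BV B(3) by auto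
    ultimately have "card (insert y (T ` B)) \<le> card B"
      using independent_span_bound[OF finB] by blast
    moreover have "y \<notin> T ` B" using \<open>y \<notin> span (T ` B)\<close> span_base by blast
    ultimately show False using finB card_image[OF injB] by simp
  qed
  then obtain c where "y = (\<Sum>v\<in>T ` B. scale (c v) v)"
    using finB span_finite[of "T ` B"] by auto
  then have "y = (\<Sum>v\<in>B. scale (c (T v)) (T v))" unfolding sum.reindex[OF injB] comp_def .
  with T_sum[OF finB BV, of "\<lambda>v. c (T v)"] show ?thesis by (elim conjE) (rule bexI, simp only:)
qed

section \<open>Polynomials of bounded degree as a finite-dimensional space\<close>

interpretation fun_vs: vector_space "\<lambda>(c::real) (f::'a \<Rightarrow> real) x. c * f x"
  by unfold_locales (auto simp: algebra_simps fun_eq_iff)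

text \<open>Monomials of degree at most \<open>n\<close>, each set containing the previous one, so
  that degree bounds can be raised freely.\<close>

primrec mons :: "nat \<Rightarrow> ('a::euclidean_space \<Rightarrow> real) set" where
  "mons 0 = {\<lambda>x. 1}"
| "mons (Suc n) = mons n \<union> (\<lambda>(b, m) x. (x \<bullet> b) * m x) ` (Basis \<times> mons n)"

definition polys :: "nat \<Rightarrow> ('a::euclidean_space \<Rightarrow> real) set" where
  "polys n = fun_vs.span (mons n)"

lemma finite_mons: "finite (mons n)"
  by (induction n) auto

lemma polys_base: "m \<in> mons n \<Longrightarrow> m \<in> polys n"
  unfolding polys_def by (rule fun_vs.span_base)

lemma polys_add: "f \<in> polys n \<Longrightarrow> g \<in> polys n \<Longrightarrow> (\<lambda>x. f x + g x) \<in> polys n"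
  using fun_vs.span_add[of f "mons n" g] by (simp add: polys_def plus_fun_def)

lemma polys_scale: "f \<in> polys n \<Longrightarrow> (\<lambda>x. c * f x) \<in> polys n"
  unfolding polys_def by (rule fun_vs.span_scale)

lemma polys_diff: "f \<in> polys n \<Longrightarrow> g \<in> polys n \<Longrightarrow> (\<lambda>x. f x - g x) \<in> polys n"
  using polys_add[OF _ polys_scale[of g n "-1"], of f] by simp

lemma polys_zero: "(\<lambda>x. 0) \<in> polys n"
  using fun_vs.span_zero[of "mons n"] by (simp add: polys_def zero_fun_def)

lemma polys_sum: "finite I \<Longrightarrow> (\<And>i. i \<in> I \<Longrightarrow> f i \<in> polys n) \<Longrightarrow> (\<lambda>x. \<Sum>i\<in>I. f i x) \<in> polys n"
  by (induction I rule: finite_induct) (auto intro: polys_add polys_zero)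

text \<open>Membership is carried along in the addition and scaling steps because the rules for
  derivatives need it there.\<close>

lemma polys_induct [consumes 1, case_names zero base add scale]:
  assumes "f \<in> polys n" and "P (\<lambda>x. 0)" and "\<And>m. m \<in> mons n \<Longrightarrow> P m"
    and "\<And>f g. f \<in> polys n \<Longrightarrow> g \<in> polys n \<Longrightarrow> P f \<Longrightarrow> P g \<Longrightarrow> P (\<lambda>x. f x + g x)"
    and "\<And>f c. f \<in> polys n \<Longrightarrow> P f \<Longrightarrow> P (\<lambda>x. c * f x)"
  shows "P f"
proof -
  have "f \<in> polys n \<and> P f"
    using assms(1) unfolding polys_def
  proof (induction rule: fun_vs.span_induct_alt)
    case base
    then show ?case using assms(2) fun_vs.span_zero[of "mons n"] by (simp add: zero_fun_def)
  next
    case (step c m g)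
    have "(\<lambda>x. c * m x) \<in> polys n" "P (\<lambda>x. c * m x)"
      using step(1) polys_base assms(3,5) polys_scale by blast+
    then show ?case
      using step(2) assms(4)[of "\<lambda>x. c * m x" g] polys_add[of "\<lambda>x. c * m x" n g]
      by (simp add: plus_fun_def polys_def)
  qed
  then show ?thesis by simp
qed

lemma polys_mono: "k \<le> n \<Longrightarrow> polys k \<subseteq> polys n"
proof -
  have "polys n \<subseteq> polys (Suc n)" for n :: nat
    unfolding polys_def by (rule fun_vs.span_mono) auto
  then show "k \<le> n \<Longrightarrow> polys k \<subseteq> polys n" using lift_Suc_mono_le[of polys] by blast
qed

lemma polys_mult_inner:
  assumes "f \<in> polys n"
  shows "(\<lambda>x. (x \<bullet> v) * f x) \<in> polys (Suc n)"
proof -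
  have *: "(\<lambda>x. (x \<bullet> b) * f x) \<in> polys (Suc n)" if "b \<in> Basis" for b
    using assms
  proof (induction rule: polys_induct)
    case zero then show ?case by (simp add: polys_zero)
  next
    case (base m)
    then show ?case using that by (intro polys_base) auto
  next
    case (add f g) then show ?case using polys_add by (simp add: algebra_simps) fastforce
  next
    case (scale f c)
    then show ?case using polys_scale[of "\<lambda>x. (x \<bullet> b) * f x" "Suc n" c] by (simp add: mult.left_commute)
  qed
  have "(\<lambda>x. \<Sum>b\<in>Basis. (v \<bullet> b) * ((x \<bullet> b) * f x)) \<in> polys (Suc n)"
    by (intro polys_sum polys_scale *) auto
  moreover have "(\<Sum>b\<in>Basis. (v \<bullet> b) * ((x \<bullet> b) * f x)) = (x \<bullet> v) * f x" for x
    unfolding euclidean_inner[of x v] by (simp add: sum_distrib_left sum_distrib_right mult.commute mult.left_commute)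
  ultimately show ?thesis by simp
qed

lemma polys_const: "(\<lambda>x. c) \<in> polys n"
  using polys_scale[OF polys_base[of "\<lambda>x. 1" 0], of c] polys_mono[of 0 n] by auto

lemma polys_mult:
  assumes "f \<in> polys k" "g \<in> polys n"
  shows "(\<lambda>x. f x * g x) \<in> polys (k + n)"
proof -
  have mon: "(\<lambda>x. m x * g x) \<in> polys (k + n)" if "m \<in> mons k" for m k
    using that
  proof (induction k arbitrary: m)
    case 0 then show ?case using assms by simp
  next
    case (Suc k)
    show ?case
    proof (cases "m \<in> mons k")
      case True
      then show ?thesis using Suc.IH polys_mono[of "k + n" "Suc k + n"] by auto
    next
      case False
      then obtain b m' where m: "m' \<in> mons k" "m = (\<lambda>x. (x \<bullet> b) * m' x)" using Suc.prems by auto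
      show ?thesis using polys_mult_inner[OF Suc.IH[OF m(1)], of b] by (simp add: m(2) mult.assoc)
    qed
  qed
  show ?thesis
    using assms(1)
  proof (induction rule: polys_induct)
    case zero then show ?case by (simp add: polys_zero)
  next
    case (base m) then show ?case by (rule mon)
  next
    case (add f h) then show ?case using polys_add by (simp add: distrib_right)
  next
    case (scale f c)
    then show ?case using polys_scale[of "\<lambda>x. f x * g x" "k + n" c] by (simp add: mult.assoc)
  qed
qed

text \<open>Stone-Weierstrass delivers polynomial functions without a degree; the linear algebra
  below needs a degree bound.\<close>

lemma real_polynomial_function_polys:
  "real_polynomial_function f \<Longrightarrow> \<exists>n. f \<in> polys n"
proof (induction rule: real_polynomial_function.induct)
  case (linear f)
  have "f x = (x \<bullet> (\<Sum>b\<in>Basis. f b *\<^sub>R b)) * 1" for x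
    using Linear_Algebra.linear_componentwise[OF bounded_linear.linear[OF linear], of x 1]
    by (simp add: inner_sum_right mult.commute)
  then show ?case using polys_mult_inner[OF polys_const[of 1 0]] by (metis (no_types, lifting) ext)
next
  case (const c) then show ?case using polys_const by blast
next
  case (add f g)
  then obtain k n where "f \<in> polys k" "g \<in> polys n" by blast
  then have "f \<in> polys (max k n)" "g \<in> polys (max k n)"
    using polys_mono[of k "max k n"] polys_mono[of n "max k n"] by auto
  then show ?case using polys_add by blast
next
  case (mult f g) then show ?case using polys_mult by blast
qed

lemma polys_real_polynomial_function:
  assumes "f \<in> polys n" shows "real_polynomial_function f"
proof -
  have mon: "real_polynomial_function m" if "m \<in> mons k" for m :: "'a \<Rightarrow> real" and k
    using that
  proof (induction k arbitrary: m)
    case 0 then show ?case by (auto intro: real_polynomial_function.intros(2))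
  next
    case (Suc k)
    have "real_polynomial_function (\<lambda>x. (x \<bullet> b) * m' x)" if "m' \<in> mons k" for b :: 'a and m'
      by (intro real_polynomial_function.intros(4) real_polynomial_function.intros(1)[OF bounded_linear_inner_left]
          Suc.IH that)
    then show ?case using Suc by auto
  qed
  show ?thesis using assms
    by (induction rule: polys_induct)
       (auto intro: mon real_polynomial_function.intros)
qed

text \<open>On each line through the origin the restriction is a polynomial in one variable with
  infinitely many roots.\<close>

lemma polys_eq_zero:
  fixes f :: "'a::euclidean_space \<Rightarrow> real"
  assumes f: "f \<in> polys n" and "R > 0" and zero: "\<And>x. norm x < R \<Longrightarrow> f x = 0"
  shows "f = (\<lambda>x. 0)"
proof
  fix x
  have "real_polynomial_function (f \<circ> (\<lambda>t. t *\<^sub>R x))"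
    using polys_real_polynomial_function[OF f]
    by (intro real_polynomial_function_compose polynomial_function_bounded_linear bounded_linear_scaleR_left)
  then obtain a k where ak: "(f \<circ> (\<lambda>t. t *\<^sub>R x)) = (\<lambda>t. \<Sum>i\<le>k. a i * t ^ i)"
    unfolding real_polynomial_function_iff_sum by blast
  \<comment> \<open>The summand 1 covers x = 0 and keeps t x strictly inside the ball for t <
    d.\<close>
  define d where "d = R / (norm x + 1)"
  have nx: "norm x + 1 > 0" by (simp add: add_nonneg_pos)
  then have "d > 0" using \<open>R > 0\<close> by (simp add: d_def)
  have "(\<Sum>i\<le>k. a i * t ^ i) = 0" if t: "t \<in> {0..<d}" for t
  proof -
    have "t * norm x \<le> t * (norm x + 1)" using t by (intro mult_left_mono) auto
    also have "\<dots> < d * (norm x + 1)" using t by (intro mult_strict_right_mono) (auto simp: add_nonneg_pos)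
    also have "\<dots> = R" using nx by (simp add: d_def)
    finally have "f (t *\<^sub>R x) = 0" using t by (intro zero) auto
    then show ?thesis using fun_cong[OF ak, of t] by simp
  qed
  then have "{0..<d} \<subseteq> {t. (\<Sum>i\<le>k. a i * t ^ i) = 0}" by blast
  then have "\<not> finite {t. (\<Sum>i\<le>k. a i * t ^ i) = 0}"
    using infinite_Ico[OF \<open>d > 0\<close>] finite_subset by blast
  then have "\<forall>i\<le>k. a i = 0" using polyfun_finite_roots[of a k] by blast
  then show "f x = 0" using fun_cong[OF ak, of 1] by simp
qed

section \<open>Derivatives of polynomials\<close>

definition dird :: "'a::euclidean_space \<Rightarrow> ('a \<Rightarrow> real) \<Rightarrow> 'a \<Rightarrow> real" where
  "dird v f x = frechet_derivative f (at x) v"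

lemma polys_has_derivative:
  "f \<in> polys n \<Longrightarrow> (f has_derivative (\<lambda>v. dird v f x)) (at x)"
  unfolding dird_def
  using frechet_derivative_works[of f "at x"]
    differentiable_at_real_polynomial_function[OF polys_real_polynomial_function, of f n x UNIV]
  by (simp add: eta_contract_eq)

lemma dird_eqI: "(f has_derivative f') (at x) \<Longrightarrow> dird v f x = f' v"
  unfolding dird_def using frechet_derivative_at by metis

lemma dird_const: "dird v (\<lambda>x. c) = (\<lambda>x. 0)"
  using dird_eqI[OF has_derivative_const] by (intro ext)

lemma dird_add: "f \<in> polys n \<Longrightarrow> g \<in> polys n \<Longrightarrow> dird v (\<lambda>x. f x + g x) = (\<lambda>x. dird v f x + dird v g x)"
  by (intro ext dird_eqI[OF has_derivative_add] polys_has_derivative)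

lemma dird_scale: "f \<in> polys n \<Longrightarrow> dird v (\<lambda>x. c * f x) = (\<lambda>x. c * dird v f x)"
  by (intro ext dird_eqI[OF has_derivative_mult_right] polys_has_derivative)

lemma dird_mult_inner:
  assumes "f \<in> polys n"
  shows "dird v (\<lambda>x. (x \<bullet> b) * f x) = (\<lambda>x. (v \<bullet> b) * f x + (x \<bullet> b) * dird v f x)"
proof
  fix x
  have "((\<lambda>x. (x \<bullet> b) * f x) has_derivative (\<lambda>h. (x \<bullet> b) * dird h f x + (h \<bullet> b) * f x)) (at x)"
    by (rule has_derivative_mult[OF bounded_linear.has_derivative[OF bounded_linear_inner_left has_derivative_ident]
          polys_has_derivative[OF assms]])
  from dird_eqI[OF this] show "dird v (\<lambda>x. (x \<bullet> b) * f x) x = (v \<bullet> b) * f x + (x \<bullet> b) * dird v f x"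
    by simp
qed

lemma dird_polys:
  assumes "f \<in> polys (Suc n)"
  shows "dird v f \<in> polys n"
proof -
  have mon: "m \<in> mons (Suc n) \<longrightarrow> dird v m \<in> polys n" for m
  proof (induction n arbitrary: m)
    case 0
    have "dird v (\<lambda>x. (x \<bullet> b) * 1) \<in> polys 0" for b
      unfolding dird_mult_inner[OF polys_const[of 1 0]] by (simp add: dird_const polys_const)
    then show ?case by (auto simp: dird_const polys_const)
  next
    case (Suc n)
    show ?case
    proof
      assume m: "m \<in> mons (Suc (Suc n))"
      show "dird v m \<in> polys (Suc n)"
      proof (cases "m \<in> mons (Suc n)")
        case True
        then show ?thesis using Suc.IH polys_mono[of n "Suc n"] by auto
      next
        case False
        then have "m \<in> (\<lambda>(b, m) x. (x \<bullet> b) * m x) ` (Basis \<times> mons (Suc n))"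
          using m mons.simps(2)[of "Suc n"] by blast
        then obtain b m' where m': "m' \<in> mons (Suc n)" "m = (\<lambda>x. (x \<bullet> b) * m' x)" by auto
        have "m' \<in> polys (Suc n)" using m'(1) by (rule polys_base)
        moreover have "dird v m' \<in> polys n" using Suc.IH m'(1) by blast
        ultimately show ?thesis
          unfolding m'(2) dird_mult_inner[OF \<open>m' \<in> polys (Suc n)\<close>]
          by (intro polys_add polys_scale polys_mult_inner)
      qed
    qed
  qed
  show ?thesis
    using assms
  proof (induction rule: polys_induct)
    case zero then show ?case by (simp add: dird_const polys_zero)
  next
    case (base m) then show ?case using mon by blast
  next
    case (add f g) then show ?case by (simp add: dird_add[OF add(1,2)] polys_add)
  next
    case (scale f c) then show ?case by (simp add: dird_scale[OF scale(1)] polys_scale)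
  qed
qed

lemma dird_polys': "f \<in> polys n \<Longrightarrow> dird v f \<in> polys n"
  using dird_polys[of f n v] polys_mono[of n "Suc n"] by auto

definition pgrad :: "('a::euclidean_space \<Rightarrow> real) \<Rightarrow> 'a \<Rightarrow> 'a" where
  "pgrad f x = (\<Sum>i\<in>Basis. dird i f x *\<^sub>R i)"

definition phess :: "('a::euclidean_space \<Rightarrow> real) \<Rightarrow> 'a \<Rightarrow> 'a \<Rightarrow> 'a" where
  "phess f x h = (\<Sum>i\<in>Basis. dird h (dird i f) x *\<^sub>R i)"

lemma GDERIV_pgrad:
  assumes "f \<in> polys n"
  shows "GDERIV f x :> pgrad f x"
proof -
  have d: "(f has_derivative (\<lambda>v. dird v f x)) (at x)" by (rule polys_has_derivative[OF assms])
  have "dird v f x = v \<bullet> pgrad f x" for v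
    using Linear_Algebra.linear_componentwise[OF has_derivative_linear[OF d], of v 1]
    by (simp add: pgrad_def inner_sum_right mult.commute)
  with d show ?thesis by (simp add: gderiv_def)
qed

lemma pgrad_has_derivative:
  assumes "f \<in> polys n"
  shows "(pgrad f has_derivative phess f x) (at x)"
  unfolding pgrad_def[abs_def] phess_def[abs_def]
  by (intro has_derivative_sum has_derivative_scaleR_left polys_has_derivative[OF dird_polys'[OF assms]])

lemma linear_phess: "f \<in> polys n \<Longrightarrow> linear (phess f x)"
  using pgrad_has_derivative has_derivative_linear by blast

lemma lform_phess:
  "lform a b e (phess f x) = a * (\<Sum>i\<in>Basis. dird i (dird i f) x) + b * (\<Sum>i\<in>Basis. (e \<bullet> i) * dird e (dird i f) x)"
proof -
  have "phess f x j \<bullet> j = dird j (dird j f) x" if "j \<in> Basis" for j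
    using that by (simp add: phess_def inner_sum_left inner_Basis if_distrib sum.delta' cong: if_cong)
  moreover have "phess f x e \<bullet> e = (\<Sum>i\<in>Basis. (e \<bullet> i) * dird e (dird i f) x)"
    by (simp add: phess_def inner_sum_left inner_commute[of e] mult.commute)
  ultimately show ?thesis by (simp add: lform_def op_trace_def)
qed

section \<open>The constant-coefficient Dirichlet problem on a ball\<close>

definition lop :: "real \<Rightarrow> real \<Rightarrow> 'a::euclidean_space \<Rightarrow> ('a \<Rightarrow> real) \<Rightarrow> 'a \<Rightarrow> real" where
  "lop a b e f x = lform a b e (phess f x)"

lemma lop_polys:
  assumes "f \<in> polys (Suc (Suc n))" shows "lop a b e f \<in> polys n"
proof -
  have "(\<lambda>x. a * (\<Sum>i\<in>Basis. dird i (dird i f) x) + b * (\<Sum>i\<in>Basis. (e \<bullet> i) * dird e (dird i f) x)) \<in> polys n"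
    by (intro polys_add polys_scale polys_sum dird_polys assms) auto
  then show ?thesis by (simp add: lop_def[abs_def] lform_phess)
qed

lemma lop_add:
  assumes "f \<in> polys n" "g \<in> polys n"
  shows "lop a b e (\<lambda>x. f x + g x) = (\<lambda>x. lop a b e f x + lop a b e g x)"
  by (simp add: fun_eq_iff lop_def lform_phess dird_add[OF assms]
      dird_add[OF dird_polys'[OF assms(1)] dird_polys'[OF assms(2)]] sum.distrib algebra_simps)

lemma lop_scale:
  assumes "f \<in> polys n"
  shows "lop a b e (\<lambda>x. c * f x) = (\<lambda>x. c * lop a b e f x)"
  by (simp add: fun_eq_iff lop_def lform_phess dird_scale[OF assms]
      dird_scale[OF dird_polys'[OF assms(1)]] sum_distrib_left algebra_simps)

text \<open>Adding \<eta> |y|^2 raises the value of the operator to 2 \<eta> (a d + b) > 0, which is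
  incompatible with an interior maximum; then \<eta> tends to 0.\<close>

lemma lop_max_principle:
  fixes f :: "'a::euclidean_space \<Rightarrow> real"
  assumes ab: "a > 0" "a + b > 0" "norm e = 1" and f: "f \<in> polys n" and "R > 0"
    and zero: "\<And>x. norm x < R \<Longrightarrow> lop a b e f x = 0"
    and bd: "\<And>x. norm x = R \<Longrightarrow> f x \<le> 0" and x: "norm x \<le> R"
  shows "f x \<le> 0"
proof -
  have "f x \<le> \<eta> * R\<^sup>2" if "\<eta> > 0" for \<eta>
  proof -
    define w where "w = (\<lambda>y. f y + \<eta> * (y \<bullet> y))"
    define G where "G = (\<lambda>y. pgrad f y + (2 * \<eta>) *\<^sub>R y)"
    have g: "GDERIV w y :> G y" for y
    proof -
      have "GDERIV (\<lambda>y. \<eta> * (y \<bullet> y)) y :> (2 * \<eta>) *\<^sub>R y"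
        unfolding gderiv_def by (rule derivative_eq_intros refl | simp)+ (auto simp: inner_commute algebra_simps)
      from GDERIV_add[OF GDERIV_pgrad[OF f] this] show ?thesis by (simp add: w_def G_def)
    qed
    have h: "(G has_derivative (\<lambda>v. phess f y v + (2 * \<eta>) *\<^sub>R v)) (at y)" for y
      unfolding G_def
      by (intro has_derivative_add pgrad_has_derivative[OF f] has_derivative_scaleR_right has_derivative_ident)
    have "continuous_on (cball 0 R) w"
      using g unfolding gderiv_def by (meson continuous_at_imp_continuous_on has_derivative_continuous)
    then obtain z where z: "z \<in> cball 0 R" "\<And>y. y \<in> cball 0 R \<Longrightarrow> w y \<le> w z"
      using continuous_attains_sup[of "cball 0 R" w] \<open>R > 0\<close> by auto
    have "norm z = R"
    proof (rule ccontr)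
      assume "norm z \<noteq> R"
      then have zR: "norm z < R" using z by simp
      let ?H = "\<lambda>v. phess f z v + (2 * \<eta>) *\<^sub>R v"
      have linH: "linear ?H" by (rule linear_add_id[OF linear_phess[OF f]])
      have "?H v \<bullet> v \<le> 0" for v
      proof (rule local_max_hessian[OF _ g h])
        show "R - norm z > 0" using zR by simp
        fix y assume "norm (y - z) < R - norm z"
        then have "norm y \<le> R" using norm_triangle_sub[of y z] by linarith
        then show "w y \<le> w z" using z by simp
      qed
      then have "- ?H v \<bullet> v \<ge> 0" for v by (simp only: inner_minus_left neg_0_le_iff_le)
      then have "lform a b e (\<lambda>v. - ?H v) \<ge> 0"
        by (intro lform_nonneg linear_compose_neg[OF linH] ab)
      moreover have "lform a b e (\<lambda>v. - ?H v) = - lform a b e ?H"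
        by (simp add: lform_def op_trace_def sum_negf inner_minus_left sum_subtractf sum.distrib
            inner_add_left inner_diff_left algebra_simps)
      moreover have "lform a b e ?H = 2 * \<eta> * (a * real DIM('a) + b)"
        using zero[OF zR] unfolding lform_add_id[OF ab(3)] by (simp add: lop_def)
      moreover have "a * real DIM('a) + b > 0" using lform_dim_pos ab by blast
      ultimately show False using \<open>\<eta> > 0\<close> by (simp add: mult_le_0_iff not_le[symmetric] del: minus_add_distrib)
    qed
    then have "w z \<le> \<eta> * R\<^sup>2" using bd[of z] by (simp add: w_def dot_square_norm)
    moreover have "f x \<le> w x" using \<open>\<eta> > 0\<close> by (simp add: w_def)
    moreover have "w x \<le> w z" using z x by simp
    ultimately show ?thesis by linarith
  qed
  from le_zero_if_le_eps[OF this] show ?thesis .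
qed

text \<open>The solution is sought as f - s q, where s = R^2 - |x|^2 vanishes on the sphere.
  Multiplication by s raises the degree by two and the operator lowers it by two, so q \<mapsto> L(s
  q) maps polynomials of degree at most n to themselves. The maximum principle makes this map
  injective, hence it is surjective.\<close>

lemma lop_dirichlet:
  fixes f :: "'a::euclidean_space \<Rightarrow> real"
  assumes ab: "a > 0" "a + b > 0" "norm e = 1" and f: "real_polynomial_function f" and "R > 0"
  obtains h n where "h \<in> polys n" "\<And>x. lop a b e h x = 0" "\<And>x. norm x = R \<Longrightarrow> h x = f x"
proof -
  obtain n where fn: "f \<in> polys n" using real_polynomial_function_polys[OF f] by blast
  define s where "s = (\<lambda>x::'a. R\<^sup>2 - x \<bullet> x)"
  have sp: "s \<in> polys 2"
  proof -
    have "(\<lambda>x::'a. \<Sum>i\<in>Basis. (x \<bullet> i) * ((x \<bullet> i) * 1)) \<in> polys (Suc (Suc 0))"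
      by (intro polys_sum polys_mult_inner polys_const) auto
    moreover have "(\<Sum>i\<in>Basis. (x \<bullet> i) * ((x \<bullet> i) * 1)) = x \<bullet> x" for x :: 'a
      unfolding euclidean_inner[of x x] by simp
    ultimately have "(\<lambda>x::'a. x \<bullet> x) \<in> polys 2" by (simp add: numeral_2_eq_2)
    then show ?thesis unfolding s_def by (intro polys_diff polys_const)
  qed
  define T where "T = (\<lambda>q. lop a b e (\<lambda>x. s x * q x))"
  have mult: "(\<lambda>x. s x * q x) \<in> polys (Suc (Suc n))" if "q \<in> polys n" for q
    using polys_mult[OF sp that] by simp
  have Tp: "T q \<in> polys n" if "q \<in> polys n" for q
    unfolding T_def by (rule lop_polys[OF mult[OF that]])
  have Tadd: "T (p + q) = T p + T q" if "p \<in> polys n" "q \<in> polys n" for p q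
    unfolding T_def using lop_add[OF mult[OF that(1)] mult[OF that(2)]]
    by (simp add: plus_fun_def distrib_left)
  have Tscale: "T (\<lambda>x. c * q x) = (\<lambda>x. c * T q x)" if "q \<in> polys n" for c q
    unfolding T_def using lop_scale[OF mult[OF that]] by (simp add: mult.left_commute)
  have Tinj: "q = 0" if q: "q \<in> polys n" "T q = 0" for q
  proof -
    \<comment> \<open>Both signs of \<open>c\<close> are used, so that s q vanishes on the
      ball.\<close>
    have le: "s x * (c * q x) \<le> 0" if "norm x \<le> R" "c = 1 \<or> c = -1" for x c
    proof (rule lop_max_principle[OF ab mult \<open>R > 0\<close> _ _ that(1)])
      show "(\<lambda>x. c * q x) \<in> polys n" using q by (intro polys_scale)
      fix y show "lop a b e (\<lambda>x. s x * (c * q x)) y = 0"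
        using fun_cong[OF Tscale[OF q(1), of c], of y] q(2) by (simp add: T_def)
    next
      fix y :: 'a assume "norm y = R" then show "s y * (c * q y) \<le> 0" by (simp add: s_def dot_square_norm)
    qed
    have "q x = 0" if "norm x < R" for x
    proof -
      have "x \<bullet> x < R\<^sup>2" using that power_strict_mono[of "norm x" R 2] by (simp add: dot_square_norm)
      then have "s x > 0" by (simp add: s_def)
      then show ?thesis using le[of x 1] le[of x "-1"] that by (simp add: mult_le_0_iff zero_le_mult_iff)
    qed
    then show ?thesis using polys_eq_zero[OF q(1) \<open>R > 0\<close>] by (simp add: zero_fun_def)
  qed
  have "lop a b e f \<in> polys n" using lop_polys[of f n] fn polys_mono[of n "Suc (Suc n)"] by auto
  then have "\<exists>q\<in>polys n. T q = lop a b e f"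
    using fun_vs.inj_endo_surj[OF finite_mons, of n T, folded polys_def, OF Tp Tadd Tscale Tinj] by blast
  then obtain q where q: "q \<in> polys n" "T q = lop a b e f" by blast
  define h where "h = (\<lambda>x. f x + (-1) * (s x * q x))"
  have f2: "f \<in> polys (Suc (Suc n))" using fn polys_mono[of n "Suc (Suc n)"] by auto
  show thesis
  proof
    show "h \<in> polys (Suc (Suc n))" unfolding h_def using f2 mult[OF q(1)] by (intro polys_add polys_scale)
    show "lop a b e h x = 0" for x
      unfolding h_def lop_add[OF f2 polys_scale[OF mult[OF q(1)]]] lop_scale[OF mult[OF q(1)]]
      using fun_cong[OF q(2), of x] by (simp add: T_def)
    show "h x = f x" if "norm x = R" for x using that by (simp add: h_def s_def dot_square_norm)
  qed
qed

section \<open>Semiconvex functions\<close>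

text \<open>Supporting paraboloids of uniform opening, equivalently convexity of U + k |x|^2. The
  explicit slope \<open>p\<close> takes the place of a gradient at points where none is known to
  exist.\<close>

definition semiconvex :: "real \<Rightarrow> ('a::euclidean_space \<Rightarrow> real) \<Rightarrow> bool" where
  "semiconvex k U \<longleftrightarrow> (\<forall>x. \<exists>p. \<forall>z. U z \<ge> U x + p \<bullet> (z - x) - k * (norm (z - x))\<^sup>2)"

lemma semiconvexE:
  assumes "semiconvex k U"
  obtains p where "\<And>z. U z \<ge> U x + p \<bullet> (z - x) - k * (norm (z - x))\<^sup>2"
  using assms unfolding semiconvex_def by blast

lemma semiconvex_shift: "semiconvex k U \<Longrightarrow> semiconvex k (\<lambda>x. U (x + h))"
  unfolding semiconvex_def by (metis add_diff_cancel_right)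

text \<open>U + k |x|^2 has a subgradient at every point, so it is convex and therefore
  continuous.\<close>

lemma continuous_semiconvex:
  fixes U :: "'a::euclidean_space \<Rightarrow> real"
  assumes "semiconvex k U"
  shows "continuous_on S U"
proof -
  define C where "C = (\<lambda>x. U x + k * (x \<bullet> x))"
  have sub: "\<exists>s. \<forall>z. C z \<ge> C x + s \<bullet> (z - x)" for x
  proof -
    obtain p where p: "\<And>z. U z \<ge> U x + p \<bullet> (z - x) - k * (norm (z - x))\<^sup>2"
      using semiconvexE[OF assms] by blast
    have "C z \<ge> C x + (p + (2 * k) *\<^sub>R x) \<bullet> (z - x)" for z
    proof -
      have "k * (norm (z - x))\<^sup>2 = k * (z \<bullet> z) - k * (x \<bullet> x) - (2 * k) * (x \<bullet> (z - x))"
        unfolding power2_norm_eq_inner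
        by (simp add: inner_diff_left inner_diff_right inner_commute algebra_simps)
      then show ?thesis using p[of z] by (simp add: C_def inner_add_left)
    qed
    then show ?thesis by blast
  qed
  have "convex_on UNIV C"
  proof (rule convex_onI)
    fix t :: real and x y :: 'a assume t: "0 < t" "t < 1"
    let ?m = "(1 - t) *\<^sub>R x + t *\<^sub>R y"
    obtain s where s: "\<And>z. C z \<ge> C ?m + s \<bullet> (z - ?m)" using sub by blast
    have "(1 - t) * C x + t * C y \<ge> (1 - t) * (C ?m + s \<bullet> (x - ?m)) + t * (C ?m + s \<bullet> (y - ?m))"
      using t s by (intro add_mono mult_left_mono) auto
    moreover have "(1 - t) * (C ?m + s \<bullet> (x - ?m)) + t * (C ?m + s \<bullet> (y - ?m))
        = C ?m + s \<bullet> ((1 - t) *\<^sub>R (x - ?m) + t *\<^sub>R (y - ?m))"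
      by (simp add: inner_add_right inner_diff_right algebra_simps)
    moreover have "(1 - t) *\<^sub>R (x - ?m) + t *\<^sub>R (y - ?m) = 0" by (simp add: algebra_simps)
    ultimately show "C ?m \<le> (1 - t) * C x + t * C y" by simp
  qed auto
  then have "continuous_on UNIV C" by (intro convex_on_continuous) auto
  then have "continuous_on UNIV (\<lambda>x. C x - k * (x \<bullet> x))" by (intro continuous_intros)
  then show ?thesis by (simp add: C_def) (rule continuous_on_subset, auto)
qed

text \<open>Identifies slopes: two first-order expansions with quadratic errors must have the same
  linear part. The test vector is a small multiple of \<open>v\<close>.\<close>

lemma inner_le_square_imp_zero:
  fixes v :: "'a::euclidean_space"
  assumes "d > 0" and "\<And>w. norm w < d \<Longrightarrow> v \<bullet> w \<le> C * (norm w)\<^sup>2"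
  shows "v = 0"
proof (rule ccontr)
  assume "v \<noteq> 0"
  \<comment> \<open>Small enough that t v lies in the ball of radius \<open>d\<close> and C t \<le>
    1/2.\<close>
  define t where "t = min (d / (2 * norm v)) (1 / (2 * (\<bar>C\<bar> + 1)))"
  have t: "t > 0" using \<open>v \<noteq> 0\<close> \<open>d > 0\<close> by (simp add: t_def)
  have "t \<le> d / (2 * norm v)" unfolding t_def by (rule min.cobounded1)
  then have "t * norm v \<le> d / 2" using \<open>v \<noteq> 0\<close> by (simp add: field_simps)
  then have "norm (t *\<^sub>R v) < d" using t \<open>d > 0\<close> by simp
  from assms(2)[OF this] have "t * (norm v)\<^sup>2 \<le> t * (C * t * (norm v)\<^sup>2)"
    by (simp add: dot_square_norm power_mult_distrib power2_eq_square[of t] mult.assoc mult.left_commute)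
  then have "(norm v)\<^sup>2 \<le> (C * t) * (norm v)\<^sup>2" using t by (simp add: mult_le_cancel_left)
  moreover have "C * t \<le> 1 / 2"
  proof -
    have "t \<le> 1 / (2 * (\<bar>C\<bar> + 1))" unfolding t_def by (rule min.cobounded2)
    then have "t * (2 * (\<bar>C\<bar> + 1)) \<le> 1" by (simp add: pos_le_divide_eq)
    then have "2 * (\<bar>C\<bar> * t) + 2 * t \<le> 1" by (simp add: algebra_simps)
    moreover have "C * t \<le> \<bar>C\<bar> * t" using t by (intro mult_right_mono) auto
    ultimately show ?thesis using t by linarith
  qed
  then have "(C * t) * (norm v)\<^sup>2 \<le> (1 / 2) * (norm v)\<^sup>2" by (intro mult_right_mono) auto
  ultimately show False using \<open>v \<noteq> 0\<close> by simp
qed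

text \<open>The function is pinched between a paraboloid below and the jet above. Comparing
  first-order terms identifies the slopes; then the second-order terms bound the negative part of
  the Hessian.\<close>

lemma superjet_semiconvex:
  fixes U :: "'a::euclidean_space \<Rightarrow> real"
  assumes low: "\<And>z. U z \<ge> U x + p \<bullet> (z - x) - k * (norm (z - x))\<^sup>2"
    and jet: "superjet UNIV U x q H"
  shows "q = p" "H w \<bullet> w \<ge> - 2 * k * (norm w)\<^sup>2"
proof -
  have lin: "linear H" by (rule superjet_linear[OF jet])
  obtain C0 where C0: "\<And>w. norm (H w) \<le> C0 * norm w"
    using linear_bounded_pos[OF lin] by metis
  have Hle: "H w \<bullet> w \<le> C0 * (norm w)\<^sup>2" for w
  proof -
    have "H w \<bullet> w \<le> norm (H w) * norm w" by (rule norm_cauchy_schwarz)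
    also have "\<dots> \<le> C0 * norm w * norm w" by (intro mult_right_mono C0) auto
    finally show ?thesis by (simp add: power2_eq_square)
  qed
  obtain d where d: "d > 0" "\<And>y. norm (y - x) < d \<Longrightarrow>
      U y \<le> U x + q \<bullet> (y - x) + H (y - x) \<bullet> (y - x) / 2 + 1 * (norm (y - x))\<^sup>2"
    using superjetD[OF jet zero_less_one] by (metis UNIV_I)
  have "p - q = 0"
  proof (rule inner_le_square_imp_zero[OF d(1)])
    fix w :: 'a assume "norm w < d"
    then have "p \<bullet> w - k * (norm w)\<^sup>2 \<le> q \<bullet> w + H w \<bullet> w / 2 + (norm w)\<^sup>2"
      using d(2)[of "x + w"] low[of "x + w"] by simp
    then show "(p - q) \<bullet> w \<le> (k + C0 / 2 + 1) * (norm w)\<^sup>2"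
      using Hle[of w] by (simp add: inner_diff_left algebra_simps)
  qed
  then show "q = p" by simp
  have "- (H w \<bullet> w / 2 + k * (norm w)\<^sup>2) \<le> \<eta> * (norm w)\<^sup>2" if \<eta>: "\<eta> > 0" for \<eta>
  proof (cases "w = 0")
    case True then show ?thesis by (simp add: linear_0[OF lin])
  next
    case False
    obtain d where d: "d > 0" "\<And>y. norm (y - x) < d \<Longrightarrow>
        U y \<le> U x + q \<bullet> (y - x) + H (y - x) \<bullet> (y - x) / 2 + \<eta> * (norm (y - x))\<^sup>2"
      using superjetD[OF jet \<eta>] by (metis UNIV_I)
    define t where "t = d / (2 * norm w)"
    have t: "t > 0" "norm (t *\<^sub>R w) < d" using d False by (auto simp: t_def)
    then have "- k * (norm (t *\<^sub>R w))\<^sup>2 \<le> H (t *\<^sub>R w) \<bullet> (t *\<^sub>R w) / 2 + \<eta> * (norm (t *\<^sub>R w))\<^sup>2"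
      using d(2)[of "x + t *\<^sub>R w"] low[of "x + t *\<^sub>R w"] \<open>q = p\<close> by simp
    then have "t\<^sup>2 * (- (H w \<bullet> w / 2 + k * (norm w)\<^sup>2)) \<le> t\<^sup>2 * (\<eta> * (norm w)\<^sup>2)"
      by (simp add: linear_scale[OF lin] power_mult_distrib power2_eq_square[of t] algebra_simps)
    then show ?thesis using t by (simp add: mult_le_cancel_left)
  qed
  from le_zero_if_le_eps[OF this] show "H w \<bullet> w \<ge> - 2 * k * (norm w)\<^sup>2" by simp
qed

lemma superjet_shift:
  "superjet UNIV (\<lambda>x. U (x + h)) x q H \<longleftrightarrow> superjet UNIV U (x + h) q H"
proof -
  have "(\<forall>y. norm (y - x) < d \<longrightarrow> P (y + h) (y - x)) \<longleftrightarrow> (\<forall>y. norm (y - (x + h)) < d \<longrightarrow> P y (y - (x + h)))"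
    for d P
    by (metis (no_types, opaque_lifting) add_diff_cancel_right diff_add_cancel)
  from this[where P = "\<lambda>y w. U y \<le> U (x + h) + q \<bullet> w + H w \<bullet> w / 2 + _ * (norm w)\<^sup>2"]
  show ?thesis unfolding superjet_def by simp
qed

lemma superjet_add_square:
  assumes "superjet S (\<lambda>y. U y + \<mu> * (y \<bullet> y)) x q H"
  shows "superjet S U x (q - (2 * \<mu>) *\<^sub>R x) (\<lambda>w. H w + (- 2 * \<mu>) *\<^sub>R w)"
proof (rule superjetI)
  show "linear (\<lambda>w. H w + (- 2 * \<mu>) *\<^sub>R w)" by (rule linear_add_id[OF superjet_linear[OF assms]])
  fix \<eta> :: real assume "\<eta> > 0"
  then obtain d where d: "d > 0" "\<And>y. y \<in> S \<Longrightarrow> norm (y - x) < d \<Longrightarrow>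
      U y + \<mu> * (y \<bullet> y) \<le> U x + \<mu> * (x \<bullet> x) + q \<bullet> (y - x) + H (y - x) \<bullet> (y - x) / 2 + \<eta> * (norm (y - x))\<^sup>2"
    using superjetD[OF assms] by metis
  have "U y \<le> U x + (q - (2 * \<mu>) *\<^sub>R x) \<bullet> (y - x)
      + (H (y - x) + (- 2 * \<mu>) *\<^sub>R (y - x)) \<bullet> (y - x) / 2 + \<eta> * (norm (y - x))\<^sup>2"
    if "y \<in> S" "norm (y - x) < d" for y
  proof -
    have "\<mu> * (y \<bullet> y) - \<mu> * (x \<bullet> x) = (2 * \<mu>) * (x \<bullet> (y - x)) + \<mu> * ((y - x) \<bullet> (y - x))"
      by (simp add: inner_diff_left inner_diff_right inner_commute algebra_simps)
    with d(2)[OF that] show ?thesis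
      by (simp only: inner_diff_left[of q] inner_add_left inner_scaleR_left add_divide_distrib)
  qed
  with d(1) show "\<exists>d>0. \<forall>y\<in>S. norm (y - x) < d \<longrightarrow> U y \<le> U x + (q - (2 * \<mu>) *\<^sub>R x) \<bullet> (y - x)
      + (H (y - x) + (- 2 * \<mu>) *\<^sub>R (y - x)) \<bullet> (y - x) / 2 + \<eta> * (norm (y - x))\<^sup>2" by blast
qed

text \<open>At an interior maximum of W - h the polynomial h would itself supply a superjet of W on
  which the form vanishes.\<close>

lemma comparison_lop:
  fixes W :: "'a::euclidean_space \<Rightarrow> real"
  assumes "r > 0" and cont: "continuous_on UNIV W" and h: "h \<in> polys n" "\<And>x. lop a b e h x = 0"
    and jets: "\<And>x q H. norm x < r \<Longrightarrow> superjet UNIV W x q H \<Longrightarrow> lform a b e H > 0"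
    and bd: "\<And>x. norm x = r \<Longrightarrow> W x - h x \<le> m"
  shows "W 0 - h 0 \<le> m"
proof -
  have "continuous_on UNIV h"
    using GDERIV_pgrad[OF h(1)] unfolding gderiv_def
    by (meson continuous_at_imp_continuous_on has_derivative_continuous)
  then have "continuous_on (cball 0 r) (\<lambda>x. W x - h x)"
    using cont by (intro continuous_on_diff) (auto intro: continuous_on_subset)
  then obtain z where z: "z \<in> cball 0 r" "\<And>y. y \<in> cball 0 r \<Longrightarrow> W y - h y \<le> W z - h z"
    using continuous_attains_sup[of "cball 0 r" "\<lambda>x. W x - h x"] \<open>r > 0\<close> by auto
  have "norm z = r"
  proof (rule ccontr)
    assume "norm z \<noteq> r"
    then have zr: "norm z < r" using z by simp
    have "superjet UNIV W z (pgrad h z) (phess h z)"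
    proof (rule superjet_smooth[OF _ GDERIV_pgrad[OF h(1)] pgrad_has_derivative[OF h(1)]])
      show "r - norm z > 0" using zr by simp
      fix y assume "norm (y - z) < r - norm z"
      then have "norm y \<le> r" using norm_triangle_sub[of y z] by linarith
      then show "W y - W z \<le> h y - h z" using z(2)[of y] by simp
    qed
    from jets[OF zr this] h(2)[of z] show False by (simp add: lop_def)
  qed
  then show ?thesis using bd[of z] z(2)[of 0] \<open>r > 0\<close> by simp
qed

text \<open>A polynomial solution lying between \<open>U\<close> and \<open>- V\<close> on a sphere separates them at the centre
  as well.\<close>

lemma linear_comparison:
  fixes U V :: "'a::euclidean_space \<Rightarrow> real"
  assumes ab: "a > 0" "a + b > 0" "norm e = 1" and "r > 0" "c > 0"
    and cont: "continuous_on UNIV U" "continuous_on UNIV V"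
    and jU: "\<And>x q H. norm x < r \<Longrightarrow> superjet UNIV U x q H \<Longrightarrow> lform a b e H \<ge> c"
    and jV: "\<And>x q H. norm x < r \<Longrightarrow> superjet UNIV V x q H \<Longrightarrow> lform a b e H \<ge> - c / 2"
    and max: "\<And>x. norm x \<le> r \<Longrightarrow> U x + V x \<le> U 0 + V 0"
  shows False
proof -
  define N where "N = a * real DIM('a) + b"
  have N: "N > 0" unfolding N_def using lform_dim_pos ab by blast
  \<comment> \<open>The constants leave the form at least c/4 for \<open>U'\<close> and c/8 for
    \<open>V'\<close>, both positive, while \<mu> + \<nu> = - c / (16 N) is still negative. The sum
    therefore drops by \<open>\<gamma>\<close> from the centre to the sphere.\<close>
  define \<mu> where "\<mu> = - 3 * c / (8 * N)"
  define \<nu> where "\<nu> = 5 * c / (16 * N)"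
  have \<mu>N: "2 * \<mu> * N = - 3 * c / 4" using N by (simp add: \<mu>_def)
  have \<nu>N: "2 * \<nu> * N = 5 * c / 8" using N by (simp add: \<nu>_def)
  define U' where "U' = (\<lambda>x. U x + \<mu> * (x \<bullet> x))"
  define V' where "V' = (\<lambda>x. V x + \<nu> * (x \<bullet> x))"
  have jU': "lform a b e H > 0" if "norm x < r" "superjet UNIV U' x q H" for x q H
  proof -
    have "c \<le> lform a b e (\<lambda>w. H w + (- 2 * \<mu>) *\<^sub>R w)"
      using superjet_add_square that(2) unfolding U'_def by (intro jU[OF that(1)]) blast
    then show ?thesis using \<mu>N \<open>c > 0\<close> unfolding lform_add_id[OF ab(3)] N_def[symmetric] by simp
  qed
  have jV': "lform a b e H > 0" if "norm x < r" "superjet UNIV V' x q H" for x q H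
  proof -
    have "- c / 2 \<le> lform a b e (\<lambda>w. H w + (- 2 * \<nu>) *\<^sub>R w)"
      using superjet_add_square that(2) unfolding V'_def by (intro jV[OF that(1)]) blast
    then show ?thesis using \<nu>N \<open>c > 0\<close> unfolding lform_add_id[OF ab(3)] N_def[symmetric] by simp
  qed
  have cont': "continuous_on UNIV U'" "continuous_on UNIV V'"
    unfolding U'_def V'_def by (intro continuous_intros cont)+
  define \<gamma> where "\<gamma> = c * r\<^sup>2 / (16 * N)"
  have \<gamma>: "\<gamma> > 0" using N \<open>c > 0\<close> \<open>r > 0\<close> by (simp add: \<gamma>_def)
  have sum: "U' x + V' x \<le> U' 0 + V' 0 - \<gamma>" if "norm x = r" for x
  proof -
    have "\<mu> * r\<^sup>2 + \<nu> * r\<^sup>2 = - \<gamma>" using N by (simp add: \<mu>_def \<nu>_def \<gamma>_def field_simps)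
    then show ?thesis using max[of x] that by (simp add: U'_def V'_def dot_square_norm)
  qed
  have "continuous_on (cball 0 r) V'" using cont'(2) by (rule continuous_on_subset) auto
  then obtain f where f: "real_polynomial_function f" "\<And>x. x \<in> cball 0 r \<Longrightarrow> \<bar>V' x - f x\<bar> < \<gamma> / 4"
    using Stone_Weierstrass_real_polynomial_function[of "cball 0 r" V' "\<gamma> / 4"] \<gamma> by auto
  obtain h n where h: "h \<in> polys n" "\<And>x. lop a b e h x = 0" "\<And>x. norm x = r \<Longrightarrow> h x = f x"
    using lop_dirichlet[OF ab f(1) \<open>r > 0\<close>] by blast
  have Vh: "\<bar>V' x - h x\<bar> < \<gamma> / 4" if "norm x = r" for x using f(2)[of x] h(3) that by simp
  have "V' 0 - h 0 \<le> \<gamma> / 4"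
  proof (rule comparison_lop[OF \<open>r > 0\<close> cont'(2) h(1,2) jV'])
    show "V' x - h x \<le> \<gamma> / 4" if "norm x = r" for x using Vh[OF that] by linarith
  qed
  \<comment> \<open>Together with the previous bound, V'(0) - h(0) would be at most \<gamma>/4 and
    at least 3 \<gamma>/4.\<close>
  moreover have "U' 0 - (-1) * h 0 \<le> U' 0 + V' 0 - \<gamma> + \<gamma> / 4"
  proof (rule comparison_lop[OF \<open>r > 0\<close> cont'(1) polys_scale[OF h(1), of "-1"] _ jU'])
    show "lop a b e (\<lambda>x. (-1) * h x) x = 0" for x
      unfolding lop_scale[OF h(1)] by (simp add: h(2))
    show "U' x - (-1) * h x \<le> U' 0 + V' 0 - \<gamma> + \<gamma> / 4" if "norm x = r" for x
      using Vh[OF that] sum[OF that] by linarith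
  qed
  ultimately show False using \<gamma> by simp
qed

section \<open>Maxima of sums of semiconvex functions\<close>

text \<open>Adding 2 k times the identity makes the Hessian semidefinite, so the cost of replacing
  the direction of \<open>p\<close> by \<open>e\<close> is at most \<rho> times the trace, which
  goes into the first coefficient. Undoing the shift leaves the constant 2 k \<rho> d.\<close>

lemma nlap_le_lform:
  fixes H :: "'a::euclidean_space \<Rightarrow> 'a"
  assumes lin: "linear H" and low: "\<And>w. H w \<bullet> w \<ge> - 2 * k * (norm w)\<^sup>2"
    and "p \<noteq> 0" "norm e = 1" and \<rho>: "2 * \<bar>b\<bar> * norm (sgn p - e) \<le> \<rho>"
  shows "nlap a b p H \<le> lform (a + \<rho>) b e H + 2 * k * \<rho> * real DIM('a)"
proof -
  let ?H = "\<lambda>w. H w + (2 * k) *\<^sub>R w"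
  have linH: "linear ?H" by (rule linear_add_id[OF lin])
  have psd: "?H w \<bullet> w \<ge> 0" for w using low[of w] by (simp add: inner_add_left dot_square_norm)
  have tr: "op_trace ?H \<ge> 0" by (rule psd_trace_nonneg[OF linH psd])
  have "nlap a b p ?H = a * op_trace ?H + b * (?H (sgn p) \<bullet> sgn p)"
  proof -
    have "?H (sgn p) \<bullet> sgn p = (?H p \<bullet> p) / (norm p)\<^sup>2"
      using linear_scale[OF linH, of "inverse (norm p)" p]
      by (simp add: sgn_div_norm power2_eq_square divide_inverse mult.assoc mult.left_commute)
    then show ?thesis by (simp add: nlap_def)
  qed
  also have "b * (?H (sgn p) \<bullet> sgn p) \<le> b * (?H e \<bullet> e) + \<rho> * op_trace ?H"
  proof -
    have "b * (?H (sgn p) \<bullet> sgn p) - b * (?H e \<bullet> e) \<le> \<bar>b\<bar> * \<bar>?H (sgn p) \<bullet> sgn p - ?H e \<bullet> e\<bar>"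
      by (metis abs_ge_self abs_mult right_diff_distrib')
    also have "\<dots> \<le> \<bar>b\<bar> * (op_trace ?H * norm (sgn p - e) * norm (sgn p + e))"
      by (intro mult_left_mono psd_diag_diff linH psd) auto
    also have "\<dots> \<le> \<bar>b\<bar> * (op_trace ?H * norm (sgn p - e) * 2)"
      using tr norm_triangle_ineq[of "sgn p" e] \<open>p \<noteq> 0\<close> \<open>norm e = 1\<close>
      by (intro mult_left_mono) (auto simp: norm_sgn)
    also have "\<dots> = (2 * \<bar>b\<bar> * norm (sgn p - e)) * op_trace ?H" by simp
    also have "\<dots> \<le> \<rho> * op_trace ?H" by (intro mult_right_mono \<rho> tr)
    finally show ?thesis by simp
  qed
  finally have "nlap a b p ?H \<le> lform (a + \<rho>) b e ?H" by (simp add: lform_def algebra_simps)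
  then show ?thesis
    unfolding nlap_add_id[OF \<open>p \<noteq> 0\<close>] lform_add_id[OF \<open>norm e = 1\<close>] by (simp add: algebra_simps)
qed

lemma norm_sgn_diff_le:
  fixes p q :: "'a::euclidean_space"
  assumes "q \<noteq> 0"
  shows "norm (sgn p - sgn q) \<le> 2 * norm (p - q) / norm q"
proof -
  have "norm q *\<^sub>R (sgn p - sgn q) = (norm q - norm p) *\<^sub>R sgn p + (p - q)"
    using assms by (cases "p = 0") (auto simp: sgn_div_norm algebra_simps)
  then have "norm q * norm (sgn p - sgn q) \<le> \<bar>norm q - norm p\<bar> * norm (sgn p) + norm (p - q)"
    using norm_triangle_ineq[of "(norm q - norm p) *\<^sub>R sgn p" "p - q"] assms
    by (metis norm_scaleR abs_norm_cancel)
  also have "\<dots> \<le> \<bar>norm q - norm p\<bar> * 1 + norm (p - q)"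
    by (intro add_right_mono mult_left_mono) (auto simp: norm_sgn)
  also have "\<dots> \<le> 2 * norm (p - q)"
    using norm_triangle_ineq3[of q p] by (simp add: norm_minus_commute)
  finally show ?thesis using assms by (simp add: field_simps)
qed

text \<open>The slope \<open>p\<close> is tested at distance |x - x0| from \<open>x\<close> in the
  direction p - q0; the three quadratic errors contribute 4 + 1 + 1 = 6.\<close>

lemma subgradient_near:
  fixes U :: "'a::euclidean_space \<Rightarrow> real"
  assumes "k \<ge> 0"
    and low0: "\<And>z. U z \<ge> U x0 + q0 \<bullet> (z - x0) - k * (norm (z - x0))\<^sup>2"
    and up0: "\<And>z. U z \<le> U x0 + q0 \<bullet> (z - x0) + k * (norm (z - x0))\<^sup>2"
    and low: "\<And>z. U z \<ge> U x + p \<bullet> (z - x) - k * (norm (z - x))\<^sup>2"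
  shows "norm (p - q0) \<le> 6 * k * norm (x - x0)"
proof (cases "x = x0")
  case True
  have "p - q0 = 0"
  proof (rule inner_le_square_imp_zero[OF zero_less_one])
    fix w :: 'a
    show "(p - q0) \<bullet> w \<le> (2 * k) * (norm w)\<^sup>2"
      using low[of "x0 + w"] up0[of "x0 + w"] True by (simp add: inner_diff_left algebra_simps)
  qed
  then show ?thesis using \<open>k \<ge> 0\<close> by simp
next
  case False
  define s where "s = norm (x - x0)"
  have s: "s > 0" using False by (simp add: s_def)
  define v where "v = s *\<^sub>R sgn (p - q0)"
  have vs: "norm v \<le> s" using s by (simp add: v_def norm_sgn)
  have "norm (x + v - x0) \<le> 2 * s"
    using norm_triangle_ineq[of "x - x0" v] vs by (simp add: s_def algebra_simps)
  note sq = power_mono[OF this norm_ge_zero, of 2] power_mono[OF vs norm_ge_zero, of 2]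
  have "(p - q0) \<bullet> v \<le> k * (norm (x + v - x0))\<^sup>2 + k * (norm (x - x0))\<^sup>2 + k * (norm v)\<^sup>2"
    using low[of "x + v"] up0[of "x + v"] low0[of x]
    by (simp add: inner_diff_left inner_diff_right inner_add_right algebra_simps)
  also have "\<dots> \<le> k * (2 * s)\<^sup>2 + k * s\<^sup>2 + k * s\<^sup>2"
    using sq \<open>k \<ge> 0\<close> unfolding s_def[symmetric] by (intro add_mono mult_left_mono) auto
  also have "(p - q0) \<bullet> v = s * norm (p - q0)"
    by (cases "p = q0") (auto simp: v_def sgn_div_norm dot_square_norm power2_eq_square)
  finally have "s * norm (p - q0) \<le> s * (6 * k * s)" by (simp add: power2_eq_square algebra_simps)
  then show ?thesis using s by (simp add: s_def mult_le_cancel_left)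
qed

lemma lform_minus: "linear H \<Longrightarrow> lform a b (- e) H = lform a b e H"
  by (simp add: lform_def linear_neg)

lemma zero_gradient_at_max:
  fixes U V :: "'a::euclidean_space \<Rightarrow> real"
  assumes "k \<ge> 0" "a \<ge> 0" "a + b > 0" "\<kappa> > 0" and sc: "semiconvex k U" "semiconvex k V"
    and "e0 > 0"
    and jU: "\<And>x q H. norm (x - x0) < e0 \<Longrightarrow> superjet UNIV U x q H \<Longrightarrow> q \<noteq> 0 \<Longrightarrow>
      nlap a b q H \<ge> \<kappa> * (norm q)\<^sup>2"
    and jV: "\<And>x q H. norm (x - x0) < e0 \<Longrightarrow> superjet UNIV V x q H \<Longrightarrow> q \<noteq> 0 \<Longrightarrow> nlap a b q H \<ge> 0"
    and max: "\<And>x. U x + V x \<le> U x0 + V x0"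
  shows "U z \<ge> U x0 - k * (norm (z - x0))\<^sup>2"
proof -
  obtain p where p: "\<And>z. U z \<ge> U x0 + p \<bullet> (z - x0) - k * (norm (z - x0))\<^sup>2"
    using semiconvexE[OF sc(1)] by blast
  obtain p' where p': "\<And>z. V z \<ge> V x0 + p' \<bullet> (z - x0) - k * (norm (z - x0))\<^sup>2"
    using semiconvexE[OF sc(2)] by blast
  have "p + p' = 0"
  proof (rule inner_le_square_imp_zero[OF zero_less_one])
    fix w :: 'a
    show "(p + p') \<bullet> w \<le> (2 * k) * (norm w)\<^sup>2"
      using p[of "x0 + w"] p'[of "x0 + w"] max[of "x0 + w"] by (simp add: inner_add_left)
  qed
  then have p'_eq: "p' = - p" by (simp add: add_eq_0_iff)
  have upU: "U z \<le> U x0 + p \<bullet> (z - x0) + k * (norm (z - x0))\<^sup>2" for z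
    using p'[of z] max[of z] by (simp add: p'_eq)
  have upV: "V z \<le> V x0 + p' \<bullet> (z - x0) + k * (norm (z - x0))\<^sup>2" for z
    using p[of z] max[of z] by (simp add: p'_eq)
  have "p = 0"
  proof (rule ccontr)
    assume "p \<noteq> 0"
    define e where "e = sgn p"
    have e: "norm e = 1" using \<open>p \<noteq> 0\<close> by (simp add: e_def norm_sgn)
    define d where "d = real DIM('a)"
    have "d \<ge> 0" by (simp add: d_def)
    \<comment> \<open>A lower bound for \<kappa> |q|^2 as long as |q| \<ge> |p| / 2.\<close>
    define c where "c = \<kappa> * (norm p)\<^sup>2 / 4"
    have c: "c > 0" using \<open>\<kappa> > 0\<close> \<open>p \<noteq> 0\<close> by (simp add: c_def)
    \<comment> \<open>Chosen so that the freezing error 2 k \<rho> d is at most c/4. The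
      inequalities then read at least c/2 for U and at least - c/4 for V, the gap required with
      constant c/2.\<close>
    define \<rho> where "\<rho> = c / (8 * (k * d + 1))"
    have kd: "k * d \<ge> 0" using \<open>k \<ge> 0\<close> \<open>d \<ge> 0\<close> by simp
    have \<rho>: "\<rho> > 0" using c kd by (simp add: \<rho>_def)
    have "2 * k * \<rho> * d = (c / 4) * (k * d / (k * d + 1))"
    proof -
      have "2 * k * (c / (8 * X)) * d = (c / 4) * (k * d / X)" for X :: real
        by (cases "X = 0") (auto simp: field_simps)
      then show ?thesis unfolding \<rho>_def .
    qed
    also have "\<dots> \<le> (c / 4) * 1" using c kd by (intro mult_left_mono) (auto simp: divide_le_eq)
    finally have small: "2 * k * \<rho> * d \<le> c / 4" by simp
    \<comment> \<open>Admissible deviation of the slopes: the first bound keeps them away from 0,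
      the second keeps their directions within the tolerance \<rho>. The summand 4 avoids division
      by zero when b = 0.\<close>
    define s where "s = min (norm p / 2) (\<rho> * norm p / (4 * \<bar>b\<bar> + 4))"
    have s: "s > 0" using \<rho> \<open>p \<noteq> 0\<close> by (simp add: s_def)
    define r where "r = min e0 (s / (6 * k + 1))"
    have r: "r > 0" using s \<open>e0 > 0\<close> \<open>k \<ge> 0\<close> by (simp add: r_def)
    have close: "norm q \<ge> norm p / 2 \<and> 2 * \<bar>b\<bar> * norm (sgn q - sgn q0) \<le> \<rho>"
      if q: "norm (q - q0) \<le> 6 * k * norm x" "norm q0 = norm p" and x: "norm x < r" for q q0 x :: 'a
    proof -
      have "norm x \<le> s / (6 * k + 1)" using x by (simp add: r_def)
      then have "norm x * (6 * k + 1) \<le> s" using \<open>k \<ge> 0\<close> by (simp add: pos_le_divide_eq)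
      moreover have "6 * k * norm x \<le> norm x * (6 * k + 1)" by (simp add: algebra_simps)
      ultimately have qs: "norm (q - q0) \<le> s" using q(1) by linarith
      have "s \<le> norm p / 2" unfolding s_def by (rule min.cobounded1)
      then have 1: "norm q \<ge> norm p / 2" using qs q(2) norm_triangle_sub[of q0 q] by (simp add: norm_minus_commute)
      have "q0 \<noteq> 0" using q(2) \<open>p \<noteq> 0\<close> by auto
      have "2 * \<bar>b\<bar> * norm (sgn q - sgn q0) \<le> 2 * \<bar>b\<bar> * (2 * norm (q - q0) / norm q0)"
        by (intro mult_left_mono norm_sgn_diff_le \<open>q0 \<noteq> 0\<close>) auto
      also have "\<dots> \<le> 2 * \<bar>b\<bar> * (2 * s / norm p)"
        unfolding q(2) using qs by (intro mult_left_mono divide_right_mono) auto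
      also have "\<dots> = (4 * \<bar>b\<bar>) * (s / norm p)" by simp
      also have "\<dots> \<le> (4 * \<bar>b\<bar> + 4) * (s / norm p)" using s by (intro mult_right_mono) auto
      also have "\<dots> \<le> \<rho>"
      proof -
        have "s \<le> \<rho> * norm p / (4 * \<bar>b\<bar> + 4)" unfolding s_def by (rule min.cobounded2)
        then show ?thesis using \<open>p \<noteq> 0\<close> by (simp add: field_simps)
      qed
      finally show ?thesis using 1 by blast
    qed
    have ab': "a + \<rho> > 0" "a + \<rho> + b > 0" using assms \<rho> by auto
    show False
    proof (rule linear_comparison[OF ab' e r])
      show "c / 2 > 0" using c by simp
      show "continuous_on UNIV (\<lambda>x. U (x + x0))" "continuous_on UNIV (\<lambda>x. V (x + x0))"
        using sc by (auto intro: continuous_semiconvex semiconvex_shift)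
      show "U (x + x0) + V (x + x0) \<le> U (0 + x0) + V (0 + x0)" for x using max by simp
    next
      fix x q H assume x: "norm x < r" and "superjet UNIV (\<lambda>x. U (x + x0)) x q H"
      then have jet: "superjet UNIV U (x + x0) q H" by (simp add: superjet_shift)
      obtain q' where q': "\<And>z. U z \<ge> U (x + x0) + q' \<bullet> (z - (x + x0)) - k * (norm (z - (x + x0)))\<^sup>2"
        using semiconvexE[OF sc(1)] by blast
      note sj = superjet_semiconvex[OF q' jet]
      have "norm (q - p) \<le> 6 * k * norm x"
        using subgradient_near[OF \<open>k \<ge> 0\<close> p upU q'] sj(1) by simp
      from close[OF this refl x] have cl: "norm q \<ge> norm p / 2" "2 * \<bar>b\<bar> * norm (sgn q - e) \<le> \<rho>"
        by (auto simp: e_def)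
      have "q \<noteq> 0" using cl(1) \<open>p \<noteq> 0\<close> by auto
      have "norm p / 2 * (norm p / 2) \<le> norm q * norm q" using cl(1) by (intro mult_mono) auto
      then have "c \<le> \<kappa> * (norm q)\<^sup>2" using \<open>\<kappa> > 0\<close> by (simp add: c_def power2_eq_square)
      also have "\<dots> \<le> nlap a b q H" using x by (intro jU[OF _ jet \<open>q \<noteq> 0\<close>]) (auto simp: r_def)
      also have "\<dots> \<le> lform (a + \<rho>) b e H + 2 * k * \<rho> * real DIM('a)"
        by (rule nlap_le_lform[OF superjet_linear[OF jet] sj(2) \<open>q \<noteq> 0\<close> e cl(2)])
      finally show "c / 2 \<le> lform (a + \<rho>) b e H" using small c unfolding d_def by linarith
    next
      fix x q H assume x: "norm x < r" and "superjet UNIV (\<lambda>x. V (x + x0)) x q H"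
      then have jet: "superjet UNIV V (x + x0) q H" by (simp add: superjet_shift)
      obtain q' where q': "\<And>z. V z \<ge> V (x + x0) + q' \<bullet> (z - (x + x0)) - k * (norm (z - (x + x0)))\<^sup>2"
        using semiconvexE[OF sc(2)] by blast
      note sj = superjet_semiconvex[OF q' jet]
      have "norm (q - p') \<le> 6 * k * norm x"
        using subgradient_near[OF \<open>k \<ge> 0\<close> p' upV q'] sj(1) by simp
      from close[OF this _ x] have cl: "norm q \<ge> norm p / 2" "2 * \<bar>b\<bar> * norm (sgn q - (- e)) \<le> \<rho>"
        by (auto simp: e_def p'_eq sgn_minus)
      have "q \<noteq> 0" using cl(1) \<open>p \<noteq> 0\<close> by auto
      have "norm (- e) = 1" using e by simp
      have "0 \<le> nlap a b q H" using x by (intro jV[OF _ jet \<open>q \<noteq> 0\<close>]) (auto simp: r_def)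
      also have "\<dots> \<le> lform (a + \<rho>) b (- e) H + 2 * k * \<rho> * real DIM('a)"
        by (rule nlap_le_lform[OF superjet_linear[OF jet] sj(2) \<open>q \<noteq> 0\<close> \<open>norm (- e) = 1\<close> cl(2)])
      also have "lform (a + \<rho>) b (- e) H = lform (a + \<rho>) b e H"
        by (rule lform_minus[OF superjet_linear[OF jet]])
      finally show "- (c / 2) / 2 \<le> lform (a + \<rho>) b e H" using small unfolding d_def by linarith
    qed
  qed
  then show ?thesis using p[of z] by simp
qed

text \<open>Hopf's argument at the first contact point of a ball growing around \<open>y\<close>
  with the set U = m. It survives the singularity because the barrier used for the contradiction has
  nonzero gradient. The radius s/4 keeps every ball involved inside the region of the
  hypotheses.\<close>

lemma strong_maximum_principle:
  fixes U :: "'a::euclidean_space \<Rightarrow> real"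
  assumes "a + b > 0" and cont: "continuous_on UNIV U"
    and le: "\<And>x. norm (x - x0) < s \<Longrightarrow> U x \<le> U x0"
    and jets: "\<And>x q H. norm (x - x0) < s \<Longrightarrow> superjet UNIV U x q H \<Longrightarrow> q \<noteq> 0 \<Longrightarrow> nlap a b q H \<ge> 0"
    and y: "norm (y - x0) < s / 4"
  shows "U y = U x0"
proof (rule ccontr)
  assume ne: "U y \<noteq> U x0"
  define m where "m = U x0"
  define Z where "Z = {z \<in> cball y (norm (y - x0)). U z = m}"
  have "closed {z. U z = m}" using cont by (intro closed_Collect_eq) auto
  then have "compact (cball y (norm (y - x0)) \<inter> {z. U z = m})" by (intro compact_Int_closed compact_cball)
  moreover have "cball y (norm (y - x0)) \<inter> {z. U z = m} = Z" by (auto simp: Z_def)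
  ultimately have "compact Z" by simp
  moreover have "x0 \<in> Z" by (simp add: Z_def m_def dist_norm)
  ultimately obtain x1 where x1: "x1 \<in> Z" "\<And>z. z \<in> Z \<Longrightarrow> dist y x1 \<le> dist y z"
    using distance_attains_inf[of Z y] compact_imp_closed by blast
  define R where "R = dist y x1"
  have R: "R > 0" "R \<le> norm (y - x0)" "U x1 = m"
    using x1(1) ne by (auto simp: R_def Z_def m_def)
  have less: "U z < m" if "dist y z < R" for z
  proof -
    have "z \<notin> Z" using x1(2)[of z] that by (auto simp: R_def)
    then have "U z \<noteq> m" using that R by (auto simp: Z_def)
    moreover have "norm (z - x0) \<le> norm (y - x0) + dist y z"
      using norm_triangle_ineq[of "z - y" "y - x0"] by (simp add: dist_norm norm_minus_commute)
    then have "U z \<le> m" unfolding m_def using that R y by (intro le) linarith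
    ultimately show ?thesis by simp
  qed
  \<comment> \<open>Halving the ball leaves \<open>x1\<close> as the only point of the closed ball
    around \<open>w\<close> at which U can reach m.\<close>
  define w where "w = midpoint y x1"
  define r where "r = R / 2"
  have r: "r > 0" "dist y w = r" "dist w x1 = r"
    using R by (auto simp: w_def r_def R_def dist_midpoint)
  \<comment> \<open>A point of the small ball on or beyond the large sphere gives equality in the
    triangle inequality, hence is the reflection of y in w, which is x1.\<close>
  have in_ball: "U z < m" if "dist w z \<le> r" "z \<noteq> x1" for z
  proof (rule less, rule ccontr)
    assume "\<not> dist y z < R"
    moreover have "dist y z \<le> dist y w + dist w z" by (rule dist_triangle)
    ultimately have eq: "dist y z = dist y w + dist w z" "dist w z = r" using r that by (auto simp: r_def)
    have between: "w \<in> closed_segment y z" using eq(1) by (simp add: between between_mem_segment[symmetric])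
    then have "w = midpoint y z"
    proof -
      obtain t where t: "w = (1 - t) *\<^sub>R y + t *\<^sub>R z" "0 \<le> t" "t \<le> 1"
        using between unfolding closed_segment_def by blast
      have "w - y = t *\<^sub>R (z - y)" by (simp add: t(1) algebra_simps)
      then have "dist y w = t * dist y z" using t by (metis abs_of_nonneg dist_norm norm_minus_commute norm_scaleR)
      then have "t = 1 / 2" using eq r by simp
      then show ?thesis unfolding midpoint_def t(1) \<open>t = 1 / 2\<close> by (simp add: scaleR_add_right)
    qed
    then have "z = x1" unfolding w_def by (metis add_diff_cancel_left' midpoint_eq_iff)
    then show False using that by simp
  qed
  \<comment> \<open>r/2 bounds from below the distance to \<open>w\<close> on the ball around
    \<open>x1\<close> where the barrier is used.\<close>
  define \<mu> where "\<mu> = \<bar>a * real DIM('a) + b\<bar> / (2 * (a + b) * (r / 2)\<^sup>2) + 1"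
  have \<mu>: "\<mu> > \<bar>a * real DIM('a) + b\<bar> / (2 * (a + b) * (r / 2)\<^sup>2)" "\<mu> > 0"
    using assms(1) r by (auto simp: \<mu>_def add_nonneg_pos)
  define S where "S = sphere x1 (r / 2) \<inter> cball w r"
  have "\<exists>\<eta>>0. \<forall>z\<in>S. U z \<le> m - \<eta>"
  proof (cases "S = {}")
    case True then show ?thesis by (intro exI[of _ 1]) auto
  next
    case False
    have "compact S" by (simp add: S_def compact_Int)
    then obtain z where z: "z \<in> S" "\<And>z'. z' \<in> S \<Longrightarrow> U z' \<le> U z"
      using continuous_attains_sup[of S U] False cont continuous_on_subset by blast
    have "z \<noteq> x1" using z(1) r by (auto simp: S_def)
    then have "U z < m" using z(1) by (intro in_ball) (auto simp: S_def)
    then show ?thesis using z(2) by (intro exI[of _ "m - U z"]) auto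
  qed
  then obtain \<eta> where \<eta>: "\<eta> > 0" "\<And>z. z \<in> S \<Longrightarrow> U z \<le> m - \<eta>" by blast
  \<comment> \<open>The barrier difference is never below - 1, so with \<tau> < \<eta> the dip of
    \<open>h\<close> cannot compensate the drop of U on \<open>S\<close>.\<close>
  define \<tau> where "\<tau> = \<eta> / 2"
  have \<tau>: "\<tau> > 0" "\<tau> < \<eta>" using \<eta> by (auto simp: \<tau>_def)
  define h where "h = (\<lambda>z. \<tau> * (barrier w \<mu> z - barrier w \<mu> x1))"
  have h_cont: "continuous_on A h" for A unfolding h_def by (intro continuous_intros continuous_barrier)
  have "continuous_on (cball x1 (r / 2)) (\<lambda>z. U z - h z)"
    using cont by (intro continuous_on_diff h_cont) (auto intro: continuous_on_subset)
  then obtain z where z: "z \<in> cball x1 (r / 2)" "\<And>z'. z' \<in> cball x1 (r / 2) \<Longrightarrow> U z' - h z' \<le> U z - h z"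
    using continuous_attains_sup[of "cball x1 (r / 2)" "\<lambda>z. U z - h z"] r by auto
  have zw: "norm (z - w) \<ge> r / 2"
    using z(1) r(3) dist_triangle[of w x1 z] by (simp add: dist_norm norm_minus_commute)
  have near: "norm (z' - x0) < s" if "z' \<in> cball x1 (r / 2)" for z'
  proof -
    have "norm (z' - x0) \<le> dist x1 z' + dist y x1 + norm (y - x0)"
      using dist_triangle[of z' x0 x1] dist_triangle[of x1 x0 y] by (simp add: dist_norm norm_minus_commute)
    then show ?thesis using that R y r by (simp add: r_def R_def[symmetric])
  qed
  have "U z - h z \<ge> m" using z(2)[of x1] r R(3) by (simp add: h_def)
  have "dist x1 z \<noteq> r / 2"
  proof
    assume zs: "dist x1 z = r / 2"
    \<comment> \<open>Within the ball around \<open>w\<close> the drop \<eta> of U decides; outside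
      it \<open>h\<close> is positive while U \<le> m.\<close>
    show False
    proof (cases "dist w z \<le> r")
      case True
      then have "U z \<le> m - \<eta>" using zs by (intro \<eta>) (auto simp: S_def)
      moreover have "h z \<ge> - \<tau>"
      proof -
        have "barrier w \<mu> z \<ge> -1" using \<mu> by (simp add: barrier_range(1))
        then have "barrier w \<mu> z - barrier w \<mu> x1 \<ge> -1" using barrier_range(2)[of w \<mu> x1] by linarith
        then have "\<tau> * (barrier w \<mu> z - barrier w \<mu> x1) \<ge> \<tau> * (-1)" using \<tau> by (intro mult_left_mono) auto
        then show ?thesis by (simp add: h_def)
      qed
      ultimately show False using \<open>U z - h z \<ge> m\<close> \<tau> by linarith
    next
      case False
      then have "\<not> norm (z - w) \<le> norm (x1 - w)" using r(3) by (simp add: dist_norm norm_minus_commute)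
      then have "barrier w \<mu> z > barrier w \<mu> x1" using barrier_le_iff[OF \<mu>(2)] by (meson not_le)
      then have "h z > 0" using \<tau> by (simp add: h_def)
      moreover have "U z \<le> m" unfolding m_def by (intro le near z)
      ultimately show False using \<open>U z - h z \<ge> m\<close> by linarith
    qed
  qed
  then have pos: "r / 2 - dist x1 z > 0" using z(1) by simp
  obtain q H where "superjet UNIV U z q H" "q \<noteq> 0" "nlap a b q H < 0"
  proof (rule superjet_barrier[OF assms(1) _ zw \<tau>(1) \<mu>(1) pos, of UNIV U])
    show "r / 2 > 0" using r by simp
    fix z' assume "norm (z' - z) < r / 2 - dist x1 z"
    then have "z' \<in> cball x1 (r / 2)"
      using dist_triangle[of x1 z' z] by (simp add: dist_norm norm_minus_commute)
    then show "U z' - U z \<le> \<tau> * (barrier w \<mu> z' - barrier w \<mu> z)"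
      using z(2)[of z'] by (simp add: h_def algebra_simps)
  qed
  then show False using jets[OF near[OF z(1)]] by fastforce
qed

text \<open>The jet inequalities are required only where some shifted sum reaches the level
  \<open>c\<close>, since sup-convolutions inherit the equation only there.\<close>

lemma no_excess:
  fixes U W :: "'a::euclidean_space \<Rightarrow> real"
  assumes k: "k \<ge> 0" and ab: "a \<ge> 0" "a + b > 0" and "\<kappa> > 0"
    and sc: "semiconvex k U" "semiconvex k W" and "r0 > 0"
    and jU: "\<And>h x q H. norm h < r0 \<Longrightarrow> U (x + h) + W x \<ge> c \<Longrightarrow> superjet UNIV U (x + h) q H \<Longrightarrow> q \<noteq> 0 \<Longrightarrow>
      nlap a b q H \<ge> \<kappa> * (norm q)\<^sup>2"
    and jW: "\<And>h x q H. norm h < r0 \<Longrightarrow> U (x + h) + W x \<ge> c \<Longrightarrow> superjet UNIV W x q H \<Longrightarrow> q \<noteq> 0 \<Longrightarrow>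
      nlap a b q H \<ge> 0"
    and bdd: "\<And>h x. norm h < r0 \<Longrightarrow> U (x + h) + W x \<ge> c \<Longrightarrow> norm x \<le> B"
  shows "U x + W x \<le> c"
proof (rule ccontr)
  assume "\<not> U x + W x \<le> c"
  then have x: "U x + W x > c" by simp
  have contU: "continuous_on S U" and contW: "continuous_on S W" for S
    using sc continuous_semiconvex by blast+
  have contG: "continuous_on S (\<lambda>x. U (x + h) + W x)" for S h
    by (intro continuous_on_add continuous_on_compose2[OF contU[of UNIV]] contW continuous_intros) auto
  have op: "open {h. U (x + h) + W x > c}"
    by (intro open_Collect_less continuous_intros continuous_on_compose2[OF contU[of UNIV]]) auto
  have "0 \<in> {h. U (x + h) + W x > c}" using x by simp
  then obtain r1 where r1: "r1 > 0" "ball 0 r1 \<subseteq> {h. U (x + h) + W x > c}"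
    by (rule openE[OF op])
  define r where "r = min r0 r1"
  have r: "r > 0" "r \<le> r0" using r1 \<open>r0 > 0\<close> by (auto simp: r_def)
  have "\<exists>z. U (z + h) + W z > c \<and> (\<forall>y. U (y + h) + W y \<le> U (z + h) + W z)" if h: "norm h < r" for h
  proof -
    let ?A = "{y. U (y + h) + W y \<ge> c}"
    have "h \<in> ball 0 r1" using h by (simp add: r_def)
    then have xh: "U (x + h) + W x > c" using r1 by blast
    have "closed ?A" by (intro closed_Collect_le contG continuous_on_const)
    moreover have "bounded ?A" using bdd[of h] h r by (intro boundedI[of _ B]) auto
    ultimately have "compact ?A" by (simp add: compact_eq_bounded_closed)
    moreover have "x \<in> ?A" using xh by simp
    then have "?A \<noteq> {}" by blast
    ultimately have "\<exists>z\<in>?A. \<forall>y\<in>?A. U (y + h) + W y \<le> U (z + h) + W z"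
      by (intro continuous_attains_sup contG)
    then obtain z where z: "z \<in> ?A" "\<And>y. y \<in> ?A \<Longrightarrow> U (y + h) + W y \<le> U (z + h) + W z"
      by blast
    have "U (x + h) + W x \<le> U (z + h) + W z" using z(2)[of x] xh by simp
    moreover have "U (y + h) + W y \<le> U (z + h) + W z" for y
      using z(1) z(2)[of y] by (cases "y \<in> ?A") auto
    ultimately show ?thesis using xh by (intro exI[of _ z] conjI allI) (linarith, blast)
  qed
  then obtain X where X: "\<And>h. norm h < r \<Longrightarrow> U (X h + h) + W (X h) > c"
    "\<And>h y. norm h < r \<Longrightarrow> U (y + h) + W y \<le> U (X h + h) + W (X h)" by metis
  have nbhd: "\<exists>e>0. \<forall>y. norm (y - z) < e \<longrightarrow> U (y + h) + W y \<ge> c" if "U (z + h) + W z > c" for z h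
  proof -
    have op: "open {y. U (y + h) + W y > c}" by (intro open_Collect_less contG continuous_on_const)
    have "z \<in> {y. U (y + h) + W y > c}" using that by simp
    then obtain e where e: "e > 0" "ball z e \<subseteq> {y. U (y + h) + W y > c}" by (rule openE[OF op])
    have "U (y + h) + W y \<ge> c" if "norm (y - z) < e" for y
    proof -
      have "y \<in> ball z e" using that by (simp add: dist_norm norm_minus_commute)
      with e(2) have "U (y + h) + W y > c" by blast
      then show ?thesis by simp
    qed
    with e(1) show ?thesis by blast
  qed
  define M where "M = (\<lambda>h. U (X h + h) + W (X h))"
  \<comment> \<open>Keeping the maximiser \<open>X h\<close> and changing only the shift affects U
    alone, whose supporting paraboloid there has zero slope. The value at X h + h' - h is the one
    that lands on X h + h'.\<close>
  have M_le: "M h' \<ge> M h - k * (norm (h' - h))\<^sup>2" if h: "norm h < r" "norm h' < r" for h h'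
  proof -
    obtain e where e: "e > 0" "\<And>y. norm (y - X h) < e \<Longrightarrow> U (y + h) + W y \<ge> c"
      using nbhd[OF X(1)[OF h(1)]] by blast
    have hr0: "norm h < r0" using h r by simp
    have "U (z + h) \<ge> U (X h + h) - k * (norm (z - X h))\<^sup>2" for z
    proof (rule zero_gradient_at_max[OF k ab \<open>\<kappa> > 0\<close> semiconvex_shift[OF sc(1)] sc(2) e(1)])
      fix y q H assume "norm (y - X h) < e" "superjet UNIV (\<lambda>x. U (x + h)) y q H" "q \<noteq> 0"
      then show "nlap a b q H \<ge> \<kappa> * (norm q)\<^sup>2"
        by (intro jU[OF hr0 e(2)]) (simp_all add: superjet_shift)
    next
      fix y q H assume "norm (y - X h) < e" "superjet UNIV W y q H" "q \<noteq> 0"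
      then show "nlap a b q H \<ge> 0" by (intro jW[OF hr0 e(2)])
    next
      show "U (y + h) + W y \<le> U (X h + h) + W (X h)" for y by (rule X(2)[OF h(1)])
    qed
    from this[of "X h + h' - h"] have "U (X h + h') \<ge> U (X h + h) - k * (norm (h' - h))\<^sup>2"
      by (simp add: algebra_simps)
    with X(2)[OF h(2), of "X h"] show ?thesis by (simp add: M_def)
  qed
  \<comment> \<open>Exchanging h and h' makes the quadratic bound two-sided, so the derivative of
    \<open>M\<close> vanishes.\<close>
  have "\<exists>C. \<forall>h\<in>ball 0 r. M h = C"
  proof (rule has_derivative_zero_constant)
    fix h :: 'a assume h: "h \<in> ball 0 r"
    show "(M has_derivative (\<lambda>h. 0)) (at h within ball 0 r)"
      unfolding has_derivative_within_alt
    proof (intro conjI allI impI)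
      fix e :: real assume "e > 0"
      show "\<exists>d>0. \<forall>h'\<in>ball 0 r. norm (h' - h) < d \<longrightarrow> norm (M h' - M h - 0) \<le> e * norm (h' - h)"
      proof (intro exI[of _ "e / (k + 1)"] conjI ballI impI)
        show "e / (k + 1) > 0" using \<open>e > 0\<close> k by simp
        fix h' assume h': "h' \<in> ball 0 r" "norm (h' - h) < e / (k + 1)"
        have "\<bar>M h' - M h\<bar> \<le> k * norm (h' - h) * norm (h' - h)"
          using M_le[of h h'] M_le[of h' h] h h' by (simp add: power2_eq_square norm_minus_commute abs_le_iff)
        also have "\<dots> \<le> e * norm (h' - h)"
        proof (rule mult_right_mono)
          have "norm (h' - h) * (k + 1) \<le> e" using h' k by (simp add: pos_less_divide_eq less_imp_le)
          then show "k * norm (h' - h) \<le> e" by (simp add: algebra_simps) (smt (verit) norm_ge_zero)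
        qed simp
        finally show "norm (M h' - M h - 0) \<le> e * norm (h' - h)" by simp
      qed
    qed simp
  qed simp
  then obtain C where C: "\<And>h. norm h < r \<Longrightarrow> M h = C" by auto
  define E where "E = {z. U z + W z = C}"
  \<comment> \<open>At a point of \<open>E\<close>, moving the argument of U alone or of W alone by
    less than r cannot raise the sum above \<open>C\<close>, so each function has a local maximum
    there separately.\<close>
  have upper: "U (y + h) + W y \<le> C" if "norm h < r" for y h
    using X(2)[OF that] C[OF that] by (simp add: M_def)
  have C0: "U (X 0) + W (X 0) = C" using C[of 0] r by (simp add: M_def)
  have "C > c" using X(1)[of 0] r C0 by simp
  have "open E"
    unfolding open_contains_ball
  proof
    fix z assume "z \<in> E"
    then have z: "U z + W z = C" by (simp add: E_def)
    obtain e where e: "e > 0" "\<And>y. norm (y - z) < e \<Longrightarrow> U (y + 0) + W y \<ge> c"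
      using nbhd[of z 0] z \<open>C > c\<close> by auto
    define s where "s = min e r"
    have s: "s > 0" using e r by (simp add: s_def)
    have "U y = U z \<and> W y = W z" if y: "norm (y - z) < s / 4" for y
    proof
      show "U y = U z"
      proof (rule strong_maximum_principle[OF ab(2) contU _ _ y])
        fix y assume y: "norm (y - z) < s"
        then show "U y \<le> U z" using upper[of "y - z" z] z by (simp add: s_def)
        fix q H assume jet: "superjet UNIV U y q H" "q \<noteq> 0"
        have "\<kappa> * (norm q)\<^sup>2 \<le> nlap a b q H"
          using jU[of 0 y q H] e(2)[of y] y jet \<open>r0 > 0\<close> by (simp add: s_def)
        moreover have "\<kappa> * (norm q)\<^sup>2 \<ge> 0" using \<open>\<kappa> > 0\<close> by simp
        ultimately show "nlap a b q H \<ge> 0" by linarith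
      qed
      show "W y = W z"
      proof (rule strong_maximum_principle[OF ab(2) contW _ _ y])
        fix y assume y: "norm (y - z) < s"
        then show "W y \<le> W z" using upper[of "z - y" y] z by (simp add: s_def norm_minus_commute)
        fix q H assume jet: "superjet UNIV W y q H" "q \<noteq> 0"
        show "nlap a b q H \<ge> 0"
          using jW[of 0 y q H] e(2)[of y] y jet \<open>r0 > 0\<close> by (simp add: s_def)
      qed
    qed
    then have "ball z (s / 4) \<subseteq> E" using z by (auto simp: E_def dist_norm norm_minus_commute)
    then show "\<exists>e>0. ball z e \<subseteq> E" using s by (intro exI[of _ "s / 4"]) auto
  qed
  moreover have "closed E"
    unfolding E_def by (intro closed_Collect_eq continuous_on_add contU contW continuous_on_const)
  moreover have "X 0 \<in> E" using C0 by (simp add: E_def)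
  ultimately have "E = UNIV" using clopen by blast
  moreover have "bounded E"
    using bdd[of 0] \<open>r0 > 0\<close> \<open>C > c\<close> by (intro boundedI[of _ B]) (auto simp: E_def)
  ultimately show False using not_bounded_UNIV by auto
qed

section \<open>Sup-convolutions\<close>

definition supconv :: "real \<Rightarrow> 'a::euclidean_space set \<Rightarrow> ('a \<Rightarrow> real) \<Rightarrow> 'a \<Rightarrow> real" where
  "supconv k K u x = (SUP y\<in>K. u y - k * (norm (x - y))\<^sup>2)"

lemma supconv_attained:
  fixes u :: "'a::euclidean_space \<Rightarrow> real"
  assumes "compact K" "K \<noteq> {}" "usc_on K u"
  obtains y where "y \<in> K" "supconv k K u x = u y - k * (norm (x - y))\<^sup>2"
    "\<And>z y'. y' \<in> K \<Longrightarrow> u y' - k * (norm (z - y'))\<^sup>2 \<le> supconv k K u z"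
proof -
  have max: "\<exists>y\<in>K. \<forall>y'\<in>K. u y' - k * (norm (x - y'))\<^sup>2 \<le> u y - k * (norm (x - y))\<^sup>2" for x
  proof -
    have "usc_on K (\<lambda>y. u y + (- k * (norm (x - y))\<^sup>2))"
      by (intro usc_on_add assms continuous_imp_usc_on continuous_intros)
    from usc_on_attains_sup[OF this assms(1,2)] show ?thesis by simp
  qed
  have le: "u y' - k * (norm (z - y'))\<^sup>2 \<le> supconv k K u z" if "y' \<in> K" for z y'
  proof -
    have "bdd_above ((\<lambda>y. u y - k * (norm (z - y))\<^sup>2) ` K)" using max[of z] by (auto simp: bdd_above_def)
    then show ?thesis unfolding supconv_def using that by (intro cSUP_upper)
  qed
  obtain y where y: "y \<in> K" "\<And>y'. y' \<in> K \<Longrightarrow> u y' - k * (norm (x - y'))\<^sup>2 \<le> u y - k * (norm (x - y))\<^sup>2"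
    using max by blast
  have "supconv k K u x \<le> u y - k * (norm (x - y))\<^sup>2"
    unfolding supconv_def using y assms(2) by (intro cSUP_least)
  with le[OF y(1), of x] y(1) show thesis by (intro that[OF _ _ le]) auto
qed

text \<open>The paraboloid belonging to a maximising \<open>y\<close> touches the supremum from
  below at \<open>x\<close>; its slope there is 2 k (y - x).\<close>

lemma semiconvex_supconv:
  fixes u :: "'a::euclidean_space \<Rightarrow> real"
  assumes "compact K" "K \<noteq> {}" "usc_on K u"
  shows "semiconvex k (supconv k K u)"
  unfolding semiconvex_def
proof
  fix x
  obtain y where y: "y \<in> K" "supconv k K u x = u y - k * (norm (x - y))\<^sup>2"
    "\<And>z y'. y' \<in> K \<Longrightarrow> u y' - k * (norm (z - y'))\<^sup>2 \<le> supconv k K u z"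
    using supconv_attained[OF assms] by metis
  have "supconv k K u z \<ge> supconv k K u x + ((2 * k) *\<^sub>R (y - x)) \<bullet> (z - x) - k * (norm (z - x))\<^sup>2" for z
  proof -
    have "k * (norm (x - y))\<^sup>2 - k * (norm (z - y))\<^sup>2
        = ((2 * k) *\<^sub>R (y - x)) \<bullet> (z - x) - k * (norm (z - x))\<^sup>2"
      unfolding power2_norm_eq_inner
      by (simp add: inner_diff_left inner_diff_right inner_commute algebra_simps)
    with y(3)[OF y(1), of z] y(2) show ?thesis by linarith
  qed
  then show "\<exists>p. \<forall>z. supconv k K u z \<ge> supconv k K u x + p \<bullet> (z - x) - k * (norm (z - x))\<^sup>2" by blast
qed

text \<open>Translating x and y by the same vector leaves the penalty \<open>C\<close> unchanged, so
  a jet of the regularised function at x is a jet of the original one at y.\<close>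

lemma superjet_supconv:
  assumes jet: "superjet UNIV U x q H" and y: "U x = u y - C"
    and le: "\<And>z. y + z \<in> K \<Longrightarrow> u (y + z) - C \<le> U (x + z)"
  shows "superjet K u y q H"
proof (rule superjetI)
  show "linear H" by (rule superjet_linear[OF jet])
  fix \<eta> :: real assume "\<eta> > 0"
  then obtain d where d: "d > 0" "\<And>z. norm (z - x) < d \<Longrightarrow>
      U z \<le> U x + q \<bullet> (z - x) + H (z - x) \<bullet> (z - x) / 2 + \<eta> * (norm (z - x))\<^sup>2"
    using superjetD[OF jet] by (metis UNIV_I)
  have "u z \<le> u y + q \<bullet> (z - y) + H (z - y) \<bullet> (z - y) / 2 + \<eta> * (norm (z - y))\<^sup>2"
    if "z \<in> K" "norm (z - y) < d" for z
    using le[of "z - y"] d(2)[of "x + (z - y)"] y that by simp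
  with d(1) show "\<exists>d>0. \<forall>z\<in>K. norm (z - y) < d \<longrightarrow>
      u z \<le> u y + q \<bullet> (z - y) + H (z - y) \<bullet> (z - y) / 2 + \<eta> * (norm (z - y))\<^sup>2" by blast
qed

lemma supconv_jets:
  fixes u :: "'a::euclidean_space \<Rightarrow> real"
  assumes K: "compact K" "K \<noteq> {}" "usc_on K u" and jet: "superjet UNIV (supconv k K u) x q H"
  obtains y where "y \<in> K" "supconv k K u x = u y - k * (norm (x - y))\<^sup>2" "superjet K u y q H"
proof -
  obtain y where y: "y \<in> K" "supconv k K u x = u y - k * (norm (x - y))\<^sup>2"
    "\<And>z y'. y' \<in> K \<Longrightarrow> u y' - k * (norm (z - y'))\<^sup>2 \<le> supconv k K u z"
    using supconv_attained[OF K] by metis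
  have "superjet K u y q H"
  proof (rule superjet_supconv[where U = "supconv k K u" and C = "k * (norm (x - y))\<^sup>2" and u = u and y = y and x = x, OF jet y(2)])
    fix z assume "y + z \<in> K"
    from y(3)[OF this, of "x + z"] show "u (y + z) - k * (norm (x - y))\<^sup>2 \<le> supconv k K u (x + z)" by simp
  qed
  with y show thesis by (intro that)
qed

section \<open>Comparison\<close>

text \<open>Otherwise violating pairs with distance tending to 0 accumulate at a diagonal point
  outside \<Omega>, where upper semicontinuity contradicts the strict inequality. This sends the
  maximisers of the two sup-convolutions into the interior.\<close>

lemma usc_sum_near_diagonal:
  fixes u w :: "'a::euclidean_space \<Rightarrow> real"
  assumes K: "compact K" "open \<Omega>" and usc: "usc_on K u" "usc_on K w"
    and bd: "\<And>x. x \<in> K \<Longrightarrow> x \<notin> \<Omega> \<Longrightarrow> u x + w x < c"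
  obtains \<delta> where "\<delta> > 0"
    "\<And>y z. y \<in> K \<Longrightarrow> z \<in> K \<Longrightarrow> norm (y - z) < \<delta> \<Longrightarrow> u y + w z \<ge> c \<Longrightarrow> y \<in> \<Omega> \<and> z \<in> \<Omega>"
proof -
  have "\<exists>\<delta>>0. \<forall>y\<in>K. \<forall>z\<in>K. norm (y - z) < \<delta> \<longrightarrow> u y + w z \<ge> c \<longrightarrow> y \<in> \<Omega> \<and> z \<in> \<Omega>"
  proof (rule ccontr)
    assume "\<not> ?thesis"
    then have "\<exists>y z. y \<in> K \<and> z \<in> K \<and> norm (y - z) < inverse (real (Suc n)) \<and> u y + w z \<ge> c \<and> \<not> (y \<in> \<Omega> \<and> z \<in> \<Omega>)" for n
      by (metis inverse_positive_iff_positive of_nat_0_less_iff zero_less_Suc)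
    then obtain y z where yz: "\<And>n. y n \<in> K" "\<And>n. z n \<in> K" "\<And>n. norm (y n - z n) < inverse (real (Suc n))"
      "\<And>n. u (y n) + w (z n) \<ge> c" "\<And>n. \<not> (y n \<in> \<Omega> \<and> z n \<in> \<Omega>)" by metis
    obtain l r where lr: "l \<in> K" "strict_mono r" "(y \<circ> r) \<longlonglongrightarrow> l"
      using K(1) yz(1) unfolding compact_def by blast
    have "(\<lambda>n. norm (y (r n) - z (r n))) \<longlonglongrightarrow> 0"
    proof (rule tendsto_sandwich[where f = "\<lambda>_. 0" and h = "\<lambda>n. inverse (real (Suc (r n)))"])
      show "(\<lambda>n. inverse (real (Suc (r n)))) \<longlonglongrightarrow> 0"
        using LIMSEQ_subseq_LIMSEQ[OF LIMSEQ_inverse_real_of_nat lr(2)] by (simp add: comp_def)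
      show "\<forall>\<^sub>F n in sequentially. norm (y (r n) - z (r n)) \<le> inverse (real (Suc (r n)))"
        by (intro always_eventually allI less_imp_le yz(3))
    qed (auto intro: tendsto_const)
    then have "(\<lambda>n. y (r n) - (y (r n) - z (r n))) \<longlonglongrightarrow> l - 0"
      using lr(3) by (intro tendsto_diff) (auto simp: comp_def tendsto_norm_zero_iff)
    then have zl: "(z \<circ> r) \<longlonglongrightarrow> l" by (simp add: comp_def)
    have "l \<notin> \<Omega>"
    proof
      assume "l \<in> \<Omega>"
      then have "\<forall>\<^sub>F n in sequentially. y (r n) \<in> \<Omega>" "\<forall>\<^sub>F n in sequentially. z (r n) \<in> \<Omega>"
        using topological_tendstoD[OF lr(3) K(2)] topological_tendstoD[OF zl K(2)] by (auto simp: comp_def)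
      then have "\<forall>\<^sub>F n in sequentially. False"
        by eventually_elim (use yz(5) in blast)
      then show False by simp
    qed
    then have "u l + w l < c" using bd lr(1) by blast
    define \<epsilon> where "\<epsilon> = (c - u l - w l) / 2"
    have "\<epsilon> > 0" using \<open>u l + w l < c\<close> by (simp add: \<epsilon>_def)
    then have "u l < u l + \<epsilon>" "w l < w l + \<epsilon>" by auto
    obtain d1 where d1: "d1 > 0" "\<And>y. y \<in> K \<Longrightarrow> dist y l < d1 \<Longrightarrow> u y < u l + \<epsilon>"
      using usc_onD[OF usc(1) lr(1) \<open>u l < u l + \<epsilon>\<close>] by metis
    obtain d2 where d2: "d2 > 0" "\<And>y. y \<in> K \<Longrightarrow> dist y l < d2 \<Longrightarrow> w y < w l + \<epsilon>"
      using usc_onD[OF usc(2) lr(1) \<open>w l < w l + \<epsilon>\<close>] by metis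
    have "\<forall>\<^sub>F n in sequentially. dist (y (r n)) l < d1" "\<forall>\<^sub>F n in sequentially. dist (z (r n)) l < d2"
      using tendstoD[OF lr(3) d1(1)] tendstoD[OF zl d2(1)] by (auto simp: comp_def)
    then have "\<forall>\<^sub>F n in sequentially. False"
    proof eventually_elim
      case (elim n)
      then have "u (y (r n)) + w (z (r n)) < c" using d1(2)[OF yz(1)] d2(2)[OF yz(2)] by (fastforce simp: \<epsilon>_def field_simps)
      with yz(4)[of "r n"] show False by simp
    qed
    then show False by simp
  qed
  then show thesis using that by blast
qed

lemma strict_comparison:
  fixes u w :: "'a::euclidean_space \<Rightarrow> real"
  assumes K: "compact K" "K \<noteq> {}" "open \<Omega>" and usc: "usc_on K u" "usc_on K w"
    and ab: "a \<ge> 0" "a + b > 0" and "\<kappa> > 0"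
    and ju: "\<And>x q H. x \<in> K \<Longrightarrow> x \<in> \<Omega> \<Longrightarrow> superjet K u x q H \<Longrightarrow> q \<noteq> 0 \<Longrightarrow> nlap a b q H \<ge> \<kappa> * (norm q)\<^sup>2"
    and jw: "\<And>x q H. x \<in> K \<Longrightarrow> x \<in> \<Omega> \<Longrightarrow> superjet K w x q H \<Longrightarrow> q \<noteq> 0 \<Longrightarrow> nlap a b q H \<ge> 0"
    and bd: "\<And>x. x \<in> K \<Longrightarrow> x \<notin> \<Omega> \<Longrightarrow> u x + w x < c" and x: "x \<in> K"
  shows "u x + w x \<le> c"
proof -
  obtain \<delta> where \<delta>: "\<delta> > 0"
    "\<And>y z. y \<in> K \<Longrightarrow> z \<in> K \<Longrightarrow> norm (y - z) < \<delta> \<Longrightarrow> u y + w z \<ge> c \<Longrightarrow> y \<in> \<Omega> \<and> z \<in> \<Omega>"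
    using usc_sum_near_diagonal[OF K(1,3) usc bd] by metis
  obtain Bu where Bu: "\<And>y. y \<in> K \<Longrightarrow> u y \<le> Bu" using usc_on_attains_sup[OF usc(1) K(1,2)] by blast
  obtain Bw where Bw: "\<And>y. y \<in> K \<Longrightarrow> w y \<le> Bw" using usc_on_attains_sup[OF usc(2) K(1,2)] by blast
  obtain B where B: "\<And>y. y \<in> K \<Longrightarrow> norm y \<le> B" using compact_imp_bounded[OF K(1)] bounded_iff by blast
  \<comment> \<open>The total penalty is at most Bu + Bw - c at a point where the sum reaches c.
    With this \<open>k\<close>, a penalty of at most A forces a displacement of at most
    \<delta>/4.\<close>
  define A where "A = \<bar>Bu + Bw - c\<bar> + 1"
  define k where "k = A * (4 / \<delta>)\<^sup>2"
  have k: "k > 0" using \<delta>(1) by (simp add: k_def A_def)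
  define U where "U = supconv k K u"
  define W where "W = supconv k K w"
  \<comment> \<open>The two displacements of at most \<delta>/4 and the shift, which is below
    \<delta>/2, place y and z within \<delta> of each other.\<close>
  have key: "y \<in> \<Omega> \<and> z \<in> \<Omega> \<and> norm (x - z) \<le> \<delta>"
    if "norm h < \<delta> / 2" "U (x + h) + W x \<ge> c" and y: "y \<in> K" "U (x + h) = u y - k * (norm (x + h - y))\<^sup>2"
      and z: "z \<in> K" "W x = w z - k * (norm (x - z))\<^sup>2" for h x y z
  proof -
    have sum: "u y + w z - k * (norm (x + h - y))\<^sup>2 - k * (norm (x - z))\<^sup>2 \<ge> c"
      using that by simp
    have pos: "k * (norm (x + h - y))\<^sup>2 \<ge> 0" "k * (norm (x - z))\<^sup>2 \<ge> 0" using k by auto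
    have small: "norm v \<le> \<delta> / 4" if "k * (norm v)\<^sup>2 \<le> A" for v :: 'a
    proof (rule power2_le_imp_le)
      have "A > 0" by (simp add: A_def)
      have "A * ((4 / \<delta>) * norm v)\<^sup>2 = k * (norm v)\<^sup>2"
        unfolding k_def power_mult_distrib by (simp only: mult.assoc)
      then have "A * ((4 / \<delta>) * norm v)\<^sup>2 \<le> A * 1" using that by simp
      then have "((4 / \<delta>) * norm v)\<^sup>2 \<le> 1" using \<open>A > 0\<close> by (simp only: mult_le_cancel_left_pos)
      then show "(norm v)\<^sup>2 \<le> (\<delta> / 4)\<^sup>2" using \<delta>(1) by (simp add: power_mult_distrib power_divide field_simps)
    qed (use \<delta> in auto)
    have n1: "norm (x + h - y) \<le> \<delta> / 4"
      using sum pos Bu[OF y(1)] Bw[OF z(1)] by (intro small) (simp add: A_def)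
    have n2: "norm (x - z) \<le> \<delta> / 4"
      using sum pos Bu[OF y(1)] Bw[OF z(1)] by (intro small) (simp add: A_def)
    have "norm (y - z) \<le> norm (x + h - y) + norm (x - z) + norm h"
    proof -
      have "y - z = (x - z) + h - (x + h - y)" by simp
      then show ?thesis
        using norm_triangle_ineq4[of "(x - z) + h" "x + h - y"] norm_triangle_ineq[of "x - z" h] by simp
    qed
    then have "norm (y - z) < \<delta>" using n1 n2 that(1) \<delta>(1) by linarith
    moreover have "u y + w z \<ge> c" using sum pos by linarith
    ultimately show ?thesis using \<delta> y(1) z(1) n2 by force
  qed
  have attU: "\<exists>y\<in>K. U x = u y - k * (norm (x - y))\<^sup>2" for x
    unfolding U_def using supconv_attained[OF K(1,2) usc(1)] by metis
  have attW: "\<exists>y\<in>K. W x = w y - k * (norm (x - y))\<^sup>2" for x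
    unfolding W_def using supconv_attained[OF K(1,2) usc(2)] by metis
  have "U x + W x \<le> c"
  proof (rule no_excess[where k = k and U = U and W = W and x = x and c = c and ?r0.0 = "\<delta> / 2" and B = "B + \<delta>", OF _ ab \<open>\<kappa> > 0\<close>])
    show "k \<ge> 0" using k by simp
    show "semiconvex k U" unfolding U_def by (intro semiconvex_supconv K usc)
    show "semiconvex k W" unfolding W_def by (intro semiconvex_supconv K usc)
    show "\<delta> / 2 > 0" using \<delta> by simp
  next
    fix h x q H assume h: "norm h < \<delta> / 2" "U (x + h) + W x \<ge> c" and jet: "superjet UNIV U (x + h) q H" "q \<noteq> 0"
    obtain y where y: "y \<in> K" "U (x + h) = u y - k * (norm (x + h - y))\<^sup>2" "superjet K u y q H"
      using supconv_jets[OF K(1,2) usc(1)] jet(1) unfolding U_def by metis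
    obtain z where z: "z \<in> K" "W x = w z - k * (norm (x - z))\<^sup>2" using attW by blast
    show "nlap a b q H \<ge> \<kappa> * (norm q)\<^sup>2"
      using key[OF h y(1,2) z] ju[OF y(1) _ y(3) jet(2)] by blast
  next
    fix h x q H assume h: "norm h < \<delta> / 2" "U (x + h) + W x \<ge> c" and jet: "superjet UNIV W x q H" "q \<noteq> 0"
    obtain z where z: "z \<in> K" "W x = w z - k * (norm (x - z))\<^sup>2" "superjet K w z q H"
      using supconv_jets[OF K(1,2) usc(2)] jet(1) unfolding W_def by metis
    obtain y where y: "y \<in> K" "U (x + h) = u y - k * (norm (x + h - y))\<^sup>2" using attU by blast
    show "nlap a b q H \<ge> 0"
      using key[OF h y z(1,2)] jw[OF z(1) _ z(3) jet(2)] by blast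
  next
    fix h x assume h: "norm h < \<delta> / 2" "U (x + h) + W x \<ge> c"
    obtain z where z: "z \<in> K" "W x = w z - k * (norm (x - z))\<^sup>2" using attW by blast
    obtain y where y: "y \<in> K" "U (x + h) = u y - k * (norm (x + h - y))\<^sup>2" using attU by blast
    have "norm (x - z) \<le> \<delta>" using key[OF h y z] by blast
    then show "norm x \<le> B + \<delta>" using B[OF z(1)] norm_triangle_sub[of x z] by linarith
  qed
  moreover have "u x \<le> U x"
    using supconv_attained[OF K(1,2) usc(1)] x unfolding U_def
    by (metis (no_types, lifting) diff_zero mult_zero_right norm_zero power_zero_numeral right_minus_eq)
  moreover have "w x \<le> W x"
    using supconv_attained[OF K(1,2) usc(2)] x unfolding W_def
    by (metis (no_types, lifting) diff_zero mult_zero_right norm_zero power_zero_numeral right_minus_eq)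
  ultimately show ?thesis by linarith
qed

text \<open>\<open>f\<close> is the increasing convex inverse of t \<mapsto> M + (1 - exp (-
  \<delta> (t - M))) / \<delta>, and a perturbation of the identity of order \<delta> on bounded
  ranges. The two estimates are those of the logarithm, ln (1 + t) \<le> t and t - t^2 \<le> ln (1 +
  t).\<close>

lemma strictify_bounds:
  fixes s M \<delta> :: real
  assumes "\<delta> > 0" "s \<le> M"
  defines "f \<equiv> \<lambda>s. M - ln (1 + \<delta> * (M - s)) / \<delta>"
  shows "s \<le> f s" and "\<delta> * (M - s) \<le> 1 \<Longrightarrow> f s \<le> s + \<delta> * (M - s)\<^sup>2"
    and "s = M + (1 - exp (- \<delta> * (f s - M))) / \<delta>"
proof -
  define t where "t = \<delta> * (M - s)"
  have t: "t \<ge> 0" using assms by (simp add: t_def)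
  have fs: "f s = M - ln (1 + t) / \<delta>" by (simp add: f_def t_def)
  have st: "s = M - t / \<delta>" using assms by (simp add: t_def)
  have "ln (1 + t) / \<delta> \<le> t / \<delta>" using ln_add_one_self_le_self[OF t] assms by (intro divide_right_mono) auto
  then show "s \<le> f s" using fs st by linarith
  show "f s \<le> s + \<delta> * (M - s)\<^sup>2" if "\<delta> * (M - s) \<le> 1"
  proof -
    have "t - t\<^sup>2 \<le> ln (1 + t)" using ln_one_plus_pos_lower_bound[OF t] that by (simp add: t_def)
    then have "(t - t\<^sup>2) / \<delta> \<le> ln (1 + t) / \<delta>" using assms by (intro divide_right_mono) auto
    moreover have "(t - t\<^sup>2) / \<delta> = (M - s) - \<delta> * (M - s)\<^sup>2"
      using assms by (simp add: t_def field_simps power2_eq_square)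
    ultimately show ?thesis using fs by linarith
  qed
  have "- \<delta> * (f s - M) = ln (1 + t)" using assms fs by simp
  then have "exp (- \<delta> * (f s - M)) = 1 + t" using t by (simp add: exp_ln)
  then show "s = M + (1 - exp (- \<delta> * (f s - M))) / \<delta>" using st by simp
qed

text \<open>After \<open>u\<close> is replaced by \<open>f (u y)\<close>, the level \<theta>/2
  separates the boundary values, which have grown by a small amount, from the excess \<theta> at
  \<open>x\<close>.\<close>

lemma comparison:
  fixes u w :: "'a::euclidean_space \<Rightarrow> real"
  assumes K: "compact K" "open \<Omega>" and usc: "usc_on K u" "usc_on K w"
    and ab: "a \<ge> 0" "a + b > 0"
    and ju: "\<And>x q H. x \<in> K \<Longrightarrow> x \<in> \<Omega> \<Longrightarrow> superjet K u x q H \<Longrightarrow> q \<noteq> 0 \<Longrightarrow> nlap a b q H \<ge> 0"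
    and jw: "\<And>x q H. x \<in> K \<Longrightarrow> x \<in> \<Omega> \<Longrightarrow> superjet K w x q H \<Longrightarrow> q \<noteq> 0 \<Longrightarrow> nlap a b q H \<ge> 0"
    and bd: "\<And>x. x \<in> K \<Longrightarrow> x \<notin> \<Omega> \<Longrightarrow> u x + w x \<le> 0" and x: "x \<in> K"
  shows "u x + w x \<le> 0"
proof (rule ccontr)
  assume "\<not> u x + w x \<le> 0"
  define \<theta> where "\<theta> = u x + w x"
  have \<theta>: "\<theta> > 0" using \<open>\<not> u x + w x \<le> 0\<close> by (simp add: \<theta>_def)
  have "K \<noteq> {}" using x by auto
  obtain M where M: "\<And>y. y \<in> K \<Longrightarrow> u y \<le> M" using usc_on_attains_sup[OF usc(1) K(1) \<open>K \<noteq> {}\<close>] by blast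
  obtain Bw where Bw: "\<And>y. y \<in> K \<Longrightarrow> w y \<le> Bw" using usc_on_attains_sup[OF usc(2) K(1) \<open>K \<noteq> {}\<close>] by blast
  \<comment> \<open>An upper semicontinuous \<open>u\<close> need not be bounded below, so
    \<open>f\<close> is not uniformly close to the identity on its range. Below M - L the values are
    too small to matter: even with Bw added the sum is negative.\<close>
  define L where "L = \<bar>M\<bar> + \<bar>Bw\<bar> + \<theta> + 1"
  have L: "L \<ge> 1" using \<theta> by (simp add: L_def)
  \<comment> \<open>Makes the perturbation \<delta> (M - s)^2 at most \<theta>/4 for s between M - L
    and M, and keeps \<delta> (M - s) \<le> 1.\<close>
  define \<delta> where "\<delta> = min 1 \<theta> / (4 * L\<^sup>2)"
  have \<delta>: "\<delta> > 0" using \<theta> L by (simp add: \<delta>_def)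
  have \<delta>L2: "\<delta> * L\<^sup>2 \<le> \<theta> / 4" "\<delta> * L\<^sup>2 \<le> 1" using L \<theta> by (auto simp: \<delta>_def)
  have "L * 1 \<le> L * L" using L by (intro mult_left_mono) auto
  then have "\<delta> * L \<le> \<delta> * L\<^sup>2" using \<delta> by (simp add: power2_eq_square)
  then have \<delta>L: "\<delta> * L \<le> 1" using \<delta>L2 by linarith
  define f where "f = (\<lambda>s. M - ln (1 + \<delta> * (M - s)) / \<delta>)"
  have f: "s \<le> f s" "\<delta> * (M - s) \<le> 1 \<Longrightarrow> f s \<le> s + \<delta> * (M - s)\<^sup>2"
    "s = M + (1 - exp (- \<delta> * (f s - M))) / \<delta>" if "s \<le> M" for s
    unfolding f_def by (fact strictify_bounds[OF \<delta> that])+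
  have f_upper: "f s \<le> s + \<theta> / 4" if "M - L \<le> s" "s \<le> M" for s
  proof -
    have "\<delta> * (M - s) \<le> \<delta> * L" "(M - s)\<^sup>2 \<le> L\<^sup>2" using that \<delta> by (auto intro!: mult_left_mono power_mono)
    moreover from this have "\<delta> * (M - s)\<^sup>2 \<le> \<delta> * L\<^sup>2" using \<delta> by (intro mult_left_mono) auto
    ultimately show ?thesis using f(2)[OF that(2)] \<delta>L \<delta>L2 by linarith
  qed
  have f_mono: "f s \<le> f t" if "s \<le> t" "t < M + 1 / \<delta>" for s t
  proof -
    have "\<delta> * (t - M) < 1" using that \<delta> by (simp add: field_simps)
    then have pos: "1 + \<delta> * (M - t) > 0" by (simp add: algebra_simps)
    moreover have "1 + \<delta> * (M - t) \<le> 1 + \<delta> * (M - s)" using that \<delta> by simp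
    ultimately have "ln (1 + \<delta> * (M - t)) \<le> ln (1 + \<delta> * (M - s))" by (subst ln_le_cancel_iff) auto
    then show ?thesis using \<delta> by (simp add: f_def divide_right_mono)
  qed
  have f_cont: "continuous_on {..<M + 1 / \<delta>} f"
  proof -
    have "1 + \<delta> * (M - s) \<noteq> 0" if "s < M + 1 / \<delta>" for s
    proof -
      have "\<delta> * (s - M) < 1" using that \<delta> by (simp add: field_simps)
      then show ?thesis by (simp add: algebra_simps)
    qed
    then show ?thesis unfolding f_def using \<delta> by (intro continuous_intros) auto
  qed
  have M': "M < M + 1 / \<delta>" using \<delta> by simp
  have usc': "usc_on K (\<lambda>y. f (u y))"
  proof (rule usc_on_mono_compose[OF usc(1) f_cont])
    show "u y \<in> {..<M + 1 / \<delta>}" if "y \<in> K" for y using le_less_trans[OF M[OF that] M'] by simp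
    show "f s \<le> f t" if "s \<le> t" "t \<in> {..<M + 1 / \<delta>}" for s t using f_mono that by simp
  qed simp
  have bd': "f (u y) + w y < \<theta> / 2" if y: "y \<in> K" "y \<notin> \<Omega>" for y
  proof (cases "M - L \<le> u y")
    case True
    then show ?thesis using f_upper[OF True M[OF y(1)]] bd[OF y] \<theta> by linarith
  next
    case False
    then have "f (u y) \<le> f (M - L)" using L M' by (intro f_mono) linarith+
    also have "\<dots> \<le> M - L + \<theta> / 4" using L by (intro f_upper) auto
    finally show ?thesis using Bw[OF y(1)] \<theta> by (simp add: L_def)
  qed
  have inv: "u y = M + (1 - exp (- \<delta> * (f (u y) - M))) / \<delta>" if "y \<in> K" for y
    using f(3)[OF M[OF that]] .
  have "f (u x) + w x \<le> \<theta> / 2"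
  proof (rule strict_comparison[OF K(1) \<open>K \<noteq> {}\<close> K(2) usc' usc(2) ab _ _ jw bd' x])
    show "\<delta> * (a + b) > 0" using \<delta> ab by simp
    fix y q H assume "y \<in> K" "y \<in> \<Omega>" "superjet K (\<lambda>y. f (u y)) y q H" "q \<noteq> 0"
    then show "nlap a b q H \<ge> \<delta> * (a + b) * (norm q)\<^sup>2"
      using ju inv \<delta> by (intro superjet_strict[where u = u and w = "\<lambda>y. f (u y)" and M = M and S = K]) blast+
  qed
  moreover have "u x \<le> f (u x)" by (rule f(1)[OF M[OF x]])
  ultimately show False using \<theta> by (simp add: \<theta>_def)
qed

theorem proposition3p2:
  fixes p :: ereal
    and \<Omega> :: "'a::euclidean_space set"
    and g u v :: "'a \<Rightarrow> real"
  assumes "1 < p"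
    and "C2_domain \<Omega>" and "bounded \<Omega>"
    and "continuous_on (frontier \<Omega>) g"
    and "gen_visc_subsolution p \<Omega> g u"
    and "gen_visc_supersolution p \<Omega> g v"
  shows "\<forall>x\<in>closure \<Omega>. u x \<le> v x"
proof
  fix x assume x: "x \<in> closure \<Omega>"
  let ?K = "closure \<Omega>" let ?a = "lap_a p" let ?b = "lap_b p"
  have "open \<Omega>" using assms(2) by (simp add: C2_domain_def)
  have K: "compact ?K" "?K \<noteq> {}" using assms(3) x by auto
  have usc: "usc_on ?K u" "usc_on ?K (\<lambda>y. - v y)"
    using assms(5,6)
    by (auto simp: gen_visc_subsolution_def gen_visc_supersolution_def usc_on_def lsc_on_def minus_less_iff)
  obtain Bu where Bu: "\<And>y. y \<in> ?K \<Longrightarrow> u y \<le> Bu" using usc_on_attains_sup[OF usc(1) K] by blast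
  obtain Bv where Bv: "\<And>y. y \<in> ?K \<Longrightarrow> - v y \<le> Bv" using usc_on_attains_sup[OF usc(2) K] by blast
  note ab = lap_ab[OF assms(1)]
  note ju = subsolution_superjet[OF assms(5,3) Bu] and jv = supersolution_superjet[OF assms(6,3) Bv]
  have u_le: "u y \<le> g y" if "y \<in> frontier \<Omega>" for y
    using boundary_le[OF assms(2,3) ab(2) usc(1) assms(4) ju that] by blast
  \<comment> \<open>The boundary lemma only sees superjets, so it applies to - v with boundary data
    - g.\<close>
  have "continuous_on (frontier \<Omega>) (\<lambda>y. - g y)" using assms(4) by (intro continuous_on_minus)
  then have v_ge: "- v y \<le> - g y" if "y \<in> frontier \<Omega>" for y
    using boundary_le[OF assms(2,3) ab(2) usc(2) _ jv that] by blast
  have "u x + - v x \<le> 0"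
  proof (rule comparison[OF K(1) \<open>open \<Omega>\<close> usc ab _ _ _ x])
    fix y q H assume "y \<in> ?K" "y \<in> \<Omega>" "superjet ?K u y q H" "q \<noteq> 0"
    then show "nlap ?a ?b q H \<ge> 0" using ju by blast
  next
    fix y q H assume "y \<in> ?K" "y \<in> \<Omega>" "superjet ?K (\<lambda>y. - v y) y q H" "q \<noteq> 0"
    then show "nlap ?a ?b q H \<ge> 0" using jv by blast
  next
    fix y assume "y \<in> ?K" "y \<notin> \<Omega>"
    then have "y \<in> frontier \<Omega>" using \<open>open \<Omega>\<close> by (simp add: frontier_def interior_open)
    from u_le[OF this] v_ge[OF this] show "u y + - v y \<le> 0" by simp
  qed
  then show "u x \<le> v x" by simp
qed

end
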